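(* Let $k$ be a field, $C$ a coalgebra over $k$, $A$ an algebra over $k$ that is also a right $C$-comodule with coaction $\varrho^A:A\to A\otimes C$, and let $B\subseteq A$ be an entwined $C$-extension with bijective right-right entwining map $\psi:C\otimes A\to A\otimes C$. Let ${}^A\!\varrho:A\to C\otimes A$, ${}^A\!\varrho(a)=\psi^{-1}(a\varrho^A(1))$, be the induced left $C$-coaction. Assume that $C$ is a coseparable coalgebra with a cointegral $\delta:C\otimes C\to k$ and that the lifted canonical map $$\overline{\mathrm{can}}:A\otimes A\to A\otimes C,\qquad a\otimes a'\mapsto a\varrho^A(a'),$$ is surjective. Let $\sigma:C\to A\otimes A$ be a $k$-linear map such that $\overline{\mathrm{can}}(\sigma(c))=1\otimes c$ for all $c\in C$, and define maps $\gamma:C\otimes A\to A$ and $\alpha:A\otimes C\to A$ by $$\gamma=(\delta\otimes \mathrm{id}_A)\circ(\mathrm{id}_C\otimes {}^A\!\varrho),\qquad \alpha=(\mathrm{id}_A\otimes\delta)\circ(\varrho^A\otimes \mathrm{id}_C).$$ Then the map $\ell:C\to A\otimes A$ given by $$\ell=(\gamma\otimes\alpha)\circ(\mathrm{id}_C\otimes\sigma\otimes \mathrm{id}_C)\circ(\Delta\otimes \mathrm{id}_C)\circ\Delta$$ is a strong connection form. Furthermore, if $\varrho^A(1)=1\otimes e$ for a group-like element $e\in C$, then $B\subseteq A$ is a principal $C$-extension.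
   Context: Conventions. All unadorned tensor products are over the field $k$; algebras are associative and unital; $1$ is the unit of $A$ and $\mu:A\otimes A\to A$ the product; $\Delta$ and $\varepsilon$ are the coproduct and counit of the coalgebra $C$ (coassociative and counital). Sweedler notation (summation suppressed): $\Delta(c)=c_{(1)}\otimes c_{(2)}$, $\varrho^A(a)=a_{(0)}\otimes a_{(1)}$. For $a\in A$ and $x=\sum a_i\otimes c_i\in A\otimes C$, $ax=\sum aa_i\otimes c_i$. An element $e\in C$ is group-like if $\Delta(e)=e\otimes e$ and $\varepsilon(e)=1$. Coinvariants. For an algebra $A$ that is a right $C$-comodule, $A^{co C}=\{b\in A : \varrho^A(ba)=b\varrho^A(a)\ \text{for all } a\in A\}$, a subalgebra of $A$. (No compatibility of the coaction with the product is assumed beyond what is stated below.) Right-right entwining map. A $k$-linear map $\psi:C\otimes A\to A\otimes C$ such that $$\psi\circ(\mathrm{id}_C\otimes\mu)=(\mu\otimes \mathrm{id}_C)\circ(\mathrm{id}_A\otimes\psi)\circ(\psi\otimes \mathrm{id}_A),\qquad \psi(c\otimes 1)=1\otimes c,$$ $$(\mathrm{id}_A\otimes\Delta)\circ\psi=(\psi\otimes \mathrm{id}_C)\circ(\mathrm{id}_C\otimes\psi)\circ(\Delta\otimes \mathrm{id}_A),\qquad (\mathrm{id}_A\otimes\varepsilon)\circ\psi=\varepsilon\otimes \mathrm{id}_A .$$ Entwined $C$-extension. Let $C$ be a coalgebra and $A$ an algebra and a right $C$-comodule. An inclusion of algebras $B\subseteq A$ is an entwined $C$-extension if $B=A^{co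 C}$ and there is a bijective right-right entwining map $\psi:C\otimes A\to A\otimes C$ such that $\varrho^A(a\tilde a)=a_{(0)}\psi(a_{(1)}\otimes\tilde a)$ for all $a,\tilde a\in A$. In this case ${}^A\!\varrho(a)=\psi^{-1}(a\varrho^A(1))$ makes $A$ a left $C$-comodule. Strong connection form. For an entwined $C$-extension $B\subseteq A$, a strong connection form is a $k$-linear map $\ell:C\to A\otimes A$ such that (a) $\overline{\mathrm{can}}(\ell(c))=1\otimes c$ for all $c\in C$; (b) $(\ell\otimes \mathrm{id}_C)\circ\Delta=(\mathrm{id}_A\otimes\varrho^A)\circ\ell$; (c) $(\mathrm{id}_C\otimes\ell)\circ\Delta=({}^A\!\varrho\otimes \mathrm{id}_A)\circ\ell$. Coseparable coalgebra and cointegral. $C$ is coseparable if the coproduct has a retraction in the category of $C$-bicomodules; equivalently, there is a cointegral, i.e. a $k$-linear map $\delta:C\otimes C\to k$ such that for all $c,c'\in C$ $$\delta(c_{(1)}\otimes c_{(2)})=\varepsilon(c),\qquad c_{(1)}\,\delta(c_{(2)}\otimes c')=\delta(c\otimes c'_{(1)})\,c'_{(2)}.$$ Principal $C$-extension. Let $C$ be a coalgebra, $A$ an algebra and a right $C$-comodule via $\varrho^A$, and $B=A^{co C}$. The inclusion $B\subseteq A$ is a principal $C$-extension (one also says that $A$ is a principal $C$-extension) if: (a) $\mathrm{can}:A\otimes_B A\to A\otimes C$, $a\otimes a'\mapsto a\varrho^A(a')$, is bijective; (b) $A$ is $C$-equivariantly projective as a left $B$-module, i.e. there is a left $B$-linear,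 right $C$-colinear section $s:A\to B\otimes A$ of the product map $B\otimes A\to A$ (where $B\otimes A$ has the right coaction $\mathrm{id}_B\otimes\varrho^A$); (c) the map $C\otimes A\to A\otimes C$, $c\otimes a\mapsto \mathrm{can}(\mathrm{can}^{-1}(1\otimes c)a)$, is bijective (here $A\otimes_B A$ is a right $A$-module by multiplication in the second factor); (d) there is a group-like element $e\in C$ such that $\varrho^A(a)=\psi(e\otimes a)$ for all $a\in A$, where $\psi$ is the map in (c). *)

theory Defs
  imports "HOL-Algebra.Free_Abelian_Groups" "HOL-Algebra.Generated_Groups" "HOL-Algebra.Module"
begin

section \<open>Tensor products\<close>

text \<open>
  The tensor product of \<open>M\<close> and \<open>N\<close> over a set \<open>S\<close> of scalars acting by \<open>r\<close> on the right of \<open>M\<close>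
  and by \<open>l\<close> on the left of \<open>N\<close> is the free abelian group on \<open>carrier M \<times> carrier N\<close> modulo the
  biadditivity and balancing relations. It is packaged as a \<open>ring\<close> record whose
  multiplicative part is irrelevant, as \<^locale>\<open>abelian_group\<close> expects.
\<close>

type_synonym ('m, 'n) tensor = "('m \<times> 'n \<Rightarrow>\<^sub>0 int) set"

definition balancing_relators ::
  "'s set \<Rightarrow> ('m \<Rightarrow> 's \<Rightarrow> 'm) \<Rightarrow> ('s \<Rightarrow> 'n \<Rightarrow> 'n) \<Rightarrow> ('m, 'x) ring_scheme \<Rightarrow> ('n, 'y) ring_scheme
    \<Rightarrow> ('m, 'n) tensor" where
  "balancing_relators S r l M N =
     {frag_of (x \<oplus>\<^bsub>M\<^esub> x', y) - frag_of (x, y) - frag_of (x', y) | x x' y.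
        x \<in> carrier M \<and> x' \<in> carrier M \<and> y \<in> carrier N} \<union>
     {frag_of (x, y \<oplus>\<^bsub>N\<^esub> y') - frag_of (x, y) - frag_of (x, y') | x y y'.
        x \<in> carrier M \<and> y \<in> carrier N \<and> y' \<in> carrier N} \<union>
     {frag_of (r x s, y) - frag_of (x, l s y) | x s y.
        x \<in> carrier M \<and> s \<in> S \<and> y \<in> carrier N}"

definition balanced_tensor ::
  "'s set \<Rightarrow> ('m \<Rightarrow> 's \<Rightarrow> 'm) \<Rightarrow> ('s \<Rightarrow> 'n \<Rightarrow> 'n) \<Rightarrow> ('m, 'x) ring_scheme \<Rightarrow> ('n, 'y) ring_scheme
    \<Rightarrow> ('m, 'n) tensor ring" where
  "balanced_tensor S r l M N =
     (let F = free_Abelian_group (carrier M \<times> carrier N);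
          Q = F Mod generate F (balancing_relators S r l M N)
      in \<lparr>carrier = carrier Q, monoid.mult = undefined, one = undefined,
          zero = \<one>\<^bsub>Q\<^esub>, add = monoid.mult Q\<rparr>)"

text \<open>
  The zero of a tensor product is the subgroup of relations, so the class of a generator is the
  translate of the zero.
\<close>

definition pure_tensor :: "(('m, 'n) tensor, 'x) ring_scheme \<Rightarrow> 'm \<Rightarrow> 'n \<Rightarrow> ('m, 'n) tensor"
    (infixl \<open>\<diamondop>\<index>\<close> 75) where
  "x \<diamondop>\<^bsub>T\<^esub> y = (\<lambda>z. z + frag_of (x, y)) ` \<zero>\<^bsub>T\<^esub>"

text \<open>
  The additive map \<open>T \<rightarrow> P\<close>, for \<open>T\<close> a tensor product of \<open>M\<close> and \<open>N\<close>, given on pure tensors by \<open>f\<close>;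
  it exists and is unique for biadditive balanced \<open>f\<close>, by \<open>tensor_lift_hom\<close>, \<open>tensor_lift_pure\<close> and
  \<open>balanced_tensor_hom_eqI\<close> below.
\<close>

definition tensor_lift ::
  "('m, 'x) ring_scheme \<Rightarrow> ('n, 'y) ring_scheme \<Rightarrow> (('m, 'n) tensor, 'z) ring_scheme
    \<Rightarrow> ('p, 'w) ring_scheme \<Rightarrow> ('m \<Rightarrow> 'n \<Rightarrow> 'p) \<Rightarrow> ('m, 'n) tensor \<Rightarrow> 'p" where
  "tensor_lift M N T P f =
     (THE h. h \<in> hom (add_monoid T) (add_monoid P) \<and> h \<in> extensional (carrier T) \<and>
             (\<forall>x\<in>carrier M. \<forall>y\<in>carrier N. h (x \<diamondop>\<^bsub>T\<^esub> y) = f x y))"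

definition balanced_actions ::
  "'s set \<Rightarrow> ('m \<Rightarrow> 's \<Rightarrow> 'm) \<Rightarrow> ('s \<Rightarrow> 'n \<Rightarrow> 'n) \<Rightarrow> ('m, 'x) ring_scheme \<Rightarrow> ('n, 'y) ring_scheme
    \<Rightarrow> bool" where
  "balanced_actions S r l M N \<longleftrightarrow>
     abelian_group M \<and> abelian_group N \<and>
     (\<forall>x\<in>carrier M. \<forall>s\<in>S. r x s \<in> carrier M) \<and> (\<forall>s\<in>S. \<forall>y\<in>carrier N. l s y \<in> carrier N)"

lemma relators_subgroup:
  assumes "balanced_actions S r l M N"
  defines "F \<equiv> free_Abelian_group (carrier M \<times> carrier N)"
  shows "balancing_relators S r l M N \<subseteq> carrier F"
    and "generate F (balancing_relators S r l M N) \<lhd> F"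
proof -
  interpret M: abelian_group M using assms by (simp add: balanced_actions_def)
  interpret N: abelian_group N using assms by (simp add: balanced_actions_def)
  interpret F: comm_group F unfolding F_def by (rule abelian_free_Abelian_group)
  have diff: "a - b \<in> carrier F" if "a \<in> carrier F" "b \<in> carrier F" for a b
    using that keys_diff[of a b] by (auto simp: F_def)
  have one: "frag_of (x, y) \<in> carrier F" if "x \<in> carrier M" "y \<in> carrier N" for x y
    using that by (simp add: F_def)
  show sub: "balancing_relators S r l M N \<subseteq> carrier F"
    using assms(1) unfolding balancing_relators_def balanced_actions_def
    by (auto intro!: diff one simp del: carrier_free_Abelian_group_iff)
  show "generate F (balancing_relators S r l M N) \<lhd> F"
    by (rule F.subgroup_imp_normal[OF F.generate_is_subgroup[OF sub]])
qed

lemma balanced_tensor_facts: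
  assumes "balanced_actions S r l M N"
  defines "F \<equiv> free_Abelian_group (carrier M \<times> carrier N)"
  defines "H \<equiv> generate F (balancing_relators S r l M N)"
  defines "T \<equiv> balanced_tensor S r l M N"
  shows "add_monoid T = F Mod H"
    and "abelian_group T"
    and "x \<diamondop>\<^bsub>T\<^esub> y = H #>\<^bsub>F\<^esub> frag_of (x, y)"
    and "\<lbrakk>x \<in> carrier M; y \<in> carrier N\<rbrakk> \<Longrightarrow> x \<diamondop>\<^bsub>T\<^esub> y \<in> carrier T"
proof -
  interpret F: comm_group F unfolding F_def by (rule abelian_free_Abelian_group)
  interpret H: normal H F using relators_subgroup(2)[OF assms(1)] by (simp add: H_def F_def)
  show eq: "add_monoid T = F Mod H"
    by (simp add: T_def balanced_tensor_def Let_def F_def H_def FactGroup_def)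
  have "comm_group (add_monoid T)"
    unfolding eq by (rule F.abelian_FactGroup) (rule H.subgroup_axioms)
  then show "abelian_group T"
    by (intro abelian_group.intro abelian_monoid.intro abelian_group_axioms.intro comm_group.axioms)
  show p: "x \<diamondop>\<^bsub>T\<^esub> y = H #>\<^bsub>F\<^esub> frag_of (x, y)" for x y
    by (auto simp: pure_tensor_def T_def balanced_tensor_def Let_def r_coset_def F_def H_def)
  have c: "carrier T = carrier (F Mod H)"
    by (metis eq partial_object.select_convs(1))
  show "x \<diamondop>\<^bsub>T\<^esub> y \<in> carrier T" if "x \<in> carrier M" "y \<in> carrier N"
    using that unfolding p c carrier_FactGroup by (auto simp: F_def)
qed

lemma balanced_tensor_hom_eqI:
  assumes "balanced_actions S r l M N" and "group (add_monoid P)"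
  defines "T \<equiv> balanced_tensor S r l M N"
  assumes "h \<in> hom (add_monoid T) (add_monoid P)" and "h' \<in> hom (add_monoid T) (add_monoid P)"
    and eq: "\<And>x y. \<lbrakk>x \<in> carrier M; y \<in> carrier N\<rbrakk> \<Longrightarrow> h (x \<diamondop>\<^bsub>T\<^esub> y) = h' (x \<diamondop>\<^bsub>T\<^esub> y)"
    and z: "z \<in> carrier T"
  shows "h z = h' z"
proof -
  define F where "F = free_Abelian_group (carrier M \<times> carrier N)"
  define H where "H = generate F (balancing_relators S r l M N)"
  note facts = balanced_tensor_facts[OF assms(1), folded T_def F_def, folded H_def]
  interpret F: comm_group F unfolding F_def by (rule abelian_free_Abelian_group)
  interpret H: normal H F using relators_subgroup(2)[OF assms(1)] by (simp add: H_def F_def)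
  interpret P: group "add_monoid P" by fact
  have q: "(\<lambda>c. H #>\<^bsub>F\<^esub> c) \<in> hom F (F Mod H)" by (rule H.r_coset_hom_Mod)
  have g: "group_hom F (add_monoid P) (\<lambda>c. k (H #>\<^bsub>F\<^esub> c))"
    if "k \<in> hom (add_monoid T) (add_monoid P)" for k
  proof -
    have "k \<in> hom (F Mod H) (add_monoid P)" using that by (simp only: facts(1))
    from hom_compose[OF q this] show ?thesis
      by (simp add: o_def group_hom_def group_hom_axioms_def F.is_group P.is_group)
  qed
  interpret h: group_hom F "add_monoid P" "\<lambda>c. h (H #>\<^bsub>F\<^esub> c)" by (rule g) fact
  interpret h': group_hom F "add_monoid P" "\<lambda>c. h' (H #>\<^bsub>F\<^esub> c)" by (rule g) fact
  have "h (H #>\<^bsub>F\<^esub> c) = h' (H #>\<^bsub>F\<^esub> c)" if "Poly_Mapping.keys c \<subseteq> carrier M \<times> carrier N" for c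
    using that
  proof (induction rule: free_Abelian_group_induct[consumes 1])
    case 1
    show ?case using h.hom_one h'.hom_one by (simp add: F_def)
  next
    case (2 a b)
    then have ab: "a \<in> carrier F" "b \<in> carrier F" and "a - b = a \<otimes>\<^bsub>F\<^esub> inv\<^bsub>F\<^esub> b"
      by (simp_all add: F_def)
    then show ?case
      using 2 h.hom_mult[of a "inv\<^bsub>F\<^esub> b"] h'.hom_mult[of a "inv\<^bsub>F\<^esub> b"] h.hom_inv[of b] h'.hom_inv[of b]
      by simp
  next
    case (3 p)
    then show ?case using eq by (cases p) (auto simp: facts(3))
  qed
  moreover have "z \<in> carrier (F Mod H)" using z facts(1) by (metis partial_object.select_convs(1))
  ultimately show ?thesis by (auto simp: carrier_FactGroup F_def)
qed

lemma
  assumes act: "balanced_actions S r l M N" and P: "abelian_group P"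
  defines "T \<equiv> balanced_tensor S r l M N"
  assumes closed: "\<And>x y. \<lbrakk>x \<in> carrier M; y \<in> carrier N\<rbrakk> \<Longrightarrow> f x y \<in> carrier P"
    and add_left: "\<And>x x' y. \<lbrakk>x \<in> carrier M; x' \<in> carrier M; y \<in> carrier N\<rbrakk>
          \<Longrightarrow> f (x \<oplus>\<^bsub>M\<^esub> x') y = f x y \<oplus>\<^bsub>P\<^esub> f x' y"
    and add_right: "\<And>x y y'. \<lbrakk>x \<in> carrier M; y \<in> carrier N; y' \<in> carrier N\<rbrakk>
          \<Longrightarrow> f x (y \<oplus>\<^bsub>N\<^esub> y') = f x y \<oplus>\<^bsub>P\<^esub> f x y'"
    and balanced: "\<And>x s y. \<lbrakk>x \<in> carrier M; s \<in> S; y \<in> carrier N\<rbrakk> \<Longrightarrow> f (r x s) y = f x (l s y)"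
  shows tensor_lift_hom: "tensor_lift M N T P f \<in> hom (add_monoid T) (add_monoid P)"
    and tensor_lift_pure: "\<lbrakk>x \<in> carrier M; y \<in> carrier N\<rbrakk> \<Longrightarrow> tensor_lift M N T P f (x \<diamondop>\<^bsub>T\<^esub> y) = f x y"
proof -
  define F where "F = free_Abelian_group (carrier M \<times> carrier N)"
  define R where "R = balancing_relators S r l M N"
  define H where "H = generate F R"
  note facts = balanced_tensor_facts[OF act, folded T_def F_def R_def, folded H_def]
  interpret M: abelian_group M using act by (simp add: balanced_actions_def)
  interpret N: abelian_group N using act by (simp add: balanced_actions_def)
  interpret P: abelian_group P by fact
  have PG: "group (add_monoid P)" by (rule P.a_group)
  interpret F: comm_group F unfolding F_def by (rule abelian_free_Abelian_group)
  have R: "R \<subseteq> carrier F" using relators_subgroup(1)[OF act] by (simp add: R_def F_def)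
  have normal: "H \<lhd> F" using relators_subgroup(2)[OF act] by (simp add: H_def R_def F_def)
  have im: "case_prod f ` (carrier M \<times> carrier N) \<subseteq> carrier P" using closed by auto
  obtain g where g: "g \<in> hom F (add_monoid P)"
    and gp: "\<And>p. p \<in> carrier M \<times> carrier N \<Longrightarrow> g (frag_of p) = case_prod f p"
    unfolding F_def
  proof (rule comm_group.free_Abelian_group_universal[OF P.a_comm_group])
    show "case_prod f ` (carrier M \<times> carrier N) \<subseteq> carrier (add_monoid P)"
      using im by simp
  qed blast
  interpret g: group_hom F "add_monoid P" g
    by (rule group_hom.intro) (auto simp: group_hom_axioms_def g F.is_group PG)
  have gdiff: "g (a - b) = g a \<ominus>\<^bsub>P\<^esub> g b" if "a \<in> carrier F" "b \<in> carrier F" for a b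
  proof -
    have "a - b = a \<otimes>\<^bsub>F\<^esub> inv\<^bsub>F\<^esub> b" using that by (simp add: F_def)
    then show ?thesis
      using g.hom_mult[of a "inv\<^bsub>F\<^esub> b"] g.hom_inv[of b] that by (simp add: a_minus_def a_inv_def)
  qed
  have cancel: "u \<oplus>\<^bsub>P\<^esub> v \<ominus>\<^bsub>P\<^esub> u \<ominus>\<^bsub>P\<^esub> v = \<zero>\<^bsub>P\<^esub>" if "u \<in> carrier P" "v \<in> carrier P" for u v
  proof -
    have "u \<oplus>\<^bsub>P\<^esub> v \<ominus>\<^bsub>P\<^esub> u = v"
      using that by (simp add: P.minus_eq P.a_comm[of u v] P.a_assoc P.r_neg)
    then show ?thesis using that by (simp add: P.minus_eq P.r_neg)
  qed
  have fc: "frag_of (x, y) \<in> carrier F" if "x \<in> carrier M" "y \<in> carrier N" for x y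
    using that by (simp add: F_def)
  have dc: "a - b \<in> carrier F" if "a \<in> carrier F" "b \<in> carrier F" for a b
    using that keys_diff[of a b] by (auto simp: F_def)
  have "c \<in> kernel F (add_monoid P) g" if "c \<in> R" for c
  proof -
    have "g c = \<zero>\<^bsub>P\<^esub>"
      using that unfolding R_def balancing_relators_def
    proof (elim UnE CollectE exE conjE)
      fix x x' y assume "c = frag_of (x \<oplus>\<^bsub>M\<^esub> x', y) - frag_of (x, y) - frag_of (x', y)"
        and [simp]: "x \<in> carrier M" "x' \<in> carrier M" "y \<in> carrier N"
      then have "g c = f x y \<oplus>\<^bsub>P\<^esub> f x' y \<ominus>\<^bsub>P\<^esub> f x y \<ominus>\<^bsub>P\<^esub> f x' y"
        by (simp add: gdiff fc dc gp add_left)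
      then show ?thesis
        by (simp add: cancel closed)
    next
      fix x y y' assume "c = frag_of (x, y \<oplus>\<^bsub>N\<^esub> y') - frag_of (x, y) - frag_of (x, y')"
        and [simp]: "x \<in> carrier M" "y \<in> carrier N" "y' \<in> carrier N"
      then have "g c = f x y \<oplus>\<^bsub>P\<^esub> f x y' \<ominus>\<^bsub>P\<^esub> f x y \<ominus>\<^bsub>P\<^esub> f x y'"
        by (simp add: gdiff fc dc gp add_right)
      then show ?thesis
        by (simp add: cancel closed)
    next
      fix x s y assume c: "c = frag_of (r x s, y) - frag_of (x, l s y)"
        and [simp]: "x \<in> carrier M" "s \<in> S" "y \<in> carrier N"
      have [simp]: "r x s \<in> carrier M" "l s y \<in> carrier N" using act by (simp_all add: balanced_actions_def)
      have "g c = f (r x s) y \<ominus>\<^bsub>P\<^esub> f x (l s y)" unfolding c by (simp add: gdiff fc gp)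
      then show ?thesis by (simp add: balanced closed P.minus_eq P.r_neg)
    qed
    then show ?thesis using that R by (auto simp: kernel_def)
  qed
  then have "H \<subseteq> kernel F (add_monoid P) g"
    unfolding H_def by (intro F.generate_subgroup_incl g.subgroup_kernel) auto
  then have g_H: "\<forall>c\<in>H. g c = \<one>\<^bsub>add_monoid P\<^esub>" by (auto simp: kernel_def)
  have sg: "subgroup H F" using normal by (simp add: normal_def)
  have resp: "g x = g y"
    if x: "x \<in> carrier F" and y: "y \<in> carrier F" and xy: "H #>\<^bsub>F\<^esub> x = H #>\<^bsub>F\<^esub> y" for x y
  proof -
    obtain c where c: "c \<in> H" "x = c \<otimes>\<^bsub>F\<^esub> y"
      using F.rcos_self[OF x sg] xy by (auto simp: r_coset_def)
    have "c \<in> carrier F" using subgroup.mem_carrier[OF sg c(1)] .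
    then show ?thesis using c g_H g.hom_mult[of c y] g.hom_closed[OF y] y by simp
  qed
  from FactGroup_universal[OF g normal resp]
  obtain h where h: "h \<in> hom (F Mod H) (add_monoid P)"
    and hg: "\<And>c. c \<in> carrier F \<Longrightarrow> h (H #>\<^bsub>F\<^esub> c) = g c" by blast
  have carr: "carrier (F Mod H) = carrier T" by (metis facts(1) partial_object.select_convs(1))
  let ?h = "restrict h (carrier T)"
  interpret Q: group "F Mod H" by (rule normal.factorgroup_is_group[OF normal])
  have h1: "?h \<in> hom (add_monoid T) (add_monoid P)"
  proof -
    have "monoid.mult (add_monoid T) = set_mult F" by (simp only: facts(1) mult_FactGroup)
    then have add: "add T = set_mult F" by simp
    show ?thesis
      using h Q.m_closed by (auto simp: hom_def add carr)
  qed
  have "?h (x \<diamondop>\<^bsub>T\<^esub> y) = f x y" if "x \<in> carrier M" "y \<in> carrier N" for x y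
    using that facts(3,4)[of x y] hg[of "frag_of (x, y)"] gp[of "(x, y)"] fc by simp
  then have ex: "?h \<in> hom (add_monoid T) (add_monoid P) \<and> ?h \<in> extensional (carrier T) \<and>
      (\<forall>x\<in>carrier M. \<forall>y\<in>carrier N. ?h (x \<diamondop>\<^bsub>T\<^esub> y) = f x y)"
    using h1 by auto
  have "\<exists>!h. h \<in> hom (add_monoid T) (add_monoid P) \<and> h \<in> extensional (carrier T) \<and>
      (\<forall>x\<in>carrier M. \<forall>y\<in>carrier N. h (x \<diamondop>\<^bsub>T\<^esub> y) = f x y)"
  proof (rule ex1I, rule ex)
    fix k assume k: "k \<in> hom (add_monoid T) (add_monoid P) \<and> k \<in> extensional (carrier T) \<and>
      (\<forall>x\<in>carrier M. \<forall>y\<in>carrier N. k (x \<diamondop>\<^bsub>T\<^esub> y) = f x y)"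
    show "k = ?h"
    proof (rule extensionalityI[of _ "carrier T"])
      fix z assume z: "z \<in> carrier T"
      show "k z = ?h z"
        by (rule balanced_tensor_hom_eqI[OF act PG, folded T_def, OF conjunct1[OF k] h1 _ z])
          (use k ex in auto)
    qed (use k in auto)
  qed
  from theI'[OF this, folded tensor_lift_def]
  show "tensor_lift M N T P f \<in> hom (add_monoid T) (add_monoid P)"
    and "\<lbrakk>x \<in> carrier M; y \<in> carrier N\<rbrakk> \<Longrightarrow> tensor_lift M N T P f (x \<diamondop>\<^bsub>T\<^esub> y) = f x y"
    by auto
qed

definition tensor :: "'k ring \<Rightarrow> ('k, 'm) module \<Rightarrow> ('k, 'n) module \<Rightarrow> ('k, ('m, 'n) tensor) module" where
  "tensor K M N =
     (let T = balanced_tensor (carrier K) (\<lambda>x s. s \<odot>\<^bsub>M\<^esub> x) (\<lambda>s y. s \<odot>\<^bsub>N\<^esub> y) M N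
      in \<lparr>carrier = carrier T, monoid.mult = undefined, one = undefined, zero = \<zero>\<^bsub>T\<^esub>, add = add T,
          smult = (\<lambda>s. tensor_lift M N T T (\<lambda>x y. (s \<odot>\<^bsub>M\<^esub> x) \<diamondop>\<^bsub>T\<^esub> y))\<rparr>)"

definition linear_maps :: "'k ring \<Rightarrow> ('k, 'm) module \<Rightarrow> ('k, 'n) module \<Rightarrow> ('m \<Rightarrow> 'n) set" where
  "linear_maps K M N =
     {f \<in> hom (add_monoid M) (add_monoid N).
        \<forall>s\<in>carrier K. \<forall>x\<in>carrier M. f (s \<odot>\<^bsub>M\<^esub> x) = s \<odot>\<^bsub>N\<^esub> f x}"

definition self_module :: "'k ring \<Rightarrow> ('k, 'k) module" where
  "self_module K = \<lparr>carrier = carrier K, monoid.mult = monoid.mult K, one = \<one>\<^bsub>K\<^esub>,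
     zero = \<zero>\<^bsub>K\<^esub>, add = add K, smult = monoid.mult K\<rparr>"

definition tensor_map ::
  "'k ring \<Rightarrow> ('k, 'm) module \<Rightarrow> ('k, 'n) module \<Rightarrow> ('k, 'p) module \<Rightarrow> ('k, 'q) module
    \<Rightarrow> ('m \<Rightarrow> 'p) \<Rightarrow> ('n \<Rightarrow> 'q) \<Rightarrow> ('m, 'n) tensor \<Rightarrow> ('p, 'q) tensor" where
  "tensor_map K M N P Q f g =
     tensor_lift M N (tensor K M N) (tensor K P Q) (\<lambda>x y. f x \<diamondop>\<^bsub>tensor K P Q\<^esub> g y)"

definition assoc_right ::
  "'k ring \<Rightarrow> ('k, 'm) module \<Rightarrow> ('k, 'n) module \<Rightarrow> ('k, 'p) module
    \<Rightarrow> (('m, 'n) tensor, 'p) tensor \<Rightarrow> ('m, ('n, 'p) tensor) tensor" where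
  "assoc_right K M N P =
     (let MN = tensor K M N; NP = tensor K N P; T = tensor K M NP
      in tensor_lift MN P (tensor K MN P) T
           (\<lambda>t z. tensor_lift M N MN T (\<lambda>x y. x \<diamondop>\<^bsub>T\<^esub> (y \<diamondop>\<^bsub>NP\<^esub> z)) t))"

definition assoc_left ::
  "'k ring \<Rightarrow> ('k, 'm) module \<Rightarrow> ('k, 'n) module \<Rightarrow> ('k, 'p) module
    \<Rightarrow> ('m, ('n, 'p) tensor) tensor \<Rightarrow> (('m, 'n) tensor, 'p) tensor" where
  "assoc_left K M N P =
     (let MN = tensor K M N; NP = tensor K N P; T = tensor K MN P
      in tensor_lift M NP (tensor K M NP) T
           (\<lambda>x t. tensor_lift N P NP T (\<lambda>y z. (x \<diamondop>\<^bsub>MN\<^esub> y) \<diamondop>\<^bsub>T\<^esub> z) t))"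

definition unit_left :: "'k ring \<Rightarrow> ('k, 'm) module \<Rightarrow> ('k, 'm) tensor \<Rightarrow> 'm" where
  "unit_left K M =
     tensor_lift (self_module K) M (tensor K (self_module K) M) M (\<lambda>s x. s \<odot>\<^bsub>M\<^esub> x)"

definition unit_right :: "'k ring \<Rightarrow> ('k, 'm) module \<Rightarrow> ('m, 'k) tensor \<Rightarrow> 'm" where
  "unit_right K M =
     tensor_lift M (self_module K) (tensor K M (self_module K)) M (\<lambda>x s. s \<odot>\<^bsub>M\<^esub> x)"

section \<open>Coalgebras, algebras and comodules\<close>

locale coalgebra = K: field K + C: module K C
  for K :: "'k ring" and C :: "('k, 'c) module" +
  fixes \<Delta> :: "'c \<Rightarrow> ('c, 'c) tensor" and \<epsilon> :: "'c \<Rightarrow> 'k"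
  assumes comult_linear: "\<Delta> \<in> linear_maps K C (tensor K C C)"
    and counit_linear: "\<epsilon> \<in> linear_maps K C (self_module K)"
    and coassoc: "c \<in> carrier C \<Longrightarrow>
      assoc_right K C C C (tensor_map K C C (tensor K C C) C \<Delta> id (\<Delta> c)) =
      tensor_map K C C C (tensor K C C) id \<Delta> (\<Delta> c)"
    and counit_left: "c \<in> carrier C \<Longrightarrow>
      unit_left K C (tensor_map K C C (self_module K) C \<epsilon> id (\<Delta> c)) = c"
    and counit_right: "c \<in> carrier C \<Longrightarrow>
      unit_right K C (tensor_map K C C C (self_module K) id \<epsilon> (\<Delta> c)) = c"

definition group_like ::
  "'k ring \<Rightarrow> ('k, 'c) module \<Rightarrow> ('c \<Rightarrow> ('c, 'c) tensor) \<Rightarrow> ('c \<Rightarrow> 'k) \<Rightarrow> 'c \<Rightarrow> bool" where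
  "group_like K C \<Delta> \<epsilon> e \<longleftrightarrow> e \<in> carrier C \<and> \<Delta> e = e \<diamondop>\<^bsub>tensor K C C\<^esub> e \<and> \<epsilon> e = \<one>\<^bsub>K\<^esub>"

text \<open>Unlike \<^locale>\<open>algebra\<close>, the multiplication need not be commutative.\<close>

locale assoc_algebra = K: field K + A: ring A + A: module K A
  for K :: "'k ring" and A :: "('k, 'a) module" +
  assumes smult_mult_left: "\<lbrakk>s \<in> carrier K; a \<in> carrier A; b \<in> carrier A\<rbrakk> \<Longrightarrow>
      (s \<odot>\<^bsub>A\<^esub> a) \<otimes>\<^bsub>A\<^esub> b = s \<odot>\<^bsub>A\<^esub> (a \<otimes>\<^bsub>A\<^esub> b)"
    and smult_mult_right: "\<lbrakk>s \<in> carrier K; a \<in> carrier A; b \<in> carrier A\<rbrakk> \<Longrightarrow>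
      a \<otimes>\<^bsub>A\<^esub> (s \<odot>\<^bsub>A\<^esub> b) = s \<odot>\<^bsub>A\<^esub> (a \<otimes>\<^bsub>A\<^esub> b)"

definition product_map :: "'k ring \<Rightarrow> ('k, 'a) module \<Rightarrow> ('a, 'a) tensor \<Rightarrow> 'a" where
  "product_map K A = tensor_lift A A (tensor K A A) A (\<lambda>a b. a \<otimes>\<^bsub>A\<^esub> b)"

text \<open>The left action \<open>a (x \<otimes> y) = a x \<otimes> y\<close>; in the uses below \<open>A\<close> is an algebra or a subalgebra.\<close>

definition left_mult ::
  "'k ring \<Rightarrow> ('k, 'a) module \<Rightarrow> ('k, 'm) module \<Rightarrow> 'a \<Rightarrow> ('a, 'm) tensor \<Rightarrow> ('a, 'm) tensor" where
  "left_mult K A M a = tensor_map K A M A M (\<lambda>x. a \<otimes>\<^bsub>A\<^esub> x) id"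

locale right_comodule = coalgebra K C \<Delta> \<epsilon> + A: module K A
  for K :: "'k ring" and C :: "('k, 'c) module" and \<Delta> \<epsilon> and A :: "('k, 'a) module" +
  fixes \<rho> :: "'a \<Rightarrow> ('a, 'c) tensor"
  assumes coaction_linear: "\<rho> \<in> linear_maps K A (tensor K A C)"
    and coaction_coassoc: "a \<in> carrier A \<Longrightarrow>
      assoc_right K A C C (tensor_map K A C (tensor K A C) C \<rho> id (\<rho> a)) =
      tensor_map K A C A (tensor K C C) id \<Delta> (\<rho> a)"
    and coaction_counit: "a \<in> carrier A \<Longrightarrow>
      unit_right K A (tensor_map K A C A (self_module K) id \<epsilon> (\<rho> a)) = a"

text \<open>An algebra that is a right comodule, with no compatibility between the two structures.\<close>

locale comodule_and_algebra = assoc_algebra K A + right_comodule K C \<Delta> \<epsilon> A \<rho>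
  for K :: "'k ring" and A :: "('k, 'a) module" and C :: "('k, 'c) module" and \<Delta> \<epsilon> \<rho>

definition coinvariants ::
  "'k ring \<Rightarrow> ('k, 'a) module \<Rightarrow> ('k, 'c) module \<Rightarrow> ('a \<Rightarrow> ('a, 'c) tensor) \<Rightarrow> 'a set" where
  "coinvariants K A C \<rho> =
     {b \<in> carrier A. \<forall>a\<in>carrier A. \<rho> (b \<otimes>\<^bsub>A\<^esub> a) = left_mult K A C b (\<rho> a)}"

definition lifted_can ::
  "'k ring \<Rightarrow> ('k, 'a) module \<Rightarrow> ('k, 'c) module \<Rightarrow> ('a \<Rightarrow> ('a, 'c) tensor)
    \<Rightarrow> ('a, 'a) tensor \<Rightarrow> ('a, 'c) tensor" where
  "lifted_can K A C \<rho> =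
     tensor_lift A A (tensor K A A) (tensor K A C) (\<lambda>a a'. left_mult K A C a (\<rho> a'))"

section \<open>Entwined extensions and strong connections\<close>

locale entwining_map = coalgebra K C \<Delta> \<epsilon> + assoc_algebra K A
  for K :: "'k ring" and A :: "('k, 'a) module" and C :: "('k, 'c) module" and \<Delta> \<epsilon> +
  fixes \<psi> :: "('c, 'a) tensor \<Rightarrow> ('a, 'c) tensor"
  assumes entwining_linear: "\<psi> \<in> linear_maps K (tensor K C A) (tensor K A C)"
    and entwining_mult: "w \<in> carrier (tensor K C (tensor K A A)) \<Longrightarrow>
      \<psi> (tensor_map K C (tensor K A A) C A id (product_map K A) w) =
      tensor_map K (tensor K A A) C A C (product_map K A) id
        (assoc_left K A A C
          (tensor_map K A (tensor K C A) A (tensor K A C) id \<psi>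
            (assoc_right K A C A
              (tensor_map K (tensor K C A) A (tensor K A C) A \<psi> id
                (assoc_left K C A A w)))))"
    and entwining_one: "c \<in> carrier C \<Longrightarrow>
      \<psi> (c \<diamondop>\<^bsub>tensor K C A\<^esub> \<one>\<^bsub>A\<^esub>) = \<one>\<^bsub>A\<^esub> \<diamondop>\<^bsub>tensor K A C\<^esub> c"
    and entwining_comult: "z \<in> carrier (tensor K C A) \<Longrightarrow>
      tensor_map K A C A (tensor K C C) id \<Delta> (\<psi> z) =
      assoc_right K A C C
        (tensor_map K (tensor K C A) C (tensor K A C) C \<psi> id
          (assoc_left K C A C
            (tensor_map K C (tensor K C A) C (tensor K A C) id \<psi>
              (assoc_right K C C A
                (tensor_map K C A (tensor K C C) A \<Delta> id z)))))"
    and entwining_counit: "z \<in> carrier (tensor K C A) \<Longrightarrow>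
      unit_right K A (tensor_map K A C A (self_module K) id \<epsilon> (\<psi> z)) =
      unit_left K A (tensor_map K C A (self_module K) A \<epsilon> id z)"

text \<open>The bijective entwining map is recorded as a parameter. The formula in \<open>coaction_mult\<close> is
  \<open>\<rho> (a a') = a\<^sub>0 \<psi> (a\<^sub>1 \<otimes> a')\<close>.\<close>

locale entwined_extension =
  comodule_and_algebra K A C \<Delta> \<epsilon> \<rho> + entwining_map K A C \<Delta> \<epsilon> \<psi>
  for K :: "'k ring" and A :: "('k, 'a) module" and C :: "('k, 'c) module" and \<Delta> \<epsilon> \<rho> and \<psi> +
  fixes B :: "'a set"
  assumes base: "B = coinvariants K A C \<rho>"
    and entwining_bij: "bij_betw \<psi> (carrier (tensor K C A)) (carrier (tensor K A C))"
    and coaction_mult: "\<lbrakk>a \<in> carrier A; a' \<in> carrier A\<rbrakk> \<Longrightarrow>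
      \<rho> (a \<otimes>\<^bsub>A\<^esub> a') =
      tensor_lift A C (tensor K A C) (tensor K A C)
        (\<lambda>x c. left_mult K A C x (\<psi> (c \<diamondop>\<^bsub>tensor K C A\<^esub> a'))) (\<rho> a)"

definition left_coaction ::
  "'k ring \<Rightarrow> ('k, 'a) module \<Rightarrow> ('k, 'c) module \<Rightarrow> ('a \<Rightarrow> ('a, 'c) tensor)
    \<Rightarrow> (('c, 'a) tensor \<Rightarrow> ('a, 'c) tensor) \<Rightarrow> 'a \<Rightarrow> ('c, 'a) tensor" where
  "left_coaction K A C \<rho> \<psi> a =
     the_inv_into (carrier (tensor K C A)) \<psi> (left_mult K A C a (\<rho> \<one>\<^bsub>A\<^esub>))"

locale strong_connection_form = entwined_extension K A C \<Delta> \<epsilon> \<rho> \<psi> B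
  for K :: "'k ring" and A :: "('k, 'a) module" and C :: "('k, 'c) module" and \<Delta> \<epsilon> \<rho> \<psi> B +
  fixes ell :: "'c \<Rightarrow> ('a, 'a) tensor"
  assumes connection_linear: "ell \<in> linear_maps K C (tensor K A A)"
    and connection_can: "c \<in> carrier C \<Longrightarrow>
      lifted_can K A C \<rho> (ell c) = \<one>\<^bsub>A\<^esub> \<diamondop>\<^bsub>tensor K A C\<^esub> c"
    and connection_right: "c \<in> carrier C \<Longrightarrow>
      assoc_right K A A C (tensor_map K C C (tensor K A A) C ell id (\<Delta> c)) =
      tensor_map K A A A (tensor K A C) id \<rho> (ell c)"
    and connection_left: "c \<in> carrier C \<Longrightarrow>
      tensor_map K C C C (tensor K A A) id ell (\<Delta> c) =
      assoc_right K C A A (tensor_map K A A (tensor K C A) A (left_coaction K A C \<rho> \<psi>) id (ell c))"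

text \<open>
  A linear form \<open>\<delta>\<close> on \<open>C \<otimes> C\<close> with \<open>\<delta> (c\<^sub>1 \<otimes> c\<^sub>2) = \<epsilon> c\<close> and
  \<open>c\<^sub>1 \<delta> (c\<^sub>2 \<otimes> c') = \<delta> (c \<otimes> c'\<^sub>1) c'\<^sub>2\<close>. The coalgebras admitting one are the coseparable ones.
\<close>

locale cointegral = coalgebra K C \<Delta> \<epsilon>
  for K :: "'k ring" and C :: "('k, 'c) module" and \<Delta> \<epsilon> +
  fixes \<delta> :: "('c, 'c) tensor \<Rightarrow> 'k"
  assumes cointegral_linear: "\<delta> \<in> linear_maps K (tensor K C C) (self_module K)"
    and cointegral_comult: "c \<in> carrier C \<Longrightarrow> \<delta> (\<Delta> c) = \<epsilon> c"
    and cointegral_balanced: "\<lbrakk>c \<in> carrier C; c' \<in> carrier C\<rbrakk> \<Longrightarrow>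
      unit_right K C (tensor_map K C (tensor K C C) C (self_module K) id \<delta>
        (assoc_right K C C C (\<Delta> c \<diamondop>\<^bsub>tensor K (tensor K C C) C\<^esub> c'))) =
      unit_left K C (tensor_map K (tensor K C C) C (self_module K) C \<delta> id
        (assoc_left K C C C (c \<diamondop>\<^bsub>tensor K C (tensor K C C)\<^esub> \<Delta> c')))"

section \<open>Principal extensions\<close>

definition base_tensor :: "('k, 'a) module \<Rightarrow> 'a set \<Rightarrow> ('a, 'a) tensor ring" where
  "base_tensor A B = balanced_tensor B (monoid.mult A) (monoid.mult A) A A"

definition canonical_map ::
  "'k ring \<Rightarrow> ('k, 'a) module \<Rightarrow> ('k, 'c) module \<Rightarrow> ('a \<Rightarrow> ('a, 'c) tensor) \<Rightarrow> 'a set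
    \<Rightarrow> ('a, 'a) tensor \<Rightarrow> ('a, 'c) tensor" where
  "canonical_map K A C \<rho> B =
     tensor_lift A A (base_tensor A B) (tensor K A C) (\<lambda>a a'. left_mult K A C a (\<rho> a'))"

definition base_right_mult ::
  "('k, 'a) module \<Rightarrow> 'a set \<Rightarrow> ('a, 'a) tensor \<Rightarrow> 'a \<Rightarrow> ('a, 'a) tensor" where
  "base_right_mult A B t a =
     tensor_lift A A (base_tensor A B) (base_tensor A B)
       (\<lambda>x y. x \<diamondop>\<^bsub>base_tensor A B\<^esub> (y \<otimes>\<^bsub>A\<^esub> a)) t"

text \<open>The map \<open>c \<otimes> a \<mapsto> can (can\<^sup>-\<^sup>1 (1 \<otimes> c) a)\<close>.\<close>

definition canonical_entwining ::
  "'k ring \<Rightarrow> ('k, 'a) module \<Rightarrow> ('k, 'c) module \<Rightarrow> ('a \<Rightarrow> ('a, 'c) tensor) \<Rightarrow> 'a set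
    \<Rightarrow> ('c, 'a) tensor \<Rightarrow> ('a, 'c) tensor" where
  "canonical_entwining K A C \<rho> B =
     tensor_lift C A (tensor K C A) (tensor K A C)
       (\<lambda>c a. canonical_map K A C \<rho> B
          (base_right_mult A B
            (the_inv_into (carrier (base_tensor A B)) (canonical_map K A C \<rho> B)
              (\<one>\<^bsub>A\<^esub> \<diamondop>\<^bsub>tensor K A C\<^esub> c)) a))"

definition equivariantly_projective ::
  "'k ring \<Rightarrow> ('k, 'a) module \<Rightarrow> ('k, 'c) module \<Rightarrow> ('a \<Rightarrow> ('a, 'c) tensor) \<Rightarrow> 'a set \<Rightarrow> bool" where
  "equivariantly_projective K A C \<rho> B \<longleftrightarrow>
     (let B' = A\<lparr>carrier := B\<rparr> in
      \<exists>s \<in> linear_maps K A (tensor K B' A).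
        (\<forall>b\<in>B. \<forall>a\<in>carrier A. s (b \<otimes>\<^bsub>A\<^esub> a) = left_mult K B' A b (s a)) \<and>
        (\<forall>a\<in>carrier A.
           assoc_right K B' A C (tensor_map K A C (tensor K B' A) C s id (\<rho> a)) =
           tensor_map K B' A B' (tensor K A C) id \<rho> (s a)) \<and>
        (\<forall>a\<in>carrier A. tensor_lift B' A (tensor K B' A) A (\<lambda>b x. b \<otimes>\<^bsub>A\<^esub> x) (s a) = a))"

locale principal_extension = comodule_and_algebra K A C \<Delta> \<epsilon> \<rho>
  for K :: "'k ring" and A :: "('k, 'a) module" and C :: "('k, 'c) module" and \<Delta> \<epsilon> \<rho> +
  fixes B :: "'a set"
  assumes base: "B = coinvariants K A C \<rho>"
    and can_bij: "bij_betw (canonical_map K A C \<rho> B) (carrier (base_tensor A B)) (carrier (tensor K A C))"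
    and projective: "equivariantly_projective K A C \<rho> B"
    and canonical_entwining_bij: "bij_betw (canonical_entwining K A C \<rho> B)
      (carrier (tensor K C A)) (carrier (tensor K A C))"
    and coaction_group_like: "\<exists>e. group_like K C \<Delta> \<epsilon> e \<and>
      (\<forall>a\<in>carrier A. \<rho> a = canonical_entwining K A C \<rho> B (e \<diamondop>\<^bsub>tensor K C A\<^esub> a))"

end

theory Submission
  imports Defs
begin

text \<open>Write \<open>\<phi>\<close> for the inverse of \<open>\<psi>\<close> and \<open>\<lambda> a = a\<^sub>-\<^sub>1 \<otimes> a\<^sub>0\<close> for the left coaction, so that
  \<open>\<psi> (\<lambda> a) = a \<rho> 1\<close>. Everything rests on the identity \<open>a\<^sub>-\<^sub>1 \<otimes> a\<^sub>0 a' = \<phi> (a \<rho> a')\<close>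
  (\<open>left_coaction_mult\<close>): applying \<open>\<psi>\<close> to the left side and using that \<open>\<psi>\<close> is multiplicative turns
  it into \<open>a 1\<^sub>0 \<psi> (1\<^sub>1 \<otimes> a')\<close>, and that is \<open>a \<rho> (1 a')\<close>. It has two consequences. The left coaction
  is coassociative (\<open>left_coaction_coassoc\<close>), because \<open>\<phi>\<close> inherits the compatibility of \<open>\<psi>\<close> with
  the coproduct. And \<open>a\<^sub>-\<^sub>1 \<otimes> a\<^sub>0 a'\<^sub>0 \<otimes> a'\<^sub>1\<close> depends only on the image of \<open>a \<otimes> a'\<close> under the lifted
  canonical map (\<open>left_right_coaction_mult\<close>); summed over \<open>\<sigma> c\<close> it is \<open>c\<^sub>1 \<otimes> 1 \<otimes> c\<^sub>2\<close>, whatever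
  the splitting \<open>\<sigma>\<close> is.

  The balancing property of the cointegral moves the coaction of \<open>\<alpha> (a \<otimes> c)\<close> from \<open>a\<close> to \<open>c\<close>, and
  likewise for \<open>\<gamma>\<close> (\<open>alpha_coaction\<close>, \<open>gamma_left_coaction\<close>). With coassociativity of the coproduct
  this makes \<open>ell\<close> colinear on both sides. The product of the two legs of \<open>ell c\<close> collapses to
  \<open>\<delta> (c\<^sub>1 \<otimes> c\<^sub>2) \<delta> (c\<^sub>3 \<otimes> c\<^sub>4) 1 = \<epsilon> c 1\<close> (\<open>product_connection\<close>), and right colinearity turns this
  into the condition on the lifted canonical map.

  Principality follows from any strong connection form once \<open>\<rho> 1 = 1 \<otimes> e\<close>. The coinvariants are the
  kernel of one linear map, \<open>u \<mapsto> \<rho> u - u \<rho> 1\<close> (\<open>base_iff\<close>), and left colinearity of \<open>ell\<close> says that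
  this map kills the first leg of \<open>a\<^sub>0 ell a\<^sub>1\<close> (\<open>sect_coaction\<close>). Linear maps over a field split, so
  \<open>a\<^sub>0 ell a\<^sub>1\<close> comes from \<open>B \<otimes> A\<close> and gives the equivariant section (\<open>base_section\<close>). The map
  \<open>a \<otimes> c \<mapsto> a ell c\<close> inverts the canonical map: on \<open>A \<otimes>\<^sub>B A\<close> the factor of \<open>a\<^sub>0 ell a\<^sub>1\<close> in \<open>B\<close> can be
  moved across the tensor sign, leaving \<open>1 \<otimes>\<^sub>B a\<close> (\<open>quotient_inverse\<close>). The entwining map built from
  the canonical map is then \<open>\<psi>\<close> itself (\<open>canonical_entwining_eq\<close>).

  Sums over tensors are handled as iterated applications of \<open>tensor_lift\<close>: the Sweedler expression
  \<open>F x y\<close> summed over \<open>t = x \<otimes> y\<close> is the lift of \<open>F\<close> evaluated at \<open>t\<close>. Simplification rules move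
  linear maps inside such sums and prove the linearity conditions that arise, so each structural
  axiom becomes a rewrite rule between iterated sums.\<close>

section \<open>Balanced tensor products\<close>

text \<open>Each relator lies in the subgroup that is factored out, so both sides lie in the same coset.\<close>

lemma pure_tensor_biadditive:
  assumes act: "balanced_actions S r l M N"
  defines "T \<equiv> balanced_tensor S r l M N"
  shows pure_tensor_add_left: "\<lbrakk>x \<in> carrier M; x' \<in> carrier M; y \<in> carrier N\<rbrakk> \<Longrightarrow>
      (x \<oplus>\<^bsub>M\<^esub> x') \<diamondop>\<^bsub>T\<^esub> y = x \<diamondop>\<^bsub>T\<^esub> y \<oplus>\<^bsub>T\<^esub> x' \<diamondop>\<^bsub>T\<^esub> y"
    and pure_tensor_add_right: "\<lbrakk>x \<in> carrier M; y \<in> carrier N; y' \<in> carrier N\<rbrakk> \<Longrightarrow>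
      x \<diamondop>\<^bsub>T\<^esub> (y \<oplus>\<^bsub>N\<^esub> y') = x \<diamondop>\<^bsub>T\<^esub> y \<oplus>\<^bsub>T\<^esub> x \<diamondop>\<^bsub>T\<^esub> y'"
    and pure_tensor_balanced: "\<lbrakk>x \<in> carrier M; s \<in> S; y \<in> carrier N\<rbrakk> \<Longrightarrow>
      r x s \<diamondop>\<^bsub>T\<^esub> y = x \<diamondop>\<^bsub>T\<^esub> l s y"
proof -
  define F where "F = free_Abelian_group (carrier M \<times> carrier N)"
  define R where "R = balancing_relators S r l M N"
  define H where "H = generate F R"
  note facts = balanced_tensor_facts[OF act, folded T_def F_def R_def, folded H_def]
  interpret M: abelian_group M using act by (simp add: balanced_actions_def)
  interpret N: abelian_group N using act by (simp add: balanced_actions_def)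
  interpret F: comm_group F unfolding F_def by (rule abelian_free_Abelian_group)
  interpret H: normal H F using relators_subgroup(2)[OF act] by (simp add: H_def R_def F_def)
  have R: "R \<subseteq> carrier F" using relators_subgroup(1)[OF act] by (simp add: R_def F_def)
  have act': "r x s \<in> carrier M" "l s y \<in> carrier N"
    if "x \<in> carrier M" "s \<in> S" "y \<in> carrier N" for x y s
    using act that by (auto simp: balanced_actions_def)
  have fc: "frag_of (x, y) \<in> carrier F" if "x \<in> carrier M" "y \<in> carrier N" for x y
    using that by (simp add: F_def)
  have coset: "H #>\<^bsub>F\<^esub> a = H #>\<^bsub>F\<^esub> b" if "a - b \<in> R" "b \<in> carrier F" for a b
  proof -
    have "a - b \<in> H" unfolding H_def using that(1) by (rule generate.incl)
    then have "H #>\<^bsub>F\<^esub> (a - b) = H" and "a - b \<in> carrier F"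
      using F.coset_join2 H.subgroup_axioms H.mem_carrier by blast+
    moreover have "a = (a - b) \<otimes>\<^bsub>F\<^esub> b" by (simp add: F_def)
    ultimately show ?thesis
      using F.coset_mult_assoc[of H "a - b" b] that(2) H.subset by simp
  qed
  have add: "(H #>\<^bsub>F\<^esub> a) \<oplus>\<^bsub>T\<^esub> (H #>\<^bsub>F\<^esub> b) = H #>\<^bsub>F\<^esub> (a + b)"
    if "a \<in> carrier F" "b \<in> carrier F" for a b
  proof -
    have "add T = monoid.mult (add_monoid T)" by simp
    then have "add T = set_mult F" by (simp only: facts(1) mult_FactGroup)
    then show ?thesis using H.rcos_sum[OF that] by (simp add: F_def)
  qed
  have pl: "x \<diamondop>\<^bsub>T\<^esub> y = H #>\<^bsub>F\<^esub> frag_of (x, y)" for x y by (rule facts(3))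
  have sum: "H #>\<^bsub>F\<^esub> a = (H #>\<^bsub>F\<^esub> b) \<oplus>\<^bsub>T\<^esub> (H #>\<^bsub>F\<^esub> c)"
    if "a - b - c \<in> R" "b \<in> carrier F" "c \<in> carrier F" for a b c
    using coset[of a "b + c"] add[of b c] F.m_closed[of b c] that
    by (simp add: F_def diff_diff_eq del: carrier_free_Abelian_group_iff)
  show "(x \<oplus>\<^bsub>M\<^esub> x') \<diamondop>\<^bsub>T\<^esub> y = x \<diamondop>\<^bsub>T\<^esub> y \<oplus>\<^bsub>T\<^esub> x' \<diamondop>\<^bsub>T\<^esub> y"
    if "x \<in> carrier M" "x' \<in> carrier M" "y \<in> carrier N"
    unfolding pl using that by (intro sum fc) (auto simp: R_def balancing_relators_def)
  show "x \<diamondop>\<^bsub>T\<^esub> (y \<oplus>\<^bsub>N\<^esub> y') = x \<diamondop>\<^bsub>T\<^esub> y \<oplus>\<^bsub>T\<^esub> x \<diamondop>\<^bsub>T\<^esub> y'"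
    if "x \<in> carrier M" "y \<in> carrier N" "y' \<in> carrier N"
    unfolding pl using that by (intro sum fc) (auto simp: R_def balancing_relators_def)
  show "r x s \<diamondop>\<^bsub>T\<^esub> y = x \<diamondop>\<^bsub>T\<^esub> l s y"
    if "x \<in> carrier M" "s \<in> S" "y \<in> carrier N"
    unfolding pl using that act' by (intro coset fc) (auto simp: R_def balancing_relators_def)
qed

lemma balanced_tensor_induct:
  assumes act: "balanced_actions S r l M N"
  defines "T \<equiv> balanced_tensor S r l M N"
  assumes z: "z \<in> carrier T"
    and zero: "P \<zero>\<^bsub>T\<^esub>"
    and pure: "\<And>x y. \<lbrakk>x \<in> carrier M; y \<in> carrier N\<rbrakk> \<Longrightarrow> P (x \<diamondop>\<^bsub>T\<^esub> y)"
    and add: "\<And>t u. \<lbrakk>t \<in> carrier T; u \<in> carrier T; P t; P u\<rbrakk> \<Longrightarrow> P (t \<oplus>\<^bsub>T\<^esub> u)"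
  shows "P z"
proof -
  define F where "F = free_Abelian_group (carrier M \<times> carrier N)"
  define H where "H = generate F (balancing_relators S r l M N)"
  note facts = balanced_tensor_facts[OF act, folded T_def F_def, folded H_def]
  interpret F: comm_group F unfolding F_def by (rule abelian_free_Abelian_group)
  interpret H: normal H F using relators_subgroup(2)[OF act] by (simp add: H_def F_def)
  interpret M: abelian_group M using act by (simp add: balanced_actions_def)
  interpret T: abelian_group T by (rule facts(2))
  have q: "group_hom F (add_monoid T) (\<lambda>c. H #>\<^bsub>F\<^esub> c)"
    using H.r_coset_hom_Mod T.a_group facts(1) by (simp add: group_hom_def group_hom_axioms_def F.is_group)
  interpret q: group_hom F "add_monoid T" "\<lambda>c. H #>\<^bsub>F\<^esub> c" by (rule q)
  \<comment> \<open>The free abelian group is generated under subtraction, so the negative is carried along.\<close>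
  have neg_pure: "P (\<ominus>\<^bsub>T\<^esub> (x \<diamondop>\<^bsub>T\<^esub> y))" if "x \<in> carrier M" "y \<in> carrier N" for x y
  proof -
    note add_left = pure_tensor_add_left[OF act, folded T_def]
    have 0: "\<zero>\<^bsub>M\<^esub> \<diamondop>\<^bsub>T\<^esub> y = \<zero>\<^bsub>T\<^esub>"
      using add_left[of "\<zero>\<^bsub>M\<^esub>" "\<zero>\<^bsub>M\<^esub>" y] facts(4)[of "\<zero>\<^bsub>M\<^esub>" y] that
      by (metis M.l_zero M.zero_closed T.add.l_cancel_one')
    have "\<ominus>\<^bsub>T\<^esub> (x \<diamondop>\<^bsub>T\<^esub> y) = (\<ominus>\<^bsub>M\<^esub> x) \<diamondop>\<^bsub>T\<^esub> y"
    proof (rule T.minus_equality)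
      show "(\<ominus>\<^bsub>M\<^esub> x) \<diamondop>\<^bsub>T\<^esub> y \<oplus>\<^bsub>T\<^esub> x \<diamondop>\<^bsub>T\<^esub> y = \<zero>\<^bsub>T\<^esub>"
        using add_left[of "\<ominus>\<^bsub>M\<^esub> x" x y] 0 that by (simp add: M.l_neg)
    qed (use that facts(4) in auto)
    then show ?thesis using that pure by simp
  qed
  have hn: "H #>\<^bsub>F\<^esub> (- c) = \<ominus>\<^bsub>T\<^esub> (H #>\<^bsub>F\<^esub> c)" "H #>\<^bsub>F\<^esub> c \<in> carrier T"
    if "Poly_Mapping.keys c \<subseteq> carrier M \<times> carrier N" for c
    using q.hom_inv[of c] q.hom_closed[of c] that by (simp_all add: F_def a_inv_def)
  have "P (H #>\<^bsub>F\<^esub> c) \<and> P (\<ominus>\<^bsub>T\<^esub> (H #>\<^bsub>F\<^esub> c))"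
    if "Poly_Mapping.keys c \<subseteq> carrier M \<times> carrier N" for c
    using that
  proof (induction rule: free_Abelian_group_induct[consumes 1])
    case 1
    have "H #>\<^bsub>F\<^esub> 0 = \<zero>\<^bsub>T\<^esub>" using q.hom_one by (simp add: F_def)
    then show ?case using zero T.add.inv_one by (simp add: a_inv_def)
  next
    case (2 a b)
    have mem: "H #>\<^bsub>F\<^esub> a \<in> carrier T" "H #>\<^bsub>F\<^esub> b \<in> carrier T" using 2 hn by auto
    have "H #>\<^bsub>F\<^esub> (a - b) = (H #>\<^bsub>F\<^esub> a) \<oplus>\<^bsub>T\<^esub> \<ominus>\<^bsub>T\<^esub> (H #>\<^bsub>F\<^esub> b)"
      using q.hom_mult[of a "- b"] 2 hn by (simp add: F_def)
    moreover have "\<ominus>\<^bsub>T\<^esub> (H #>\<^bsub>F\<^esub> (a - b)) = \<ominus>\<^bsub>T\<^esub> (H #>\<^bsub>F\<^esub> a) \<oplus>\<^bsub>T\<^esub> (H #>\<^bsub>F\<^esub> b)"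
      using calculation mem by (simp add: T.minus_add)
    ultimately show ?case using 2 mem add by simp
  next
    case (3 p)
    then show ?case using pure neg_pure by (cases p) (auto simp: facts(3))
  qed
  moreover have "z \<in> carrier (F Mod H)" using z facts(1) by (metis partial_object.select_convs(1))
  ultimately show ?thesis by (auto simp: carrier_FactGroup F_def)
qed

section \<open>Iterated sums over tensors\<close>

text \<open>This lets simplification inside a sum use that the bound elements lie in the carriers; all side
  conditions on linearity and closure depend on that.\<close>

lemma tensor_lift_cong [cong]:
  assumes "\<And>x y. \<lbrakk>x \<in> carrier M; y \<in> carrier N\<rbrakk> \<Longrightarrow> f x y = g x y" and "t = u"
  shows "tensor_lift M N T P f t = tensor_lift M N T P g u"
proof -
  have eq: "(\<forall>x\<in>carrier M. \<forall>y\<in>carrier N. h (x \<diamondop>\<^bsub>T\<^esub> y) = f x y) \<longleftrightarrow>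
      (\<forall>x\<in>carrier M. \<forall>y\<in>carrier N. h (x \<diamondop>\<^bsub>T\<^esub> y) = g x y)" for h
    using assms(1) by simp
  show ?thesis unfolding tensor_lift_def assms(2) eq ..
qed

text \<open>The module \<open>tensor K M N\<close> and the underlying balanced tensor product are records of different types
  with the same additive group; facts are transported between them.\<close>

lemma tensor_lift_ring_cong:
  assumes "carrier T = carrier T'" "\<zero>\<^bsub>T\<^esub> = \<zero>\<^bsub>T'\<^esub>" "add T = add T'"
    and "carrier P = carrier P'" "add P = add P'"
  shows "tensor_lift M N T P = tensor_lift M N T' P'"
proof -
  have "hom (add_monoid T) (add_monoid P) = hom (add_monoid T') (add_monoid P')"
    using assms by (simp add: hom_def)
  moreover have "x \<diamondop>\<^bsub>T\<^esub> y = x \<diamondop>\<^bsub>T'\<^esub> y" for x y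
    using assms by (simp add: pure_tensor_def)
  ultimately show ?thesis
    unfolding tensor_lift_def fun_eq_iff by (simp only: assms(1)) blast
qed

locale tensor_calculus = cring K for K :: "'k ring"
begin

abbreviation lift :: "('k, 'm) module \<Rightarrow> ('k, 'n) module \<Rightarrow> ('p, 'w) ring_scheme
    \<Rightarrow> ('m \<Rightarrow> 'n \<Rightarrow> 'p) \<Rightarrow> ('m, 'n) tensor \<Rightarrow> 'p" where
  "lift M N P f t \<equiv> tensor_lift M N (tensor K M N) P f t"

definition linear_map :: "('k, 'm) module \<Rightarrow> ('k, 'n) module \<Rightarrow> ('m \<Rightarrow> 'n) \<Rightarrow> bool" where
  "linear_map M N f \<longleftrightarrow> f \<in> linear_maps K M N"

definition bilinear_map ::
  "('k, 'm) module \<Rightarrow> ('k, 'n) module \<Rightarrow> ('k, 'p) module \<Rightarrow> ('m \<Rightarrow> 'n \<Rightarrow> 'p) \<Rightarrow> bool" where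
  "bilinear_map M N P f \<longleftrightarrow>
     (\<forall>y\<in>carrier N. linear_map M P (\<lambda>x. f x y)) \<and> (\<forall>x\<in>carrier M. linear_map N P (f x))"

definition trilinear_map ::
  "('k, 'l) module \<Rightarrow> ('k, 'm) module \<Rightarrow> ('k, 'n) module \<Rightarrow> ('k, 'p) module
    \<Rightarrow> ('l \<Rightarrow> 'm \<Rightarrow> 'n \<Rightarrow> 'p) \<Rightarrow> bool" where
  "trilinear_map L M N P f \<longleftrightarrow>
     (\<forall>y\<in>carrier M. \<forall>z\<in>carrier N. linear_map L P (\<lambda>x. f x y z)) \<and>
     (\<forall>x\<in>carrier L. bilinear_map M N P (f x))"

text \<open>Linearity goals are solved by the shape of the function. Rewriting inside the function first would
  take place without membership assumptions and destroy that shape.\<close>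

lemma linear_map_weak_cong [cong]: "N = N' \<Longrightarrow> linear_map M N f = linear_map M N' f"
  and bilinear_map_weak_cong [cong]: "P = P' \<Longrightarrow> bilinear_map M N P g = bilinear_map M N P' g"
  and trilinear_map_weak_cong [cong]: "P = P' \<Longrightarrow> trilinear_map L M N P h = trilinear_map L M N P' h"
  by simp_all

lemma linear_mapI:
  assumes "\<And>x. x \<in> carrier M \<Longrightarrow> f x \<in> carrier N"
    and "\<And>x y. \<lbrakk>x \<in> carrier M; y \<in> carrier M\<rbrakk> \<Longrightarrow> f (x \<oplus>\<^bsub>M\<^esub> y) = f x \<oplus>\<^bsub>N\<^esub> f y"
    and "\<And>s x. \<lbrakk>s \<in> carrier K; x \<in> carrier M\<rbrakk> \<Longrightarrow> f (s \<odot>\<^bsub>M\<^esub> x) = s \<odot>\<^bsub>N\<^esub> f x"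
  shows "linear_map M N f"
  using assms by (auto simp: linear_map_def linear_maps_def hom_def)

lemma linear_mapD:
  assumes "linear_map M N f"
  shows linear_map_closed: "x \<in> carrier M \<Longrightarrow> f x \<in> carrier N"
    and linear_map_add: "\<lbrakk>x \<in> carrier M; y \<in> carrier M\<rbrakk> \<Longrightarrow> f (x \<oplus>\<^bsub>M\<^esub> y) = f x \<oplus>\<^bsub>N\<^esub> f y"
    and linear_map_smult: "\<lbrakk>s \<in> carrier K; x \<in> carrier M\<rbrakk> \<Longrightarrow> f (s \<odot>\<^bsub>M\<^esub> x) = s \<odot>\<^bsub>N\<^esub> f x"
    and linear_map_hom: "f \<in> hom (add_monoid M) (add_monoid N)"
  using assms by (auto simp: linear_map_def linear_maps_def hom_def)

lemma linear_map_cong: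
  assumes "\<And>x. x \<in> carrier M \<Longrightarrow> f x = g x" and "linear_map M N f" and "module K M"
  shows "linear_map M N g"
proof -
  interpret M: module K M by fact
  show ?thesis
    using linear_mapD[OF assms(2)] by (intro linear_mapI) (simp_all flip: assms(1))
qed

lemma linear_map_zero:
  assumes "linear_map M N f" "module K M" "module K N"
  shows "f \<zero>\<^bsub>M\<^esub> = \<zero>\<^bsub>N\<^esub>"
proof -
  interpret M: module K M by fact
  interpret N: module K N by fact
  have "f \<zero>\<^bsub>M\<^esub> = f \<zero>\<^bsub>M\<^esub> \<oplus>\<^bsub>N\<^esub> f \<zero>\<^bsub>M\<^esub>"
    using linear_map_add[OF assms(1), of "\<zero>\<^bsub>M\<^esub>" "\<zero>\<^bsub>M\<^esub>"] by simp
  then show ?thesis using linear_map_closed[OF assms(1), of "\<zero>\<^bsub>M\<^esub>"] by simp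
qed

lemma bilinear_mapI [simp]:
  assumes "\<And>y. y \<in> carrier N \<Longrightarrow> linear_map M P (\<lambda>x. f x y)"
    and "\<And>x. x \<in> carrier M \<Longrightarrow> linear_map N P (\<lambda>y. f x y)"
  shows "bilinear_map M N P f"
  using assms by (simp add: bilinear_map_def)

lemma trilinear_mapI [simp]:
  assumes "\<And>y z. \<lbrakk>y \<in> carrier M; z \<in> carrier N\<rbrakk> \<Longrightarrow> linear_map L P (\<lambda>x. f x y z)"
    and "\<And>x z. \<lbrakk>x \<in> carrier L; z \<in> carrier N\<rbrakk> \<Longrightarrow> linear_map M P (\<lambda>y. f x y z)"
    and "\<And>x y. \<lbrakk>x \<in> carrier L; y \<in> carrier M\<rbrakk> \<Longrightarrow> linear_map N P (\<lambda>z. f x y z)"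
  shows "trilinear_map L M N P f"
  using assms by (simp add: trilinear_map_def)

lemma bilinear_mapD:
  assumes "bilinear_map M N P f"
  shows "y \<in> carrier N \<Longrightarrow> linear_map M P (\<lambda>x. f x y)"
    and "x \<in> carrier M \<Longrightarrow> linear_map N P (\<lambda>y. f x y)"
    and "\<lbrakk>x \<in> carrier M; y \<in> carrier N\<rbrakk> \<Longrightarrow> f x y \<in> carrier P"
  using assms by (auto simp: bilinear_map_def dest: linear_map_closed)

lemma trilinear_mapD:
  assumes "trilinear_map L M N P f"
  shows "\<lbrakk>y \<in> carrier M; z \<in> carrier N\<rbrakk> \<Longrightarrow> linear_map L P (\<lambda>x. f x y z)"
    and "\<lbrakk>x \<in> carrier L; z \<in> carrier N\<rbrakk> \<Longrightarrow> linear_map M P (\<lambda>y. f x y z)"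
    and "\<lbrakk>x \<in> carrier L; y \<in> carrier M\<rbrakk> \<Longrightarrow> linear_map N P (\<lambda>z. f x y z)"
    and "\<lbrakk>x \<in> carrier L; y \<in> carrier M; z \<in> carrier N\<rbrakk> \<Longrightarrow> f x y z \<in> carrier P"
  using assms bilinear_mapD[of M N P "f x"]
  by (auto simp: trilinear_map_def)

lemma balanced_actions_module [simp]:
  assumes "module K M" "module K N"
  shows "balanced_actions (carrier K) (\<lambda>x s. s \<odot>\<^bsub>M\<^esub> x) (\<lambda>s y. s \<odot>\<^bsub>N\<^esub> y) M N"
  using assms by (simp add: balanced_actions_def module_def module_axioms_def)

lemma tensor_balanced_tensor:
  defines "T M N \<equiv> balanced_tensor (carrier K) (\<lambda>x s. s \<odot>\<^bsub>M\<^esub> x) (\<lambda>s y. s \<odot>\<^bsub>N\<^esub> y) M N"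
  shows "carrier (tensor K M N) = carrier (T M N)"
    and "\<zero>\<^bsub>tensor K M N\<^esub> = \<zero>\<^bsub>T M N\<^esub>"
    and "add (tensor K M N) = add (T M N)"
    and "pure_tensor (tensor K M N) = pure_tensor (T M N)"
    and "tensor_lift M N (tensor K M N) = tensor_lift M N (T M N)"
proof -
  show *: "carrier (tensor K M N) = carrier (T M N)" "\<zero>\<^bsub>tensor K M N\<^esub> = \<zero>\<^bsub>T M N\<^esub>"
    "add (tensor K M N) = add (T M N)"
    by (simp_all add: tensor_def T_def Let_def)
  show ***: "pure_tensor (tensor K M N) = pure_tensor (T M N)"
    by (simp add: pure_tensor_def fun_eq_iff *)
  show "tensor_lift M N (tensor K M N) = tensor_lift M N (T M N)"
    using * by (intro ext fun_cong[OF tensor_lift_ring_cong]) auto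
qed

lemma abelian_group_cong:
  assumes "abelian_group G" "carrier H = carrier G" "add H = add G" "\<zero>\<^bsub>H\<^esub> = \<zero>\<^bsub>G\<^esub>"
  shows "abelian_group H"
proof -
  interpret G: abelian_group G by fact
  show ?thesis
    by (rule abelian_groupI) (auto simp: assms(2-4) G.a_ac intro: G.l_neg)
qed

lemma abelian_group_tensor:
  assumes "module K M" "module K N"
  shows "abelian_group (tensor K M N)"
  using balanced_tensor_facts(2)[OF balanced_actions_module[OF assms]]
  by (rule abelian_group_cong) (simp_all add: tensor_balanced_tensor)

lemma pure_closed [simp]:
  "\<lbrakk>module K M; module K N; x \<in> carrier M; y \<in> carrier N\<rbrakk> \<Longrightarrow>
     x \<diamondop>\<^bsub>tensor K M N\<^esub> y \<in> carrier (tensor K M N)"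
  by (simp add: tensor_balanced_tensor balanced_tensor_facts(4))

lemma tensor_induct [consumes 3, case_names zero pure add]:
  assumes "module K M" "module K N" "z \<in> carrier (tensor K M N)"
    and "P \<zero>\<^bsub>tensor K M N\<^esub>"
    and "\<And>x y. \<lbrakk>x \<in> carrier M; y \<in> carrier N\<rbrakk> \<Longrightarrow> P (x \<diamondop>\<^bsub>tensor K M N\<^esub> y)"
    and "\<And>t u. \<lbrakk>t \<in> carrier (tensor K M N); u \<in> carrier (tensor K M N); P t; P u\<rbrakk>
          \<Longrightarrow> P (t \<oplus>\<^bsub>tensor K M N\<^esub> u)"
  shows "P z"
  using balanced_tensor_induct[OF balanced_actions_module[OF assms(1,2)], of z P] assms(3-)
  by (simp add: tensor_balanced_tensor)

lemma
  assumes "module K M" "module K N" "abelian_group P" 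
    and closed: "\<And>x y. \<lbrakk>x \<in> carrier M; y \<in> carrier N\<rbrakk> \<Longrightarrow> f x y \<in> carrier P"
    and add_left: "\<And>x x' y. \<lbrakk>x \<in> carrier M; x' \<in> carrier M; y \<in> carrier N\<rbrakk>
          \<Longrightarrow> f (x \<oplus>\<^bsub>M\<^esub> x') y = f x y \<oplus>\<^bsub>P\<^esub> f x' y"
    and add_right: "\<And>x y y'. \<lbrakk>x \<in> carrier M; y \<in> carrier N; y' \<in> carrier N\<rbrakk>
          \<Longrightarrow> f x (y \<oplus>\<^bsub>N\<^esub> y') = f x y \<oplus>\<^bsub>P\<^esub> f x y'"
    and balanced: "\<And>x s y. \<lbrakk>x \<in> carrier M; s \<in> carrier K; y \<in> carrier N\<rbrakk>
          \<Longrightarrow> f (s \<odot>\<^bsub>M\<^esub> x) y = f x (s \<odot>\<^bsub>N\<^esub> y)"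
  shows lift_hom: "(\<lambda>t. lift M N P f t) \<in> hom (add_monoid (tensor K M N)) (add_monoid P)"
    and lift_pure_hom: "\<lbrakk>x \<in> carrier M; y \<in> carrier N\<rbrakk> \<Longrightarrow> lift M N P f (x \<diamondop>\<^bsub>tensor K M N\<^esub> y) = f x y"
proof -
  let ?T = "balanced_tensor (carrier K) (\<lambda>x s. s \<odot>\<^bsub>M\<^esub> x) (\<lambda>s y. s \<odot>\<^bsub>N\<^esub> y) M N"
  note act = balanced_actions_module[OF assms(1,2)]
  have "tensor_lift M N ?T P f \<in> hom (add_monoid ?T) (add_monoid P)"
    by (rule tensor_lift_hom[OF act]) (simp_all add: assms)
  then show "(\<lambda>t. lift M N P f t) \<in> hom (add_monoid (tensor K M N)) (add_monoid P)"
    by (simp add: tensor_balanced_tensor hom_def)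
  show "lift M N P f (x \<diamondop>\<^bsub>tensor K M N\<^esub> y) = f x y" if "x \<in> carrier M" "y \<in> carrier N"
    unfolding tensor_balanced_tensor
    by (rule tensor_lift_pure[OF act]) (simp_all add: assms that)
qed

lemma module_pure:
  assumes "module K M" "module K N"
  shows pure_add_left: "\<lbrakk>x \<in> carrier M; x' \<in> carrier M; y \<in> carrier N\<rbrakk> \<Longrightarrow>
      (x \<oplus>\<^bsub>M\<^esub> x') \<diamondop>\<^bsub>tensor K M N\<^esub> y = x \<diamondop>\<^bsub>tensor K M N\<^esub> y \<oplus>\<^bsub>tensor K M N\<^esub> x' \<diamondop>\<^bsub>tensor K M N\<^esub> y"
    and pure_add_right: "\<lbrakk>x \<in> carrier M; y \<in> carrier N; y' \<in> carrier N\<rbrakk> \<Longrightarrow>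
      x \<diamondop>\<^bsub>tensor K M N\<^esub> (y \<oplus>\<^bsub>N\<^esub> y') = x \<diamondop>\<^bsub>tensor K M N\<^esub> y \<oplus>\<^bsub>tensor K M N\<^esub> x \<diamondop>\<^bsub>tensor K M N\<^esub> y'"
    and pure_balanced: "\<lbrakk>x \<in> carrier M; s \<in> carrier K; y \<in> carrier N\<rbrakk> \<Longrightarrow>
      (s \<odot>\<^bsub>M\<^esub> x) \<diamondop>\<^bsub>tensor K M N\<^esub> y = x \<diamondop>\<^bsub>tensor K M N\<^esub> (s \<odot>\<^bsub>N\<^esub> y)"
  using pure_tensor_biadditive[OF balanced_actions_module[OF assms]]
  by (simp_all add: tensor_balanced_tensor)

lemma
  assumes "module K M" "module K N" and s: "s \<in> carrier K"
  defines "T \<equiv> tensor K M N"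
  shows tensor_smult_hom: "(\<lambda>t. s \<odot>\<^bsub>T\<^esub> t) \<in> hom (add_monoid T) (add_monoid T)"
    and smult_pure_left: "\<lbrakk>x \<in> carrier M; y \<in> carrier N\<rbrakk> \<Longrightarrow>
      s \<odot>\<^bsub>T\<^esub> (x \<diamondop>\<^bsub>T\<^esub> y) = (s \<odot>\<^bsub>M\<^esub> x) \<diamondop>\<^bsub>T\<^esub> y"
proof -
  interpret M: module K M by fact
  interpret N: module K N by fact
  let ?f = "\<lambda>x y. (s \<odot>\<^bsub>M\<^esub> x) \<diamondop>\<^bsub>T\<^esub> y"
  let ?T0 = "balanced_tensor (carrier K) (\<lambda>x s. s \<odot>\<^bsub>M\<^esub> x) (\<lambda>s y. s \<odot>\<^bsub>N\<^esub> y) M N"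
  have "smult T s = tensor_lift M N ?T0 ?T0 ?f"
    unfolding T_def tensor_balanced_tensor(4) by (simp add: tensor_def Let_def)
  also have "\<dots> = tensor_lift M N T T ?f"
    unfolding T_def by (intro fun_cong[OF tensor_lift_ring_cong]) (simp_all add: tensor_balanced_tensor)
  finally have eq: "smult T s = tensor_lift M N T T ?f" .
  have f: "?f x y \<in> carrier T" "?f (x \<oplus>\<^bsub>M\<^esub> x') y = ?f x y \<oplus>\<^bsub>T\<^esub> ?f x' y"
    "?f x (y \<oplus>\<^bsub>N\<^esub> y') = ?f x y \<oplus>\<^bsub>T\<^esub> ?f x y'"
    if "x \<in> carrier M" "x' \<in> carrier M" "y \<in> carrier N" "y' \<in> carrier N" for x x' y y'
    using that s assms(1,2) by (simp_all add: T_def M.smult_r_distr pure_add_left pure_add_right)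
  have b: "?f (u \<odot>\<^bsub>M\<^esub> x) y = ?f x (u \<odot>\<^bsub>N\<^esub> y)"
    if "x \<in> carrier M" "y \<in> carrier N" "u \<in> carrier K" for x y u
    using that s assms(1,2)
    by (simp add: T_def pure_balanced m_comm flip: M.smult_assoc1 N.smult_assoc1)
  show "(\<lambda>t. s \<odot>\<^bsub>T\<^esub> t) \<in> hom (add_monoid T) (add_monoid T)"
    unfolding eq using f b abelian_group_tensor[OF assms(1,2)]
    unfolding T_def by (intro lift_hom assms) auto
  show "s \<odot>\<^bsub>T\<^esub> (x \<diamondop>\<^bsub>T\<^esub> y) = (s \<odot>\<^bsub>M\<^esub> x) \<diamondop>\<^bsub>T\<^esub> y"
    if "x \<in> carrier M" "y \<in> carrier N"
    unfolding eq using f b abelian_group_tensor[OF assms(1,2)] that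
    unfolding T_def by (intro lift_pure_hom assms) auto
qed

lemma module_tensor [simp]:
  assumes M: "module K M" and N: "module K N"
  shows "module K (tensor K M N)"
proof -
  let ?T = "tensor K M N"
  interpret M: module K M by fact
  interpret N: module K N by fact
  interpret T: abelian_group ?T by (rule abelian_group_tensor) fact+
  have smult_closed: "s \<odot>\<^bsub>?T\<^esub> t \<in> carrier ?T" if "s \<in> carrier K" "t \<in> carrier ?T" for s t
    using tensor_smult_hom[OF M N that(1)] that(2) by (auto simp: hom_def)
  have smult_add: "s \<odot>\<^bsub>?T\<^esub> (t \<oplus>\<^bsub>?T\<^esub> u) = s \<odot>\<^bsub>?T\<^esub> t \<oplus>\<^bsub>?T\<^esub> s \<odot>\<^bsub>?T\<^esub> u"
    if "s \<in> carrier K" "t \<in> carrier ?T" "u \<in> carrier ?T" for s t u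
    using tensor_smult_hom[OF M N that(1)] that(2,3) by (auto simp: hom_def)
  have smult_zero: "s \<odot>\<^bsub>?T\<^esub> \<zero>\<^bsub>?T\<^esub> = \<zero>\<^bsub>?T\<^esub>" if "s \<in> carrier K" for s
    using smult_add[OF that T.zero_closed T.zero_closed] smult_closed[OF that T.zero_closed] by simp
  note smult_pure = smult_pure_left[OF M N]
  show ?thesis
  proof (rule moduleI[OF is_cring T.abelian_group_axioms smult_closed _ smult_add])
    fix s u t assume s: "s \<in> carrier K" and u: "u \<in> carrier K" and "t \<in> carrier ?T"
    from M N this(3) show "(s \<oplus>\<^bsub>K\<^esub> u) \<odot>\<^bsub>?T\<^esub> t = s \<odot>\<^bsub>?T\<^esub> t \<oplus>\<^bsub>?T\<^esub> u \<odot>\<^bsub>?T\<^esub> t"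
    proof (induction t rule: tensor_induct)
      case zero show ?case using s u by (simp add: smult_zero)
    next
      case (pure x y)
      then show ?case using s u M N by (simp add: smult_pure_left M.smult_l_distr pure_add_left)
    next
      case (add t t')
      then show ?case using s u
        by (simp add: smult_add smult_closed T.add.m_ac)
    qed
    from M N \<open>t \<in> carrier ?T\<close> show "(s \<otimes>\<^bsub>K\<^esub> u) \<odot>\<^bsub>?T\<^esub> t = s \<odot>\<^bsub>?T\<^esub> (u \<odot>\<^bsub>?T\<^esub> t)"
      by (induction t rule: tensor_induct)
        (use s u M N in \<open>simp_all add: smult_zero smult_pure smult_add smult_closed M.smult_assoc1\<close>)
  next
    fix t assume "t \<in> carrier ?T"
    with M N show "\<one>\<^bsub>K\<^esub> \<odot>\<^bsub>?T\<^esub> t = t"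
      by (induction t rule: tensor_induct) (use M N in \<open>simp_all add: smult_zero smult_pure smult_add smult_closed\<close>)
  qed
qed

lemma module_self [simp]: "module K (self_module K)"
proof (rule moduleI[OF is_cring])
  show "abelian_group (self_module K)"
    by (rule abelian_group_cong[OF abelian_group_axioms]) (simp_all add: self_module_def)
qed (auto simp: self_module_def l_distr r_distr m_assoc)

text \<open>Oriented as a rewrite rule this would interfere with the linearity rules, whose premises speak of
  the carrier of the module over which the variable ranges.\<close>

lemma carrier_self_module: "carrier (self_module K) = carrier K"
  by (simp add: self_module_def)

lemma self_module_simps [simp]:
  "s \<in> carrier K \<Longrightarrow> s \<in> carrier (self_module K)"
  "smult (self_module K) = monoid.mult K"
  by (simp_all add: self_module_def)

lemma smult_pure_right:
  "\<lbrakk>module K M; module K N; s \<in> carrier K; x \<in> carrier M; y \<in> carrier N\<rbrakk> \<Longrightarrow>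
     s \<odot>\<^bsub>tensor K M N\<^esub> (x \<diamondop>\<^bsub>tensor K M N\<^esub> y) = x \<diamondop>\<^bsub>tensor K M N\<^esub> (s \<odot>\<^bsub>N\<^esub> y)"
  by (simp add: smult_pure_left pure_balanced)

lemma
  assumes [simp]: "module K M" "module K N" "module K P" and f: "bilinear_map M N P f"
  shows linear_map_lift: "linear_map (tensor K M N) P (\<lambda>t. lift M N P f t)"
    and lift_pure [simp]: "\<lbrakk>x \<in> carrier M; y \<in> carrier N\<rbrakk> \<Longrightarrow> lift M N P f (x \<diamondop>\<^bsub>tensor K M N\<^esub> y) = f x y"
proof -
  interpret M: module K M by fact
  interpret P: module K P by fact
  interpret T: module K "tensor K M N" by simp
  note D = bilinear_mapD[OF f]
  have fact: "f x y \<in> carrier P" "f (x \<oplus>\<^bsub>M\<^esub> x') y = f x y \<oplus>\<^bsub>P\<^esub> f x' y"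
    "f x (y \<oplus>\<^bsub>N\<^esub> y') = f x y \<oplus>\<^bsub>P\<^esub> f x y'"
    if "x \<in> carrier M" "x' \<in> carrier M" "y \<in> carrier N" "y' \<in> carrier N" for x x' y y'
    using that D linear_map_add[OF D(1), of y x x'] linear_map_add[OF D(2), of x y y'] by auto
  have sm: "f (s \<odot>\<^bsub>M\<^esub> x) y = s \<odot>\<^bsub>P\<^esub> f x y" "f x (s \<odot>\<^bsub>N\<^esub> y) = s \<odot>\<^bsub>P\<^esub> f x y"
    if "x \<in> carrier M" "y \<in> carrier N" "s \<in> carrier K" for x y s
    using that linear_map_smult[OF D(1), of y s x] linear_map_smult[OF D(2), of x s y] by auto
  have hom: "(\<lambda>t. lift M N P f t) \<in> hom (add_monoid (tensor K M N)) (add_monoid P)"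
    using fact sm by (intro lift_hom) (auto intro: P.abelian_group_axioms)
  show pure: "lift M N P f (x \<diamondop>\<^bsub>tensor K M N\<^esub> y) = f x y" if "x \<in> carrier M" "y \<in> carrier N" for x y
    using fact sm that by (intro lift_pure_hom) (auto intro: P.abelian_group_axioms)
  have closed: "lift M N P f t \<in> carrier P" if "t \<in> carrier (tensor K M N)" for t
    using hom that by (auto simp: hom_def)
  have add: "lift M N P f (t \<oplus>\<^bsub>tensor K M N\<^esub> u) = lift M N P f t \<oplus>\<^bsub>P\<^esub> lift M N P f u"
    if "t \<in> carrier (tensor K M N)" "u \<in> carrier (tensor K M N)" for t u
    using hom that by (auto simp: hom_def)
  have zero: "lift M N P f \<zero>\<^bsub>tensor K M N\<^esub> = \<zero>\<^bsub>P\<^esub>"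
    using add[OF T.zero_closed T.zero_closed] closed[OF T.zero_closed] by simp
  show "linear_map (tensor K M N) P (\<lambda>t. lift M N P f t)"
  proof (rule linear_mapI[OF closed add])
    fix s t assume s: "s \<in> carrier K" and "t \<in> carrier (tensor K M N)"
    from assms(1,2) this(2)
    show "lift M N P f (s \<odot>\<^bsub>tensor K M N\<^esub> t) = s \<odot>\<^bsub>P\<^esub> lift M N P f t"
      by (induction t rule: tensor_induct)
        (use s in \<open>simp_all add: zero smult_pure_left pure sm T.smult_r_distr P.smult_r_distr add closed\<close>)
  qed
qed

lemma linear_map_eqI:
  assumes "module K M" "module K N" "module K P"
    and "linear_map (tensor K M N) P h" "linear_map (tensor K M N) P h'"
    and "\<And>x y. \<lbrakk>x \<in> carrier M; y \<in> carrier N\<rbrakk> \<Longrightarrow> h (x \<diamondop>\<^bsub>tensor K M N\<^esub> y) = h' (x \<diamondop>\<^bsub>tensor K M N\<^esub> y)"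
    and "t \<in> carrier (tensor K M N)"
  shows "h t = h' t"
  using assms(1,2,7)
  by (induction t rule: tensor_induct)
    (use assms(1-6) in \<open>simp_all add: linear_map_zero linear_map_add\<close>)

lemma lift_closed [simp]:
  assumes "module K M" "module K N" "module K P" "bilinear_map M N P f" "t \<in> carrier (tensor K M N)"
  shows "lift M N P f t \<in> carrier P"
  using linear_map_closed[OF linear_map_lift] assms by blast

lemma linear_map_id [simp]: "linear_map M M (\<lambda>x. x)"
  by (rule linear_mapI) auto

lemma linear_map_comp:
  assumes "linear_map M N f" "linear_map N P g"
  shows "linear_map M P (\<lambda>x. g (f x))"
  using linear_mapD[OF assms(1)] linear_mapD[OF assms(2)] by (intro linear_mapI) auto

lemma linear_map_lift_arg [simp]:
  assumes "module K M" "module K N" "module K P" "bilinear_map M N P f"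
    and "linear_map L (tensor K M N) F"
  shows "linear_map L P (\<lambda>x. lift M N P f (F x))"
  using linear_map_comp[OF assms(5) linear_map_lift] assms by blast

lemma linear_map_pure_left [simp]:
  assumes "module K P" "module K Q" "linear_map M P F" "y \<in> carrier Q"
  shows "linear_map M (tensor K P Q) (\<lambda>x. F x \<diamondop>\<^bsub>tensor K P Q\<^esub> y)"
  using linear_mapD[OF assms(3)] assms(1,2,4)
  by (intro linear_mapI) (auto simp: pure_add_left smult_pure_left)

lemma linear_map_pure_right [simp]:
  assumes "module K P" "module K Q" "linear_map M Q F" "x \<in> carrier P"
  shows "linear_map M (tensor K P Q) (\<lambda>y. x \<diamondop>\<^bsub>tensor K P Q\<^esub> F y)"
  using linear_mapD[OF assms(3)] assms(1,2,4)
  by (intro linear_mapI) (auto simp: pure_add_right smult_pure_right)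

lemma linear_map_smult_left [simp]:
  assumes "module K P" "linear_map M (self_module K) F" "p \<in> carrier P"
  shows "linear_map M P (\<lambda>x. F x \<odot>\<^bsub>P\<^esub> p)"
proof -
  interpret P: module K P by fact
  show ?thesis using linear_mapD[OF assms(2)] assms(3)
    by (intro linear_mapI) (auto simp: P.smult_l_distr P.smult_assoc1 self_module_def)
qed

lemma linear_map_smult_right [simp]:
  assumes "module K P" "linear_map M P F" "s \<in> carrier (self_module K)"
  shows "linear_map M P (\<lambda>x. s \<odot>\<^bsub>P\<^esub> F x)"
proof -
  interpret P: module K P by fact
  show ?thesis using linear_mapD[OF assms(2)] assms(3)[unfolded carrier_self_module]
    by (intro linear_mapI) (auto simp: P.smult_r_distr m_comm simp flip: P.smult_assoc1)
qed

text \<open>A sum is linear in a parameter of its summand. The claim is verified on the generators of the tensor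
  product; together with the rule for linearity in the summed tensor it covers all iterated sums.\<close>

lemma linear_map_lift_fun [simp]:
  assumes "module K L" "module K M" "module K N" "module K P" and t: "t \<in> carrier (tensor K M N)"
    and bil: "\<And>x. x \<in> carrier L \<Longrightarrow> bilinear_map M N P (F x)"
    and lin: "\<And>y z. \<lbrakk>y \<in> carrier M; z \<in> carrier N\<rbrakk> \<Longrightarrow> linear_map L P (\<lambda>x. F x y z)"
  shows "linear_map L P (\<lambda>x. lift M N P (F x) t)"
proof -
  interpret L: module K L by fact
  interpret P: module K P by fact
  note B = bilinear_mapD[OF bil]
  note LB = linear_mapD[OF linear_map_lift[OF assms(2-4) bil]]
  have pure_eq: "lift M N P (F x) (u \<diamondop>\<^bsub>tensor K M N\<^esub> v) = F x u v"
    if "x \<in> carrier L" "u \<in> carrier M" "v \<in> carrier N" for x u v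
    using that by (intro lift_pure assms)
  interpret T: module K "tensor K M N" using assms by simp
  show ?thesis
  proof (rule linear_mapI)
    fix x y assume xy: "x \<in> carrier L" "y \<in> carrier L"
    show "lift M N P (F (x \<oplus>\<^bsub>L\<^esub> y)) t = lift M N P (F x) t \<oplus>\<^bsub>P\<^esub> lift M N P (F y) t"
      using assms(2,3) t
    proof (induction t rule: tensor_induct)
      case zero
      then show ?case using xy assms by (simp add: linear_map_zero[OF linear_map_lift])
    next
      case (pure u v)
      then show ?case using xy by (simp only: pure_eq L.add.m_closed linear_map_add[OF lin])
    next
      case (add t u)
      then show ?case using xy assms by (simp add: LB P.add.m_ac)
    qed
  next
    fix s x assume sx: "s \<in> carrier K" "x \<in> carrier L"
    show "lift M N P (F (s \<odot>\<^bsub>L\<^esub> x)) t = s \<odot>\<^bsub>P\<^esub> lift M N P (F x) t"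
      using assms(2,3) t
    proof (induction t rule: tensor_induct)
      case zero
      then show ?case using sx assms by (simp add: linear_map_zero[OF linear_map_lift])
    next
      case (pure u v)
      then show ?case using sx by (simp only: pure_eq L.smult_closed linear_map_smult[OF lin])
    next
      case (add t u)
      then show ?case using sx assms by (simp add: LB P.smult_r_distr)
    qed
  qed (use t assms in simp)
qed

text \<open>The instances of this rule below bring every Sweedler expression into the form of an iterated sum of pure terms.\<close>

lemma linear_map_of_lift:
  assumes "module K M" "module K N" "module K P" "module K Q"
    and "linear_map P Q h" "bilinear_map M N P f" "t \<in> carrier (tensor K M N)"
  shows "h (lift M N P f t) = lift M N Q (\<lambda>x y. h (f x y)) t"
proof (rule linear_map_eqI[where M=M and N=N and P=Q])
  note D = bilinear_mapD[OF assms(6)]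
  have b: "bilinear_map M N Q (\<lambda>x y. h (f x y))"
    using linear_map_comp[OF D(1) assms(5)] linear_map_comp[OF D(2) assms(5)] by simp
  show "linear_map (tensor K M N) Q (\<lambda>t. h (lift M N P f t))"
    using assms by (intro linear_map_comp[OF linear_map_lift]) auto
  show "linear_map (tensor K M N) Q (lift M N Q (\<lambda>x y. h (f x y)))"
    using assms b by (intro linear_map_lift) auto
  show "h (lift M N P f (x \<diamondop>\<^bsub>tensor K M N\<^esub> y)) =
      lift M N Q (\<lambda>x y. h (f x y)) (x \<diamondop>\<^bsub>tensor K M N\<^esub> y)"
    if "x \<in> carrier M" "y \<in> carrier N" for x y
    using that assms b by simp
qed (use assms in auto)

lemma lift_lift [simp]:
  assumes "module K M" "module K N" "module K X" "module K Y" "module K Q"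
    and "bilinear_map M N (tensor K X Y) f" "t \<in> carrier (tensor K M N)" "bilinear_map X Y Q g"
  shows "lift X Y Q g (lift M N (tensor K X Y) f t) = lift M N Q (\<lambda>x y. lift X Y Q g (f x y)) t"
  by (rule linear_map_of_lift[where P="tensor K X Y"]) (use assms in \<open>auto intro: linear_map_lift\<close>)

lemma pure_lift_left [simp]:
  assumes "module K M" "module K N" "module K P" "module K Q"
    and "bilinear_map M N P f" "t \<in> carrier (tensor K M N)" "q \<in> carrier Q"
  shows "lift M N P f t \<diamondop>\<^bsub>tensor K P Q\<^esub> q =
    lift M N (tensor K P Q) (\<lambda>x y. f x y \<diamondop>\<^bsub>tensor K P Q\<^esub> q) t"
  by (rule linear_map_of_lift[where P=P]) (use assms in auto)

lemma pure_lift_right [simp]: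
  assumes "module K M" "module K N" "module K P" "module K Q"
    and "bilinear_map M N Q f" "t \<in> carrier (tensor K M N)" "p \<in> carrier P"
  shows "p \<diamondop>\<^bsub>tensor K P Q\<^esub> lift M N Q f t =
    lift M N (tensor K P Q) (\<lambda>x y. p \<diamondop>\<^bsub>tensor K P Q\<^esub> f x y) t"
  by (rule linear_map_of_lift[where P=Q]) (use assms in auto)

lemma smult_lift_left [simp]:
  fixes P :: "('k, 'p) module"
  assumes "module K M" "module K N" "module K P"
    and "bilinear_map M N (self_module K) f" "t \<in> carrier (tensor K M N)" "p \<in> carrier P"
  shows "lift M N (self_module K) f t \<odot>\<^bsub>P\<^esub> p = lift M N P (\<lambda>x y. f x y \<odot>\<^bsub>P\<^esub> p) t"
  by (rule linear_map_of_lift[where P="self_module K" and h="\<lambda>s. s \<odot>\<^bsub>P\<^esub> p"]) (use assms in auto)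

lemma smult_lift_right [simp]:
  assumes "module K M" "module K N" "module K P"
    and "bilinear_map M N P f" "t \<in> carrier (tensor K M N)" "s \<in> carrier (self_module K)"
  shows "s \<odot>\<^bsub>P\<^esub> lift M N P f t = lift M N P (\<lambda>x y. s \<odot>\<^bsub>P\<^esub> f x y) t"
  by (rule linear_map_of_lift[where P=P]) (use assms in auto)

lemma lift_pure_eq [simp]:
  assumes "module K M" "module K N" "t \<in> carrier (tensor K M N)"
  shows "lift M N (tensor K M N) (\<lambda>x y. x \<diamondop>\<^bsub>tensor K M N\<^esub> y) t = t"
  by (rule linear_map_eqI[where M=M and N=N and P="tensor K M N" and h' = "\<lambda>t. t"]) (use assms in simp_all)

text \<open>Used from left to right it recognises a sum over \<open>t\<close> whose summand depends only on \<open>x \<otimes> y\<close>; for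
  instance \<open>t\<close> is replaced by \<open>\<psi> t\<close> in the summation range when the summand mentions \<open>\<psi> (x \<otimes> y)\<close>.\<close>

lemma lift_linear_map_pure:
  assumes "module K M" "module K N" "module K P" "linear_map (tensor K M N) P h" "t \<in> carrier (tensor K M N)"
  shows "lift M N P (\<lambda>x y. h (x \<diamondop>\<^bsub>tensor K M N\<^esub> y)) t = h t"
  using linear_map_of_lift[OF assms(1,2) _ assms(3,4), of "\<lambda>x y. x \<diamondop>\<^bsub>tensor K M N\<^esub> y" t] assms
  by simp

lemma lift_commute:
  assumes "module K L" "module K M" "module K N" "module K O'" "module K P"
    and t: "t \<in> carrier (tensor K L M)" and u: "u \<in> carrier (tensor K N O')"
    and "\<And>x y. \<lbrakk>x \<in> carrier L; y \<in> carrier M\<rbrakk> \<Longrightarrow> bilinear_map N O' P (F x y)"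
    and "\<And>v w. \<lbrakk>v \<in> carrier N; w \<in> carrier O'\<rbrakk> \<Longrightarrow> bilinear_map L M P (\<lambda>x y. F x y v w)"
  shows "lift L M P (\<lambda>x y. lift N O' P (F x y) u) t = lift N O' P (\<lambda>v w. lift L M P (\<lambda>x y. F x y v w) t) u"
proof (rule linear_map_eqI[where M=L and N=M and P=P and t=t])
  note B = assms(8,9)
  note D = bilinear_mapD(1,2)[OF B(1)] bilinear_mapD(1,2)[OF B(2)]
  have b: "bilinear_map L M P (\<lambda>x y. lift N O' P (F x y) u)"
    using assms(1-5) u B D by simp
  show "linear_map (tensor K L M) P (lift L M P (\<lambda>x y. lift N O' P (F x y) u))"
    using b assms(1-5) by (intro linear_map_lift) auto
  show "linear_map (tensor K L M) P (\<lambda>t. lift N O' P (\<lambda>v w. lift L M P (\<lambda>x y. F x y v w) t) u)"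
    using assms(1-5) u B D by simp
  show "lift L M P (\<lambda>x y. lift N O' P (F x y) u) (x \<diamondop>\<^bsub>tensor K L M\<^esub> y) =
      lift N O' P (\<lambda>v w. lift L M P (\<lambda>x y. F x y v w) (x \<diamondop>\<^bsub>tensor K L M\<^esub> y)) u"
    if "x \<in> carrier L" "y \<in> carrier M" for x y
    using that b assms(1-5) u B D by simp
qed fact+

lemma trilinear_map_comp:
  assumes "trilinear_map L M N P F"
  shows "\<lbrakk>linear_map X M g; x \<in> carrier L; z \<in> carrier N\<rbrakk> \<Longrightarrow> linear_map X P (\<lambda>y. F x (g y) z)"
  using linear_map_comp[OF _ trilinear_mapD(2)[OF assms]] by blast

text \<open>One instance of these rules for each structure map makes it available to the linearity prover and to
  the normalisation of sums.\<close>

lemma linear_map_rules: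
  assumes "linear_map M N h"
  shows "x \<in> carrier M \<Longrightarrow> h x \<in> carrier N"
    and "linear_map L M F \<Longrightarrow> linear_map L N (\<lambda>x. h (F x))"
    and "\<lbrakk>module K X; module K Y; module K M; module K N; bilinear_map X Y M f; t \<in> carrier (tensor K X Y)\<rbrakk>
      \<Longrightarrow> h (lift X Y M f t) = lift X Y N (\<lambda>x y. h (f x y)) t"
  using linear_map_closed[OF assms] linear_map_comp[OF _ assms]
    linear_map_of_lift[OF _ _ _ _ assms] by auto

text \<open>The congruence rule for iterated sums needs the summed tensor as an explicit argument.\<close>

lemma tensor_defs:
  "tensor_map K M N P Q f g t = lift M N (tensor K P Q) (\<lambda>x y. f x \<diamondop>\<^bsub>tensor K P Q\<^esub> g y) t"
  "assoc_right K M N P u =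
    lift (tensor K M N) P (tensor K M (tensor K N P)) (\<lambda>t z. lift M N (tensor K M (tensor K N P))
      (\<lambda>x y. x \<diamondop>\<^bsub>tensor K M (tensor K N P)\<^esub> (y \<diamondop>\<^bsub>tensor K N P\<^esub> z)) t) u"
  "assoc_left K M N P v =
    lift M (tensor K N P) (tensor K (tensor K M N) P) (\<lambda>x t. lift N P (tensor K (tensor K M N) P)
      (\<lambda>y z. (x \<diamondop>\<^bsub>tensor K M N\<^esub> y) \<diamondop>\<^bsub>tensor K (tensor K M N) P\<^esub> z) t) v"
  "unit_left K M a = lift (self_module K) M M (\<lambda>s x. s \<odot>\<^bsub>M\<^esub> x) a"
  "unit_right K M b = lift M (self_module K) M (\<lambda>x s. s \<odot>\<^bsub>M\<^esub> x) b"
  "product_map K M c = lift M M M (\<lambda>x y. x \<otimes>\<^bsub>M\<^esub> y) c"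
  "left_mult K M N x t = lift M N (tensor K M N) (\<lambda>y z. (x \<otimes>\<^bsub>M\<^esub> y) \<diamondop>\<^bsub>tensor K M N\<^esub> z) t"
  "lifted_can K M N \<rho> c = lift M M (tensor K M N) (\<lambda>x y. left_mult K M N x (\<rho> y)) c"
  by (simp_all add: tensor_map_def assoc_left_def assoc_right_def unit_left_def unit_right_def
      product_map_def left_mult_def lifted_can_def Let_def)

lemma linear_map_minus:
  assumes "module K M" "module K N" "linear_map M N h" "x \<in> carrier M" "y \<in> carrier M"
  shows "h (x \<ominus>\<^bsub>M\<^esub> y) = h x \<ominus>\<^bsub>N\<^esub> h y"
proof -
  interpret M: module K M by fact
  interpret N: module K N by fact
  note H = linear_mapD[OF assms(3)]
  have "h (x \<ominus>\<^bsub>M\<^esub> y) \<oplus>\<^bsub>N\<^esub> h y = h x"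
    using assms(4,5) by (simp add: M.minus_eq M.a_assoc M.l_neg flip: H(2))
  then have "h x \<ominus>\<^bsub>N\<^esub> h y = h (x \<ominus>\<^bsub>M\<^esub> y) \<oplus>\<^bsub>N\<^esub> h y \<ominus>\<^bsub>N\<^esub> h y" by simp
  then show ?thesis using assms(4,5) H(1) by (simp add: N.minus_eq N.a_assoc N.r_neg)
qed

text \<open>Unlike \<open>linear_map_eqI\<close> this allows targets without a scalar multiplication, such as tensor products
  over a noncommutative subalgebra.\<close>

lemma tensor_hom_eqI:
  assumes M: "module K M" and N: "module K N" and P: "abelian_group P"
    and h: "h \<in> hom (add_monoid (tensor K M N)) (add_monoid P)"
    and h': "h' \<in> hom (add_monoid (tensor K M N)) (add_monoid P)"
    and eq: "\<And>x y. \<lbrakk>x \<in> carrier M; y \<in> carrier N\<rbrakk> \<Longrightarrow> h (x \<diamondop>\<^bsub>tensor K M N\<^esub> y) = h' (x \<diamondop>\<^bsub>tensor K M N\<^esub> y)"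
    and t: "t \<in> carrier (tensor K M N)"
  shows "h t = h' t"
proof -
  interpret P: abelian_group P by fact
  interpret T: module K "tensor K M N" using M N by simp
  have zero: "k \<zero>\<^bsub>tensor K M N\<^esub> = \<zero>\<^bsub>P\<^esub>" if k: "k \<in> hom (add_monoid (tensor K M N)) (add_monoid P)" for k
  proof -
    have "k \<zero>\<^bsub>tensor K M N\<^esub> = k \<zero>\<^bsub>tensor K M N\<^esub> \<oplus>\<^bsub>P\<^esub> k \<zero>\<^bsub>tensor K M N\<^esub>"
      "k \<zero>\<^bsub>tensor K M N\<^esub> \<in> carrier P"
      using k hom_mult[OF k, of "\<zero>\<^bsub>tensor K M N\<^esub>" "\<zero>\<^bsub>tensor K M N\<^esub>"] by (auto simp: hom_def)
    then show ?thesis by simp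
  qed
  show ?thesis using M N t
  proof (induction t rule: tensor_induct)
    case (add t u)
    then show ?case using hom_mult[OF h, of t u] hom_mult[OF h', of t u] by simp
  qed (simp_all add: zero[OF h] zero[OF h'] eq)
qed

end

section \<open>Splittings over a field\<close>

lemma (in abelian_group) eq_of_minus_zero:
  assumes "x \<in> carrier G" "y \<in> carrier G" "x \<ominus> y = \<zero>"
  shows "x = y"
  using minus_equality[of x "\<ominus> y"] assms by (simp add: minus_eq)

lemma (in module) add_eq_cancel_disjoint:
  assumes "submodule U R M" "submodule W R M" "U \<inter> W = {\<zero>\<^bsub>M\<^esub>}"
    and "u \<in> U" "u' \<in> U" "w \<in> W" "w' \<in> W" and eq: "u \<oplus>\<^bsub>M\<^esub> w = u' \<oplus>\<^bsub>M\<^esub> w'"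
  shows "w = w'"
proof -
  note U = submoduleE[OF assms(1)] and W = submoduleE[OF assms(2)]
  have m: "u \<in> carrier M" "u' \<in> carrier M" "w \<in> carrier M" "w' \<in> carrier M"
    using U(1) W(1) assms(4-7) by auto
  have "u = u' \<oplus>\<^bsub>M\<^esub> w' \<ominus>\<^bsub>M\<^esub> w"
    using m by (simp add: eq[symmetric] M.minus_eq M.a_assoc M.r_neg)
  then have "w' \<ominus>\<^bsub>M\<^esub> w = \<ominus>\<^bsub>M\<^esub> u' \<oplus>\<^bsub>M\<^esub> u"
    using m by (simp add: M.minus_eq M.a_assoc M.r_neg1)
  moreover have "w' \<ominus>\<^bsub>M\<^esub> w \<in> W" "\<ominus>\<^bsub>M\<^esub> u' \<oplus>\<^bsub>M\<^esub> u \<in> U"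
    using assms(4-7) U W by (auto simp: M.minus_eq)
  ultimately have "w' \<ominus>\<^bsub>M\<^esub> w = \<zero>\<^bsub>M\<^esub>" using assms(3) by auto
  then show ?thesis using m M.eq_of_minus_zero by blast
qed

context tensor_calculus
begin

text \<open>Zorn's lemma gives a submodule \<open>U\<close> maximal among those meeting \<open>W\<close> only in zero. If some \<open>v\<close> were
  outside \<open>U + W\<close>, then \<open>U + K v\<close> would still meet \<open>W\<close> trivially, since a nonzero coefficient of \<open>v\<close>
  could be divided out. The projection along \<open>U\<close> is as wanted.\<close>

lemma submodule_projection:
  assumes "field K" and V: "module K V" and W: "submodule W K V"
  obtains p where "linear_map V V p" "\<And>x. x \<in> carrier V \<Longrightarrow> p x \<in> W" "\<And>w. w \<in> W \<Longrightarrow> p w = w"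
proof -
  interpret field K by fact
  interpret V: module K V by fact
  note Ws = V.submoduleE[OF W]
  define \<A> where "\<A> = {U. submodule U K V \<and> U \<inter> W = {\<zero>\<^bsub>V\<^esub>}}"
  have zero: "\<zero>\<^bsub>V\<^esub> \<in> U" if "submodule U K V" for U
    using subgroup.one_closed[OF submodule.axioms(1)[OF that]] by simp
  have "\<exists>U\<in>\<A>. \<forall>X\<in>\<A>. U \<subseteq> X \<longrightarrow> X = U"
  proof (rule subset_Zorn_nonempty)
    have "submodule {\<zero>\<^bsub>V\<^esub>} K V" by (rule V.submoduleI) auto
    then show "\<A> \<noteq> {}" using zero[OF W] by (auto simp: \<A>_def)
  next
    fix \<C> assume ne: "\<C> \<noteq> {}" and chain: "subset.chain \<A> \<C>"
    have sub: "submodule X K V" "X \<inter> W = {\<zero>\<^bsub>V\<^esub>}" if "X \<in> \<C>" for X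
      using chain that by (auto simp: subset.chain_def \<A>_def)
    note S = V.submoduleE[OF sub(1)]
    have "submodule (\<Union>\<C>) K V"
    proof (rule V.submoduleI)
      show "\<Union>\<C> \<subseteq> carrier V" using S(1) by blast
      show "\<zero>\<^bsub>V\<^esub> \<in> \<Union>\<C>" using ne zero sub by blast
      show "\<ominus>\<^bsub>V\<^esub> a \<in> \<Union>\<C>" if "a \<in> \<Union>\<C>" for a using that S(3) by blast
      show "s \<odot>\<^bsub>V\<^esub> a \<in> \<Union>\<C>" if "s \<in> carrier K" "a \<in> \<Union>\<C>" for s a using that S(4) by blast
      show "a \<oplus>\<^bsub>V\<^esub> b \<in> \<Union>\<C>" if "a \<in> \<Union>\<C>" "b \<in> \<Union>\<C>" for a b
      proof -
        obtain X Y where XY: "X \<in> \<C>" "Y \<in> \<C>" "a \<in> X" "b \<in> Y" using \<open>a \<in> \<Union>\<C>\<close> \<open>b \<in> \<Union>\<C>\<close> by blast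
        then have "X \<subseteq> Y \<or> Y \<subseteq> X" using chain by (auto simp: subset.chain_def)
        then show ?thesis using XY S(5) by blast
      qed
    qed
    moreover have "\<Union>\<C> \<inter> W = {\<zero>\<^bsub>V\<^esub>}" using ne sub(2) by blast
    ultimately show "\<Union>\<C> \<in> \<A>" by (simp add: \<A>_def)
  qed
  then obtain U where U: "submodule U K V" "U \<inter> W = {\<zero>\<^bsub>V\<^esub>}"
    and max: "\<And>X. \<lbrakk>submodule X K V; X \<inter> W = {\<zero>\<^bsub>V\<^esub>}; U \<subseteq> X\<rbrakk> \<Longrightarrow> X = U"
    by (auto simp: \<A>_def)
  note Us = V.submoduleE[OF U(1)]
  have sum: "\<exists>u\<in>U. \<exists>w\<in>W. v = u \<oplus>\<^bsub>V\<^esub> w" if v: "v \<in> carrier V" for v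
  proof (rule ccontr)
    assume no: "\<not> ?thesis"
    let ?X = "{u \<oplus>\<^bsub>V\<^esub> s \<odot>\<^bsub>V\<^esub> v | u s. u \<in> U \<and> s \<in> carrier K}"
    have X: "submodule ?X K V"
    proof (rule V.submoduleI)
      show "?X \<subseteq> carrier V" using Us(1) v by auto
      show "\<zero>\<^bsub>V\<^esub> \<in> ?X" using zero[OF U(1)] v by (auto intro!: exI[of _ "\<zero>\<^bsub>V\<^esub>"] exI[of _ "\<zero>\<^bsub>K\<^esub>"])
      show "\<ominus>\<^bsub>V\<^esub> a \<in> ?X" if a: "a \<in> ?X" for a
      proof -
        obtain u s where "a = u \<oplus>\<^bsub>V\<^esub> s \<odot>\<^bsub>V\<^esub> v" "u \<in> U" "s \<in> carrier K" using a by blast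
        then have "\<ominus>\<^bsub>V\<^esub> a = \<ominus>\<^bsub>V\<^esub> u \<oplus>\<^bsub>V\<^esub> (\<ominus>\<^bsub>K\<^esub> s) \<odot>\<^bsub>V\<^esub> v" "\<ominus>\<^bsub>V\<^esub> u \<in> U"
          using Us v by (auto simp: V.smult_l_minus V.minus_add)
        then show ?thesis using \<open>s \<in> carrier K\<close> by blast
      qed
      show "r \<odot>\<^bsub>V\<^esub> a \<in> ?X" if r: "r \<in> carrier K" and a: "a \<in> ?X" for r a
      proof -
        obtain u s where us: "a = u \<oplus>\<^bsub>V\<^esub> s \<odot>\<^bsub>V\<^esub> v" "u \<in> U" "s \<in> carrier K" using a by blast
        then have "r \<odot>\<^bsub>V\<^esub> a = r \<odot>\<^bsub>V\<^esub> u \<oplus>\<^bsub>V\<^esub> (r \<otimes>\<^bsub>K\<^esub> s) \<odot>\<^bsub>V\<^esub> v" "r \<odot>\<^bsub>V\<^esub> u \<in> U"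
          using Us v r by (auto simp: V.smult_r_distr V.smult_assoc1)
        then show ?thesis using us r by blast
      qed
      show "a \<oplus>\<^bsub>V\<^esub> b \<in> ?X" if a: "a \<in> ?X" and b: "b \<in> ?X" for a b
      proof -
        obtain u s u' s' where us: "a = u \<oplus>\<^bsub>V\<^esub> s \<odot>\<^bsub>V\<^esub> v" "u \<in> U" "s \<in> carrier K"
          "b = u' \<oplus>\<^bsub>V\<^esub> s' \<odot>\<^bsub>V\<^esub> v" "u' \<in> U" "s' \<in> carrier K" using a b by blast
        then have m: "u \<in> carrier V" "u' \<in> carrier V" using Us(1) by auto
        have "a \<oplus>\<^bsub>V\<^esub> b = (u \<oplus>\<^bsub>V\<^esub> u') \<oplus>\<^bsub>V\<^esub> (s \<oplus>\<^bsub>K\<^esub> s') \<odot>\<^bsub>V\<^esub> v" "u \<oplus>\<^bsub>V\<^esub> u' \<in> U"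
          using us m Us(5) v by (auto simp: V.smult_l_distr V.a_ac)
        then show ?thesis using us by blast
      qed
    qed
    have vX: "v \<in> ?X" using zero[OF U(1)] v by (auto intro!: exI[of _ "\<zero>\<^bsub>V\<^esub>"] exI[of _ "\<one>\<^bsub>K\<^esub>"])
    have "U \<subseteq> ?X"
    proof
      fix u assume "u \<in> U"
      moreover have "u = u \<oplus>\<^bsub>V\<^esub> \<zero>\<^bsub>K\<^esub> \<odot>\<^bsub>V\<^esub> v" using \<open>u \<in> U\<close> Us(1) v by auto
      ultimately show "u \<in> ?X" by blast
    qed
    moreover have "x = \<zero>\<^bsub>V\<^esub>" if x: "x \<in> ?X" "x \<in> W" for x
    proof -
      obtain u s where us: "x = u \<oplus>\<^bsub>V\<^esub> s \<odot>\<^bsub>V\<^esub> v" "u \<in> U" "s \<in> carrier K" using x by blast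
      have m: "u \<in> carrier V" "x \<in> carrier V" using us Us(1) x Ws(1) by auto
      show ?thesis
      proof (cases "s = \<zero>\<^bsub>K\<^esub>")
        case True
        then have "x = u" using us m v by simp
        then show ?thesis using us(2) x(2) U(2) by blast
      next
        case False
        then have inv: "inv\<^bsub>K\<^esub> s \<in> carrier K" "inv\<^bsub>K\<^esub> s \<otimes>\<^bsub>K\<^esub> s = \<one>\<^bsub>K\<^esub>"
          using us field_Units by auto
        have "s \<odot>\<^bsub>V\<^esub> v = \<ominus>\<^bsub>V\<^esub> u \<oplus>\<^bsub>V\<^esub> x" using us m v by (simp add: V.r_neg1)
        moreover have "v = inv\<^bsub>K\<^esub> s \<odot>\<^bsub>V\<^esub> (s \<odot>\<^bsub>V\<^esub> v)"
          using inv us v by (simp flip: V.smult_assoc1)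
        ultimately have "v = inv\<^bsub>K\<^esub> s \<odot>\<^bsub>V\<^esub> (\<ominus>\<^bsub>V\<^esub> u \<oplus>\<^bsub>V\<^esub> x)" by simp
        also have "\<dots> = inv\<^bsub>K\<^esub> s \<odot>\<^bsub>V\<^esub> (\<ominus>\<^bsub>V\<^esub> u) \<oplus>\<^bsub>V\<^esub> inv\<^bsub>K\<^esub> s \<odot>\<^bsub>V\<^esub> x"
          using inv m by (simp add: V.smult_r_distr)
        finally have "v = \<dots>" .
        moreover have "inv\<^bsub>K\<^esub> s \<odot>\<^bsub>V\<^esub> (\<ominus>\<^bsub>V\<^esub> u) \<in> U" "inv\<^bsub>K\<^esub> s \<odot>\<^bsub>V\<^esub> x \<in> W"
          using inv us x Us(3,4) Ws(4) by auto
        ultimately show ?thesis using no by blast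
      qed
    qed
    ultimately have "?X = U" using max[OF X] zero[OF X] zero[OF W] by blast
    then have "v \<in> U" using vX by simp
    moreover have "v = v \<oplus>\<^bsub>V\<^esub> \<zero>\<^bsub>V\<^esub>" using v by simp
    ultimately show False using no zero[OF W] by blast
  qed
  define p where "p v = (THE w. w \<in> W \<and> (\<exists>u\<in>U. v = u \<oplus>\<^bsub>V\<^esub> w))" for v
  have p: "p (u \<oplus>\<^bsub>V\<^esub> w) = w" if "u \<in> U" "w \<in> W" for u w
    unfolding p_def using that V.add_eq_cancel_disjoint[OF U(1) W U(2)]
    by (intro the_equality) blast+
  show thesis
  proof (rule that)
    show "linear_map V V p"
    proof (rule linear_mapI)
      fix x assume "x \<in> carrier V"
      with sum obtain u w where uw: "u \<in> U" "w \<in> W" "x = u \<oplus>\<^bsub>V\<^esub> w" by blast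
      note m [simp] = subsetD[OF Us(1) uw(1)] subsetD[OF Ws(1) uw(2)]
      show "p x \<in> carrier V" using uw by (simp add: p)
      show "p (s \<odot>\<^bsub>V\<^esub> x) = s \<odot>\<^bsub>V\<^esub> p x" if "s \<in> carrier K" for s
        using uw that Us(4) Ws(4) by (simp add: p V.smult_r_distr)
      fix y assume "y \<in> carrier V"
      with sum obtain u' w' where uw': "u' \<in> U" "w' \<in> W" "y = u' \<oplus>\<^bsub>V\<^esub> w'" by blast
      note m' [simp] = subsetD[OF Us(1) uw'(1)] subsetD[OF Ws(1) uw'(2)]
      have "x \<oplus>\<^bsub>V\<^esub> y = (u \<oplus>\<^bsub>V\<^esub> u') \<oplus>\<^bsub>V\<^esub> (w \<oplus>\<^bsub>V\<^esub> w')" using uw uw' by (simp add: V.a_ac)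
      then show "p (x \<oplus>\<^bsub>V\<^esub> y) = p x \<oplus>\<^bsub>V\<^esub> p y"
        using uw uw' Us(5) Ws(5) by (simp add: p)
    qed
    show "p w = w" if "w \<in> W" for w
      using p[OF zero[OF U(1)] that] subsetD[OF Ws(1) that] by simp
    show "p x \<in> W" if x: "x \<in> carrier V" for x using sum[OF x] p by auto
  qed
qed

lemma linear_map_diff:
  assumes "module K M" "module K N" "linear_map M N f" "linear_map M N g"
  shows "linear_map M N (\<lambda>x. f x \<ominus>\<^bsub>N\<^esub> g x)"
proof -
  interpret M: module K M by fact
  interpret N: module K N by fact
  note F = linear_mapD[OF assms(3)] and G = linear_mapD[OF assms(4)]
  show ?thesis
    using F G by (intro linear_mapI) (auto simp: N.minus_eq N.minus_add N.smult_r_distr N.smult_r_minus N.a_ac)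
qed

text \<open>Retract \<open>N\<close> onto the image of \<open>f\<close>, choose preimages, and make the choice linear by applying to them
  the projection of \<open>M\<close> onto a complement of the kernel.\<close>

lemma generalized_inverse:
  assumes K: "field K" and M: "module K M" and N: "module K N" and f: "linear_map M N f"
  obtains g where "linear_map N M g" "\<And>x. x \<in> carrier M \<Longrightarrow> f (g (f x)) = f x"
proof -
  interpret M: module K M by fact
  interpret N: module K N by fact
  note F = linear_mapD[OF f] and F0 = linear_map_zero[OF f M N]
  have neg: "h (\<ominus>\<^bsub>M\<^esub> x) = \<ominus>\<^bsub>N'\<^esub> h x"
    if "linear_map M N' h" "module K N'" "x \<in> carrier M" for h N' x
  proof -
    interpret N': module K N' by fact
    show ?thesis
      using linear_map_add[OF that(1), of "\<ominus>\<^bsub>M\<^esub> x" x] linear_mapD(1)[OF that(1)] that(3)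
        linear_map_zero[OF that(1) M that(2)]
      by (intro N'.minus_equality[symmetric]) (simp_all add: M.l_neg)
  qed
  have ker: "submodule {x \<in> carrier M. f x = \<zero>\<^bsub>N\<^esub>} K M"
    by (rule M.submoduleI) (auto simp: F F0 neg[OF f N])
  have im: "submodule (f ` carrier M) K N"
  proof (rule N.submoduleI)
    show "\<zero>\<^bsub>N\<^esub> \<in> f ` carrier M" using F0 by (metis M.zero_closed imageI)
    show "\<ominus>\<^bsub>N\<^esub> a \<in> f ` carrier M" if "a \<in> f ` carrier M" for a
      using that neg[OF f N] by (auto simp flip: neg[OF f N])
    show "a \<oplus>\<^bsub>N\<^esub> b \<in> f ` carrier M" if "a \<in> f ` carrier M" "b \<in> f ` carrier M" for a b
      using that by (auto simp flip: F(2))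
    show "s \<odot>\<^bsub>N\<^esub> a \<in> f ` carrier M" if "s \<in> carrier K" "a \<in> f ` carrier M" for s a
      using that by (auto simp flip: F(3))
  qed (use F in auto)
  obtain p where p: "linear_map M M p" "\<And>x. x \<in> carrier M \<Longrightarrow> p x \<in> {x \<in> carrier M. f x = \<zero>\<^bsub>N\<^esub>}"
    "\<And>x. x \<in> {x \<in> carrier M. f x = \<zero>\<^bsub>N\<^esub>} \<Longrightarrow> p x = x"
    using submodule_projection[OF K M ker] by blast
  obtain q where q: "linear_map N N q" "\<And>y. y \<in> carrier N \<Longrightarrow> q y \<in> f ` carrier M"
    "\<And>y. y \<in> f ` carrier M \<Longrightarrow> q y = y"
    using submodule_projection[OF K N im] by blast
  define c where "c x = x \<ominus>\<^bsub>M\<^esub> p x" for x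
  have c: "linear_map M M c"
    unfolding c_def by (intro linear_map_diff M linear_map_id p)
  have fc: "f (c x) = f x" if "x \<in> carrier M" for x
    using that p(2)[OF that] by (simp add: c_def M.minus_eq F neg[OF f N])
  \<comment> \<open>The complementary projection forgets exactly what \<open>f\<close> forgets.\<close>
  have cong: "c x = c y" if "x \<in> carrier M" "y \<in> carrier M" "f x = f y" for x y
  proof -
    have d: "x \<ominus>\<^bsub>M\<^esub> y \<in> carrier M" using that by simp
    have "f (x \<ominus>\<^bsub>M\<^esub> y) = \<zero>\<^bsub>N\<^esub>" using that by (simp add: M.minus_eq F neg[OF f N] N.r_neg)
    then have "c (x \<ominus>\<^bsub>M\<^esub> y) = \<zero>\<^bsub>M\<^esub>"
      using p(3)[of "x \<ominus>\<^bsub>M\<^esub> y"] d unfolding c_def by (simp add: M.minus_eq M.r_neg)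
    then have "c x \<oplus>\<^bsub>M\<^esub> \<ominus>\<^bsub>M\<^esub> c y = \<zero>\<^bsub>M\<^esub>"
      using that linear_map_add[OF c, of x "\<ominus>\<^bsub>M\<^esub> y"] neg[OF c M] by (simp add: M.minus_eq)
    then show ?thesis using that linear_map_closed[OF c] M.eq_of_minus_zero[of "c x" "c y"]
      by (simp add: M.minus_eq)
  qed
  define r where "r y = (SOME x. x \<in> carrier M \<and> f x = q y)" for y
  have r: "r y \<in> carrier M" "f (r y) = q y" if "y \<in> carrier N" for y
  proof -
    have "\<exists>x. x \<in> carrier M \<and> f x = q y" using q(2)[OF that] by (metis imageE)
    from someI_ex[OF this] show "r y \<in> carrier M" "f (r y) = q y" by (simp_all add: r_def)
  qed
  note Q = linear_mapD[OF q(1)]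
  have "linear_map N M (\<lambda>y. c (r y))"
  proof (rule linear_mapI)
    show "c (r y) \<in> carrier M" if "y \<in> carrier N" for y
      using r(1)[OF that] linear_map_closed[OF c] by simp
    show "c (r (x \<oplus>\<^bsub>N\<^esub> y)) = c (r x) \<oplus>\<^bsub>M\<^esub> c (r y)" if "x \<in> carrier N" "y \<in> carrier N" for x y
      using r that by (subst linear_map_add[OF c, symmetric]) (auto intro!: cong simp: F Q)
    show "c (r (s \<odot>\<^bsub>N\<^esub> x)) = s \<odot>\<^bsub>M\<^esub> c (r x)" if "s \<in> carrier K" "x \<in> carrier N" for s x
      using r that by (subst linear_map_smult[OF c, symmetric]) (auto intro!: cong simp: F Q)
  qed
  moreover have "f (c (r (f x))) = f x" if "x \<in> carrier M" for x
    using fc[OF r(1)] r(2) q(3) that F(1) by simp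
  ultimately show thesis by (rule that)
qed

end

section \<open>Sweedler rules for the structure maps\<close>

sublocale coalgebra \<subseteq> tensor_calculus K
  by (intro tensor_calculus.intro K.is_cring)

context coalgebra
begin

lemma C_module [simp]: "module K C"
  by (rule C.module_axioms)

lemmas comult_rules [simp] = linear_map_rules[OF comult_linear[folded linear_map_def]]
lemmas counit_rules [simp] = linear_map_rules[OF counit_linear[folded linear_map_def]]

lemma counit_closed [simp]: "c \<in> carrier C \<Longrightarrow> \<epsilon> c \<in> carrier K"
  using counit_rules(1) by (simp add: carrier_self_module)

text \<open>The axiom equates two elements of \<open>C \<otimes> (C \<otimes> C)\<close>; evaluating an arbitrary trilinear function on them
  gives the form in which Sweedler calculations use it. The other structural axioms below are
  converted in the same way.\<close>

lemma comult_coassoc: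
  assumes "module K P" "c \<in> carrier C" "trilinear_map C C C P F"
  shows "lift C C P (\<lambda>d z. lift C C P (\<lambda>x y. F x y z) (\<Delta> d)) (\<Delta> c) =
    lift C C P (\<lambda>x d. lift C C P (\<lambda>y z. F x y z) (\<Delta> d)) (\<Delta> c)"
  using arg_cong[OF coassoc[OF assms(2)], of "lift C (tensor K C C) P (\<lambda>x d. lift C C P (F x) d)"]
    trilinear_mapD[OF assms(3)] assms(1,2)
  by (simp add: tensor_defs)

lemma comult_counit:
  assumes "module K P" "c \<in> carrier C" "linear_map C P h"
  shows "lift C C P (\<lambda>x y. \<epsilon> x \<odot>\<^bsub>P\<^esub> h y) (\<Delta> c) = h c"
    and "lift C C P (\<lambda>x y. \<epsilon> y \<odot>\<^bsub>P\<^esub> h x) (\<Delta> c) = h c"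
  using arg_cong[OF counit_left[OF assms(2)], of h] arg_cong[OF counit_right[OF assms(2)], of h] assms
  by (simp_all add: tensor_defs linear_map_rules[OF assms(3)] linear_map_smult[OF assms(3)])

end

context assoc_algebra
begin

sublocale tensor_calculus K
  by (intro tensor_calculus.intro K.is_cring)

lemma A_module [simp]: "module K A"
  by (rule A.module_axioms)

lemma linear_map_mult_left [simp]:
  "\<lbrakk>linear_map M A F; y \<in> carrier A\<rbrakk> \<Longrightarrow> linear_map M A (\<lambda>x. F x \<otimes>\<^bsub>A\<^esub> y)"
  by (rule linear_mapI) (simp_all add: linear_mapD A.l_distr smult_mult_left)

lemma linear_map_mult_right [simp]:
  "\<lbrakk>linear_map M A F; x \<in> carrier A\<rbrakk> \<Longrightarrow> linear_map M A (\<lambda>y. x \<otimes>\<^bsub>A\<^esub> F y)"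
  by (rule linear_mapI) (simp_all add: linear_mapD A.r_distr smult_mult_right)

lemma mult_lift_left [simp]:
  assumes "module K M" "module K N" "bilinear_map M N A f" "t \<in> carrier (tensor K M N)" "a \<in> carrier A"
  shows "lift M N A f t \<otimes>\<^bsub>A\<^esub> a = lift M N A (\<lambda>x y. f x y \<otimes>\<^bsub>A\<^esub> a) t"
  by (rule linear_map_of_lift[where h="\<lambda>x. x \<otimes>\<^bsub>A\<^esub> a" and P=A]) (use assms in auto)

lemma mult_lift_right [simp]:
  assumes "module K M" "module K N" "bilinear_map M N A f" "t \<in> carrier (tensor K M N)" "a \<in> carrier A"
  shows "a \<otimes>\<^bsub>A\<^esub> lift M N A f t = lift M N A (\<lambda>x y. a \<otimes>\<^bsub>A\<^esub> f x y) t"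
  by (rule linear_map_of_lift[where h="\<lambda>x. a \<otimes>\<^bsub>A\<^esub> x" and P=A]) (use assms in auto)

end

context right_comodule
begin

lemma comodule_module [simp]: "module K A"
  by (rule A.module_axioms)

lemmas coaction_rules [simp] = linear_map_rules[OF coaction_linear[folded linear_map_def]]

lemma coaction_coassoc_lift:
  assumes "module K P" "a \<in> carrier A" "trilinear_map A C C P F"
  shows "lift A C P (\<lambda>x d. lift A C P (\<lambda>y c. F y c d) (\<rho> x)) (\<rho> a) =
    lift A C P (\<lambda>x c. lift C C P (\<lambda>y z. F x y z) (\<Delta> c)) (\<rho> a)"
  using arg_cong[OF coaction_coassoc[OF assms(2)], of "lift A (tensor K C C) P (\<lambda>x d. lift C C P (F x) d)"]
    trilinear_mapD[OF assms(3)] assms(1,2)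
  by (simp add: tensor_defs)

lemma coaction_counit_lift:
  assumes "a \<in> carrier A"
  shows "lift A C A (\<lambda>x c. \<epsilon> c \<odot>\<^bsub>A\<^esub> x) (\<rho> a) = a"
  using coaction_counit[OF assms] assms by (simp add: tensor_defs)

end

context entwining_map
begin

lemmas entwining_rules [simp] = linear_map_rules[OF entwining_linear[folded linear_map_def]]

lemma entwining_mult_lift:
  assumes "c \<in> carrier C" "a \<in> carrier A" "a' \<in> carrier A"
  shows "\<psi> (c \<diamondop>\<^bsub>tensor K C A\<^esub> (a \<otimes>\<^bsub>A\<^esub> a')) =
    lift A C (tensor K A C)
      (\<lambda>x d. lift A C (tensor K A C) (\<lambda>y e. (x \<otimes>\<^bsub>A\<^esub> y) \<diamondop>\<^bsub>tensor K A C\<^esub> e) (\<psi> (d \<diamondop>\<^bsub>tensor K C A\<^esub> a')))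
      (\<psi> (c \<diamondop>\<^bsub>tensor K C A\<^esub> a))"
  using entwining_mult[of "c \<diamondop>\<^bsub>tensor K C (tensor K A A)\<^esub> (a \<diamondop>\<^bsub>tensor K A A\<^esub> a')"] assms
  by (simp add: tensor_defs)

lemma entwining_comult_lift:
  assumes "module K P" "c \<in> carrier C" "a \<in> carrier A" "trilinear_map A C C P F"
  shows "lift A C P (\<lambda>x d. lift C C P (\<lambda>e f. F x e f) (\<Delta> d)) (\<psi> (c \<diamondop>\<^bsub>tensor K C A\<^esub> a)) =
    lift C C P (\<lambda>c1 c2. lift A C P (\<lambda>x f. lift A C P (\<lambda>y e. F y e f) (\<psi> (c1 \<diamondop>\<^bsub>tensor K C A\<^esub> x)))
        (\<psi> (c2 \<diamondop>\<^bsub>tensor K C A\<^esub> a))) (\<Delta> c)"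
  using arg_cong[OF entwining_comult[of "c \<diamondop>\<^bsub>tensor K C A\<^esub> a"],
      of "lift A (tensor K C C) P (\<lambda>x d. lift C C P (F x) d)"]
    trilinear_mapD[OF assms(4)] assms(1-3)
  by (simp add: tensor_defs)

end

section \<open>The left coaction of an entwined extension\<close>

context entwined_extension
begin

definition inv_entwining :: "('a, 'c) tensor \<Rightarrow> ('c, 'a) tensor" where
  "inv_entwining = the_inv_into (carrier (tensor K C A)) \<psi>"

abbreviation lambda :: "'a \<Rightarrow> ('c, 'a) tensor" where
  "lambda \<equiv> left_coaction K A C \<rho> \<psi>"

lemma inv_entwining_linear: "linear_map (tensor K A C) (tensor K C A) inv_entwining"
  and inv_entwining_left [simp]: "z \<in> carrier (tensor K C A) \<Longrightarrow> inv_entwining (\<psi> z) = z"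
  and inv_entwining_right [simp]: "w \<in> carrier (tensor K A C) \<Longrightarrow> \<psi> (inv_entwining w) = w"
proof -
  have inj: "inj_on \<psi> (carrier (tensor K C A))" and im: "\<psi> ` carrier (tensor K C A) = carrier (tensor K A C)"
    using entwining_bij by (auto simp: bij_betw_def)
  interpret T: module K "tensor K C A" by simp
  show l: "inv_entwining (\<psi> z) = z" if "z \<in> carrier (tensor K C A)" for z
    using the_inv_into_f_f[OF inj that] by (simp add: inv_entwining_def)
  show r: "\<psi> (inv_entwining w) = w" if "w \<in> carrier (tensor K A C)" for w
    using f_the_inv_into_f[OF inj, of w] im that by (simp add: inv_entwining_def)
  have c: "inv_entwining w \<in> carrier (tensor K C A)" if "w \<in> carrier (tensor K A C)" for w
  proof -
    have "w \<in> \<psi> ` carrier (tensor K C A)" using im that by simp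
    then obtain z where "z \<in> carrier (tensor K C A)" "w = \<psi> z" ..
    then show ?thesis by (simp only: l)
  qed
  note psi = linear_mapD[OF entwining_linear[folded linear_map_def]]
  have eq: "inv_entwining x = y" if "y \<in> carrier (tensor K C A)" "\<psi> y = x" for x y
    using l[OF that(1)] that(2) by simp
  show "linear_map (tensor K A C) (tensor K C A) inv_entwining"
    by (rule linear_mapI, rule c, assumption) (rule eq; simp add: c r psi)+
qed

lemmas inv_entwining_rules [simp] = linear_map_rules[OF inv_entwining_linear]

lemma left_coaction_lift:
  "a \<in> carrier A \<Longrightarrow> lambda a =
    lift A C (tensor K C A) (\<lambda>x c. inv_entwining ((a \<otimes>\<^bsub>A\<^esub> x) \<diamondop>\<^bsub>tensor K A C\<^esub> c)) (\<rho> \<one>\<^bsub>A\<^esub>)"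
  by (simp add: left_coaction_def tensor_defs flip: inv_entwining_def)

lemma left_coaction_linear: "linear_map A (tensor K C A) lambda"
  by (rule linear_map_cong[OF left_coaction_lift[symmetric]]) simp_all

lemmas left_coaction_rules [simp] = linear_map_rules[OF left_coaction_linear]

lemma entwining_left_coaction:
  "a \<in> carrier A \<Longrightarrow> \<psi> (lambda a) =
    lift A C (tensor K A C) (\<lambda>x c. (a \<otimes>\<^bsub>A\<^esub> x) \<diamondop>\<^bsub>tensor K A C\<^esub> c) (\<rho> \<one>\<^bsub>A\<^esub>)"
  by (simp add: left_coaction_lift)

lemma coaction_mult_lift:
  "\<lbrakk>a \<in> carrier A; a' \<in> carrier A\<rbrakk> \<Longrightarrow> \<rho> (a \<otimes>\<^bsub>A\<^esub> a') =
    lift A C (tensor K A C)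
      (\<lambda>x c. lift A C (tensor K A C) (\<lambda>y d. (x \<otimes>\<^bsub>A\<^esub> y) \<diamondop>\<^bsub>tensor K A C\<^esub> d) (\<psi> (c \<diamondop>\<^bsub>tensor K C A\<^esub> a')))
      (\<rho> a)"
  by (simp add: coaction_mult tensor_defs)

text \<open>The identity \<open>a\<^sub>-\<^sub>1 \<otimes> a\<^sub>0 a' = \<phi> (a \<rho> a')\<close>: the left coaction of \<open>a\<close> and the right coaction of \<open>a'\<close>
  determine each other through the entwining. It is checked after applying \<open>\<psi>\<close>.\<close>

lemma left_coaction_mult:
  assumes "a \<in> carrier A" "a' \<in> carrier A"
  shows "lift C A (tensor K C A) (\<lambda>c x. c \<diamondop>\<^bsub>tensor K C A\<^esub> (x \<otimes>\<^bsub>A\<^esub> a')) (lambda a) =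
    lift A C (tensor K C A) (\<lambda>x c. inv_entwining ((a \<otimes>\<^bsub>A\<^esub> x) \<diamondop>\<^bsub>tensor K A C\<^esub> c)) (\<rho> a')"
    (is "?l = ?r")
proof -
  let ?AC = "tensor K A C"
  let ?G = "\<lambda>y d. lift A C ?AC (\<lambda>z e. (y \<otimes>\<^bsub>A\<^esub> z) \<diamondop>\<^bsub>?AC\<^esub> e) (\<psi> (d \<diamondop>\<^bsub>tensor K C A\<^esub> a'))"
  have "\<psi> ?l = lift C A ?AC (\<lambda>c x. lift A C ?AC ?G (\<psi> (c \<diamondop>\<^bsub>tensor K C A\<^esub> x))) (lambda a)"
    using assms by (simp add: entwining_mult_lift)
  also have "\<dots> = lift A C ?AC ?G (\<psi> (lambda a))"
    using assms by (intro lift_linear_map_pure) simp_all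
  also have "\<dots> = lift A C ?AC (\<lambda>x c. ?G (a \<otimes>\<^bsub>A\<^esub> x) c) (\<rho> \<one>\<^bsub>A\<^esub>)"
    using assms by (simp add: entwining_left_coaction)
  also have "\<dots> = lift A C ?AC (\<lambda>x c. (a \<otimes>\<^bsub>A\<^esub> x) \<diamondop>\<^bsub>?AC\<^esub> c) (\<rho> (\<one>\<^bsub>A\<^esub> \<otimes>\<^bsub>A\<^esub> a'))"
    using assms by (simp add: coaction_mult_lift A.m_assoc del: A.l_one)
  finally have "inv_entwining (\<psi> ?l) =
      inv_entwining (lift A C ?AC (\<lambda>x c. (a \<otimes>\<^bsub>A\<^esub> x) \<diamondop>\<^bsub>?AC\<^esub> c) (\<rho> a'))"
    using assms by simp
  then show ?thesis using assms by simp
qed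

text \<open>The compatibility of \<open>\<psi>\<close> with the coproduct, read backwards: splitting the \<open>C\<close>-leg of \<open>\<phi> (a \<otimes> d)\<close> is
  the same as splitting \<open>d\<close> and passing the two pieces through \<open>a\<close> one after the other. The sum over
  \<open>\<phi> (a \<otimes> d)\<close> is rewritten with the axiom for \<open>\<psi>\<close>, and then \<open>\<psi> \<circ> \<phi>\<close> cancels.\<close>

lemma inv_entwining_comult:
  assumes P: "module K P" and a: "a \<in> carrier A" "d \<in> carrier C" and F: "trilinear_map C C A P F"
  shows "lift C A P (\<lambda>c x. lift C C P (\<lambda>c1 c2. F c1 c2 x) (\<Delta> c)) (inv_entwining (a \<diamondop>\<^bsub>tensor K A C\<^esub> d)) =
    lift C C P (\<lambda>d1 d2. lift C A P (\<lambda>c1 x. lift C A P (\<lambda>c2 y. F c1 c2 y)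
        (inv_entwining (x \<diamondop>\<^bsub>tensor K A C\<^esub> d2))) (inv_entwining (a \<diamondop>\<^bsub>tensor K A C\<^esub> d1))) (\<Delta> d)"
proof -
  note F [simp] = trilinear_mapD[OF F]
  note [simp] = P
  let ?G = "\<lambda>y e f. lift C A P (\<lambda>c1 x. lift C A P (\<lambda>c2 z. F c1 c2 z)
        (inv_entwining (x \<diamondop>\<^bsub>tensor K A C\<^esub> f))) (inv_entwining (y \<diamondop>\<^bsub>tensor K A C\<^esub> e))"
  let ?w = "inv_entwining (a \<diamondop>\<^bsub>tensor K A C\<^esub> d)"
  have G: "trilinear_map A C C P ?G" by simp
  have step: "lift C C P (\<lambda>c1 c2. F c1 c2 x) (\<Delta> c) =
      lift A C P (\<lambda>y e. lift C C P (\<lambda>e f. ?G y e f) (\<Delta> e)) (\<psi> (c \<diamondop>\<^bsub>tensor K C A\<^esub> x))"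
    if "c \<in> carrier C" "x \<in> carrier A" for c x
  proof -
    have "lift A C P (\<lambda>y e. ?G y e f) (\<psi> (c1 \<diamondop>\<^bsub>tensor K C A\<^esub> z)) =
        lift C A P (\<lambda>c1 x. lift C A P (\<lambda>c2 z. F c1 c2 z) (inv_entwining (x \<diamondop>\<^bsub>tensor K A C\<^esub> f)))
          (inv_entwining (\<psi> (c1 \<diamondop>\<^bsub>tensor K C A\<^esub> z)))"
      if "c1 \<in> carrier C" "z \<in> carrier A" "f \<in> carrier C" for c1 z f
      by (rule lift_linear_map_pure[where h="\<lambda>w. lift C A P (\<lambda>c1 x. lift C A P (\<lambda>c2 z. F c1 c2 z)
          (inv_entwining (x \<diamondop>\<^bsub>tensor K A C\<^esub> f))) (inv_entwining w)"]) (use that in simp_all)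
    moreover have "lift A C P (\<lambda>z f. lift C A P (\<lambda>c2 z. F c1 c2 z) (inv_entwining (z \<diamondop>\<^bsub>tensor K A C\<^esub> f)))
          (\<psi> (c2 \<diamondop>\<^bsub>tensor K C A\<^esub> x)) = F c1 c2 x"
      if "c1 \<in> carrier C" "c2 \<in> carrier C" for c1 c2
      by (subst lift_linear_map_pure[where h="\<lambda>w. lift C A P (\<lambda>c2 z. F c1 c2 z) (inv_entwining w)"])
        (use that \<open>x \<in> carrier A\<close> in simp_all)
    ultimately show ?thesis
      using that by (simp add: entwining_comult_lift[OF P _ _ G])
  qed
  have "lift C A P (\<lambda>c x. lift C C P (\<lambda>c1 c2. F c1 c2 x) (\<Delta> c)) ?w =
      lift C A P (\<lambda>c x. lift A C P (\<lambda>y e. lift C C P (\<lambda>e f. ?G y e f) (\<Delta> e)) (\<psi> (c \<diamondop>\<^bsub>tensor K C A\<^esub> x))) ?w"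
    by (rule tensor_lift_cong[OF step refl])
  also have "\<dots> = lift A C P (\<lambda>y e. lift C C P (\<lambda>e f. ?G y e f) (\<Delta> e)) (\<psi> ?w)"
    by (rule lift_linear_map_pure[where h="\<lambda>w. lift A C P (\<lambda>y e. lift C C P (\<lambda>e f. ?G y e f) (\<Delta> e)) (\<psi> w)"])
      (use a in simp_all)
  finally show ?thesis using a by simp
qed

text \<open>Since \<open>\<lambda> a = \<phi> (a 1\<^sub>0 \<otimes> 1\<^sub>1)\<close>, the previous rule splits \<open>1\<^sub>1\<close>; coassociativity of \<open>\<rho>\<close> trades this
  splitting for a second coaction on \<open>1\<^sub>0\<close>, which \<open>left_coaction_mult\<close> recombines to \<open>\<lambda> a\<close>.\<close>

lemma left_coaction_coassoc:
  assumes P: "module K P" and a: "a \<in> carrier A" and F: "trilinear_map C C A P F"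
  shows "lift C A P (\<lambda>c x. lift C C P (\<lambda>c1 c2. F c1 c2 x) (\<Delta> c)) (lambda a) =
    lift C A P (\<lambda>c1 x. lift C A P (\<lambda>c2 y. F c1 c2 y) (lambda x)) (lambda a)"
proof -
  note [simp] = P trilinear_mapD[OF F]
  let ?AC = "tensor K A C"
  let ?H = "\<lambda>c1 x d. lift C A P (\<lambda>c2 y. F c1 c2 y) (inv_entwining (x \<diamondop>\<^bsub>?AC\<^esub> d))"
  have "lift C A P (\<lambda>c x. lift C C P (\<lambda>c1 c2. F c1 c2 x) (\<Delta> c)) (lambda a) =
      lift A C P (\<lambda>u d. lift C C P (\<lambda>d1 d2. lift C A P (\<lambda>c x. ?H c x d2)
        (inv_entwining ((a \<otimes>\<^bsub>A\<^esub> u) \<diamondop>\<^bsub>?AC\<^esub> d1))) (\<Delta> d)) (\<rho> \<one>\<^bsub>A\<^esub>)"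
    using a by (simp add: left_coaction_lift inv_entwining_comult[OF P _ _ F])
  also have "\<dots> = lift A C P (\<lambda>u d2. lift A C P (\<lambda>v d1. lift C A P (\<lambda>c x. ?H c x d2)
        (inv_entwining ((a \<otimes>\<^bsub>A\<^esub> v) \<diamondop>\<^bsub>?AC\<^esub> d1))) (\<rho> u)) (\<rho> \<one>\<^bsub>A\<^esub>)"
    by (rule coaction_coassoc_lift[symmetric]) (use a in simp_all)
  also have "\<dots> = lift A C P (\<lambda>u d2. lift C A P (\<lambda>c x. ?H c (x \<otimes>\<^bsub>A\<^esub> u) d2) (lambda a)) (\<rho> \<one>\<^bsub>A\<^esub>)"
  proof (rule tensor_lift_cong[OF _ refl])
    fix u d2 assume u: "u \<in> carrier A" "d2 \<in> carrier C"
    show "lift A C P (\<lambda>v d1. lift C A P (\<lambda>c x. ?H c x d2) (inv_entwining ((a \<otimes>\<^bsub>A\<^esub> v) \<diamondop>\<^bsub>?AC\<^esub> d1))) (\<rho> u) =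
      lift C A P (\<lambda>c x. ?H c (x \<otimes>\<^bsub>A\<^esub> u) d2) (lambda a)"
      using arg_cong[OF left_coaction_mult[OF a u(1)], of "lift C A P (\<lambda>c x. ?H c x d2)"] a u
      by simp
  qed
  also have "\<dots> = lift C A P (\<lambda>c x. lift A C P (\<lambda>u d2. ?H c (x \<otimes>\<^bsub>A\<^esub> u) d2) (\<rho> \<one>\<^bsub>A\<^esub>)) (lambda a)"
    by (rule lift_commute) (use a in simp_all)
  also have "\<dots> = lift C A P (\<lambda>c1 x. lift C A P (\<lambda>c2 y. F c1 c2 y) (lambda x)) (lambda a)"
    using a by (simp add: left_coaction_lift)
  finally show ?thesis .
qed

text \<open>The sum of \<open>a\<^sub>-\<^sub>1 \<otimes> a\<^sub>0 a'\<^sub>0 \<otimes> a'\<^sub>1\<close> over a tensor \<open>t\<close> depends on \<open>t\<close> only through its image under the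
  lifted canonical map. This is why the choice of the splitting \<open>\<sigma>\<close> is immaterial.\<close>

lemma left_right_coaction_mult:
  assumes P: "module K P" and t: "t \<in> carrier (tensor K A A)" and F: "trilinear_map C A C P F"
  shows "lift A A P (\<lambda>a a'. lift C A P (\<lambda>c x. lift A C P (\<lambda>y d. F c (x \<otimes>\<^bsub>A\<^esub> y) d) (\<rho> a')) (lambda a)) t =
    lift A C P (\<lambda>x d. lift C C P (\<lambda>e f. lift C A P (\<lambda>c y. F c y f) (inv_entwining (x \<diamondop>\<^bsub>tensor K A C\<^esub> e))) (\<Delta> d))
      (lifted_can K A C \<rho> t)"
proof -
  note [simp] = P trilinear_mapD[OF F] trilinear_map_comp[OF F]
  let ?AC = "tensor K A C"
  have "lift C A P (\<lambda>c x. lift A C P (\<lambda>y d. F c (x \<otimes>\<^bsub>A\<^esub> y) d) (\<rho> a')) (lambda a) =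
      lift A C P (\<lambda>y d. lift C C P (\<lambda>e f. lift C A P (\<lambda>c z. F c z f)
        (inv_entwining ((a \<otimes>\<^bsub>A\<^esub> y) \<diamondop>\<^bsub>?AC\<^esub> e))) (\<Delta> d)) (\<rho> a')"
    if a: "a \<in> carrier A" "a' \<in> carrier A" for a a'
  proof -
    have "lift C A P (\<lambda>c x. lift A C P (\<lambda>y d. F c (x \<otimes>\<^bsub>A\<^esub> y) d) (\<rho> a')) (lambda a) =
        lift A C P (\<lambda>y d. lift C A P (\<lambda>c x. F c (x \<otimes>\<^bsub>A\<^esub> y) d) (lambda a)) (\<rho> a')"
      by (rule lift_commute) (use a in simp_all)
    also have "\<dots> = lift A C P (\<lambda>y d. lift A C P (\<lambda>z e. lift C A P (\<lambda>c x. F c x d)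
        (inv_entwining ((a \<otimes>\<^bsub>A\<^esub> z) \<diamondop>\<^bsub>?AC\<^esub> e))) (\<rho> y)) (\<rho> a')"
    proof (rule tensor_lift_cong[OF _ refl])
      fix y d assume y: "y \<in> carrier A" "d \<in> carrier C"
      show "lift C A P (\<lambda>c x. F c (x \<otimes>\<^bsub>A\<^esub> y) d) (lambda a) =
          lift A C P (\<lambda>z e. lift C A P (\<lambda>c x. F c x d) (inv_entwining ((a \<otimes>\<^bsub>A\<^esub> z) \<diamondop>\<^bsub>?AC\<^esub> e))) (\<rho> y)"
        using arg_cong[OF left_coaction_mult[OF a(1) y(1)], of "lift C A P (\<lambda>c x. F c x d)"] a y
        by simp
    qed
    also have "\<dots> = lift A C P (\<lambda>y d. lift C C P (\<lambda>e f. lift C A P (\<lambda>c z. F c z f)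
        (inv_entwining ((a \<otimes>\<^bsub>A\<^esub> y) \<diamondop>\<^bsub>?AC\<^esub> e))) (\<Delta> d)) (\<rho> a')"
      by (rule coaction_coassoc_lift) (use a in simp_all)
    finally show ?thesis .
  qed
  then show ?thesis using t by (simp add: tensor_defs)
qed

end

section \<open>The connection of a cointegral\<close>

context cointegral
begin

lemmas cointegral_rules [simp] = linear_map_rules[OF cointegral_linear[folded linear_map_def]]

lemma cointegral_balanced_lift:
  assumes P: "module K P" and c: "c \<in> carrier C" "c' \<in> carrier C" and h: "linear_map C P h"
  shows "lift C C P (\<lambda>c1 c2. \<delta> (c2 \<diamondop>\<^bsub>tensor K C C\<^esub> c') \<odot>\<^bsub>P\<^esub> h c1) (\<Delta> c) =
    lift C C P (\<lambda>c1 c2. \<delta> (c \<diamondop>\<^bsub>tensor K C C\<^esub> c1) \<odot>\<^bsub>P\<^esub> h c2) (\<Delta> c')"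
proof -
  note [simp] = linear_map_rules[OF h] linear_map_smult[OF h]
  have "\<delta> t \<in> carrier K" if "t \<in> carrier (tensor K C C)" for t
    using cointegral_rules(1)[OF that] by (simp add: carrier_self_module)
  then show ?thesis
    using arg_cong[OF cointegral_balanced[OF c], of h] P c by (simp add: tensor_defs)
qed

end

locale cointegral_connection =
  entwined_extension K A C \<Delta> \<epsilon> \<rho> \<psi> B + cointegral K C \<Delta> \<epsilon> \<delta>
  for K :: "'k ring" and A :: "('k, 'a) module" and C :: "('k, 'c) module"
    and \<Delta> \<epsilon> \<rho> \<psi> B \<delta> +
  fixes \<sigma> :: "'c \<Rightarrow> ('a, 'a) tensor"
  assumes splitting_linear: "\<sigma> \<in> linear_maps K C (tensor K A A)"
    and splitting_can: "c \<in> carrier C \<Longrightarrow> lifted_can K A C \<rho> (\<sigma> c) = \<one>\<^bsub>A\<^esub> \<diamondop>\<^bsub>tensor K A C\<^esub> c"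
begin

lemmas splitting_rules [simp] = linear_map_rules[OF splitting_linear[folded linear_map_def]]

lemma cointegral_scalar [simp]: "t \<in> carrier (tensor K C C) \<Longrightarrow> \<delta> t \<in> carrier K"
  using cointegral_rules(1)[of t] by (simp add: carrier_self_module)

text \<open>The maps \<open>\<gamma>\<close>, \<open>\<alpha>\<close> and \<open>ell\<close> as Sweedler sums, with \<open>\<gamma>\<close> and \<open>\<alpha>\<close> regarded as bilinear functions of
  two elements instead of linear functions on a tensor product.\<close>

definition gamma :: "'c \<Rightarrow> 'a \<Rightarrow> 'a" where
  "gamma c a = lift C A A (\<lambda>d x. \<delta> (c \<diamondop>\<^bsub>tensor K C C\<^esub> d) \<odot>\<^bsub>A\<^esub> x) (lambda a)"

definition alpha :: "'a \<Rightarrow> 'c \<Rightarrow> 'a" where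
  "alpha a c = lift A C A (\<lambda>x d. \<delta> (d \<diamondop>\<^bsub>tensor K C C\<^esub> c) \<odot>\<^bsub>A\<^esub> x) (\<rho> a)"

lemma gamma_linear: "a \<in> carrier A \<Longrightarrow> linear_map C A (\<lambda>c. gamma c a)" "c \<in> carrier C \<Longrightarrow> linear_map A A (gamma c)"
  and alpha_linear: "c \<in> carrier C \<Longrightarrow> linear_map A A (\<lambda>a. alpha a c)" "a \<in> carrier A \<Longrightarrow> linear_map C A (alpha a)"
  unfolding gamma_def alpha_def by simp_all

lemma gamma_alpha_rules [simp]:
  "\<lbrakk>c \<in> carrier C; a \<in> carrier A\<rbrakk> \<Longrightarrow> gamma c a \<in> carrier A"
  "\<lbrakk>c \<in> carrier C; a \<in> carrier A\<rbrakk> \<Longrightarrow> alpha a c \<in> carrier A"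
  "\<lbrakk>linear_map L C F; a \<in> carrier A\<rbrakk> \<Longrightarrow> linear_map L A (\<lambda>x. gamma (F x) a)"
  "\<lbrakk>linear_map L A G; c \<in> carrier C\<rbrakk> \<Longrightarrow> linear_map L A (\<lambda>x. gamma c (G x))"
  "\<lbrakk>linear_map L A G; c \<in> carrier C\<rbrakk> \<Longrightarrow> linear_map L A (\<lambda>x. alpha (G x) c)"
  "\<lbrakk>linear_map L C F; a \<in> carrier A\<rbrakk> \<Longrightarrow> linear_map L A (\<lambda>x. alpha a (F x))"
  using linear_map_closed[OF gamma_linear(2)] linear_map_closed[OF alpha_linear(1)]
    linear_map_comp[OF _ gamma_linear(1)] linear_map_comp[OF _ gamma_linear(2)]
    linear_map_comp[OF _ alpha_linear(1)] linear_map_comp[OF _ alpha_linear(2)] by auto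

definition connection :: "'c \<Rightarrow> ('a, 'a) tensor" where
  "connection c = lift C C (tensor K A A) (\<lambda>d c3. lift C C (tensor K A A)
     (\<lambda>c1 c2. lift A A (tensor K A A) (\<lambda>x y. gamma c1 x \<diamondop>\<^bsub>tensor K A A\<^esub> alpha y c3) (\<sigma> c2)) (\<Delta> d)) (\<Delta> c)"

text \<open>Coassociativity gives \<open>a\<^sub>0 \<otimes> a\<^sub>1 \<delta> (a\<^sub>2 \<otimes> c)\<close>, and the cointegral moves this to
  \<open>a\<^sub>0 \<otimes> \<delta> (a\<^sub>1 \<otimes> c\<^sub>1) c\<^sub>2\<close>.\<close>

lemma alpha_coaction:
  assumes a: "a \<in> carrier A" and c: "c \<in> carrier C"
  shows "\<rho> (alpha a c) =
    lift C C (tensor K A C) (\<lambda>c1 c2. alpha a c1 \<diamondop>\<^bsub>tensor K A C\<^esub> c2) (\<Delta> c)"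
proof -
  let ?AC = "tensor K A C"
  let ?d = "\<lambda>x y. \<delta> (x \<diamondop>\<^bsub>tensor K C C\<^esub> y)"
  note [simp] = linear_map_smult[OF coaction_linear[folded linear_map_def]]
  have "\<rho> (alpha a c) = lift A C ?AC (\<lambda>x d. ?d d c \<odot>\<^bsub>?AC\<^esub> lift A C ?AC (\<lambda>y e. y \<diamondop>\<^bsub>?AC\<^esub> e) (\<rho> x)) (\<rho> a)"
    using a c by (simp add: alpha_def)
  also have "\<dots> = lift A C ?AC (\<lambda>x d. lift A C ?AC (\<lambda>y e. ?d d c \<odot>\<^bsub>?AC\<^esub> (y \<diamondop>\<^bsub>?AC\<^esub> e)) (\<rho> x)) (\<rho> a)"
    using a c by (simp del: lift_pure_eq)
  also have "\<dots> = lift A C ?AC (\<lambda>x d. lift C C ?AC (\<lambda>e f. ?d f c \<odot>\<^bsub>?AC\<^esub> (x \<diamondop>\<^bsub>?AC\<^esub> e)) (\<Delta> d)) (\<rho> a)"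
    by (rule coaction_coassoc_lift) (use a c in simp_all)
  also have "\<dots> = lift A C ?AC (\<lambda>x d. lift C C ?AC (\<lambda>c1 c2. ?d d c1 \<odot>\<^bsub>?AC\<^esub> (x \<diamondop>\<^bsub>?AC\<^esub> c2)) (\<Delta> c)) (\<rho> a)"
    by (intro tensor_lift_cong refl cointegral_balanced_lift) (use a c in simp_all)
  also have "\<dots> = lift C C ?AC (\<lambda>c1 c2. lift A C ?AC (\<lambda>x d. ?d d c1 \<odot>\<^bsub>?AC\<^esub> (x \<diamondop>\<^bsub>?AC\<^esub> c2)) (\<rho> a)) (\<Delta> c)"
    by (rule lift_commute) (use a c in simp_all)
  also have "\<dots> = lift C C ?AC (\<lambda>c1 c2. alpha a c1 \<diamondop>\<^bsub>?AC\<^esub> c2) (\<Delta> c)"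
    using a c by (simp add: alpha_def smult_pure_left)
  finally show ?thesis .
qed

text \<open>The mirror image, with coassociativity of the left coaction in place of that of the right one.\<close>

lemma gamma_left_coaction:
  assumes a: "a \<in> carrier A" and c: "c \<in> carrier C"
  shows "lambda (gamma c a) =
    lift C C (tensor K C A) (\<lambda>c1 c2. c1 \<diamondop>\<^bsub>tensor K C A\<^esub> gamma c2 a) (\<Delta> c)"
proof -
  let ?CA = "tensor K C A"
  let ?d = "\<lambda>x y. \<delta> (x \<diamondop>\<^bsub>tensor K C C\<^esub> y)"
  note [simp] = linear_map_smult[OF left_coaction_linear]
  have "lambda (gamma c a) = lift C A ?CA (\<lambda>d x. ?d c d \<odot>\<^bsub>?CA\<^esub> lift C A ?CA (\<lambda>e y. e \<diamondop>\<^bsub>?CA\<^esub> y) (lambda x)) (lambda a)"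
    using a c by (simp add: gamma_def)
  also have "\<dots> = lift C A ?CA (\<lambda>d x. lift C A ?CA (\<lambda>e y. ?d c d \<odot>\<^bsub>?CA\<^esub> (e \<diamondop>\<^bsub>?CA\<^esub> y)) (lambda x)) (lambda a)"
    using a c by (simp del: lift_pure_eq)
  also have "\<dots> = lift C A ?CA (\<lambda>d x. lift C C ?CA (\<lambda>e f. ?d c e \<odot>\<^bsub>?CA\<^esub> (f \<diamondop>\<^bsub>?CA\<^esub> x)) (\<Delta> d)) (lambda a)"
    by (rule left_coaction_coassoc[symmetric]) (use a c in simp_all)
  also have "\<dots> = lift C A ?CA (\<lambda>d x. lift C C ?CA (\<lambda>c1 c2. ?d c2 d \<odot>\<^bsub>?CA\<^esub> (c1 \<diamondop>\<^bsub>?CA\<^esub> x)) (\<Delta> c)) (lambda a)"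
    by (intro tensor_lift_cong refl cointegral_balanced_lift[symmetric]) (use a c in simp_all)
  also have "\<dots> = lift C C ?CA (\<lambda>c1 c2. lift C A ?CA (\<lambda>d x. ?d c2 d \<odot>\<^bsub>?CA\<^esub> (c1 \<diamondop>\<^bsub>?CA\<^esub> x)) (lambda a)) (\<Delta> c)"
    by (rule lift_commute) (use a c in simp_all)
  also have "\<dots> = lift C C ?CA (\<lambda>c1 c2. c1 \<diamondop>\<^bsub>?CA\<^esub> gamma c2 a) (\<Delta> c)"
    using a c by (simp add: gamma_def smult_pure_right)
  finally show ?thesis .
qed

lemma connection_linear: "linear_map C (tensor K A A) connection"
  unfolding connection_def by simp

lemmas connection_rules [simp] = linear_map_rules[OF connection_linear]

text \<open>By \<open>alpha_coaction\<close> the coaction on the second leg splits the outermost factor of the triple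
  coproduct; it remains to interchange sums and to apply coassociativity once.\<close>

lemma connection_right_colinear:
  assumes c: "c \<in> carrier C"
  shows "assoc_right K A A C (tensor_map K C C (tensor K A A) C connection id (\<Delta> c)) =
    tensor_map K A A A (tensor K A C) id \<rho> (connection c)"
proof -
  let ?P = "tensor K A (tensor K A C)"
  let ?R = "\<lambda>c1 x y e f. gamma c1 x \<diamondop>\<^bsub>?P\<^esub> (alpha y e \<diamondop>\<^bsub>tensor K A C\<^esub> f)"
  let ?Q = "\<lambda>d e f. lift C C ?P (\<lambda>c1 c2. lift A A ?P (\<lambda>x y. ?R c1 x y e f) (\<sigma> c2)) (\<Delta> d)"
  have inner: "lift C C ?P (\<lambda>c1 c2. lift A A ?P (\<lambda>x y. lift C C ?P (\<lambda>e f. ?R c1 x y e f) (\<Delta> c3)) (\<sigma> c2)) (\<Delta> d) =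
      lift C C ?P (\<lambda>e f. ?Q d e f) (\<Delta> c3)" if "d \<in> carrier C" "c3 \<in> carrier C" for d c3
  proof -
    have "lift C C ?P (\<lambda>c1 c2. lift A A ?P (\<lambda>x y. lift C C ?P (\<lambda>e f. ?R c1 x y e f) (\<Delta> c3)) (\<sigma> c2)) (\<Delta> d) =
      lift C C ?P (\<lambda>c1 c2. lift C C ?P (\<lambda>e f. lift A A ?P (\<lambda>x y. ?R c1 x y e f) (\<sigma> c2)) (\<Delta> c3)) (\<Delta> d)"
      by (intro tensor_lift_cong refl lift_commute) (use that in simp_all)
    also have "\<dots> = lift C C ?P (\<lambda>e f. ?Q d e f) (\<Delta> c3)"
      by (rule lift_commute) (use that in simp_all)
    finally show ?thesis .
  qed
  have "tensor_map K A A A (tensor K A C) id \<rho> (connection c) =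
      lift C C ?P (\<lambda>d c3. lift C C ?P (\<lambda>e f. ?Q d e f) (\<Delta> c3)) (\<Delta> c)"
    using c by (simp add: tensor_defs connection_def alpha_coaction inner)
  also have "\<dots> = lift C C ?P (\<lambda>b f. lift C C ?P (\<lambda>d e. ?Q d e f) (\<Delta> b)) (\<Delta> c)"
    by (rule comult_coassoc[symmetric]) (use c in simp_all)
  also have "\<dots> = assoc_right K A A C (tensor_map K C C (tensor K A A) C connection id (\<Delta> c))"
    using c by (simp add: tensor_defs connection_def)
  finally show ?thesis ..
qed

text \<open>Here \<open>gamma_left_coaction\<close> splits the innermost factor, so coassociativity is needed at both levels
  of the triple coproduct.\<close>

lemma connection_left_colinear:
  assumes c: "c \<in> carrier C"
  shows "tensor_map K C C C (tensor K A A) id connection (\<Delta> c) =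
    assoc_right K C A A (tensor_map K A A (tensor K C A) A lambda id (connection c))"
proof -
  let ?P = "tensor K C (tensor K A A)"
  let ?R = "\<lambda>e f c2 c3. lift A A ?P (\<lambda>x y. e \<diamondop>\<^bsub>?P\<^esub> (gamma f x \<diamondop>\<^bsub>tensor K A A\<^esub> alpha y c3)) (\<sigma> c2)"
  let ?S = "\<lambda>e g c3. lift C C ?P (\<lambda>f c2. ?R e f c2 c3) (\<Delta> g)"
  have inner: "lift C C ?P (\<lambda>c1 c2. lift A A ?P (\<lambda>x y. lift C C ?P
        (\<lambda>e f. e \<diamondop>\<^bsub>?P\<^esub> (gamma f x \<diamondop>\<^bsub>tensor K A A\<^esub> alpha y c3)) (\<Delta> c1)) (\<sigma> c2)) (\<Delta> d) =
      lift C C ?P (\<lambda>e g. ?S e g c3) (\<Delta> d)" if "d \<in> carrier C" "c3 \<in> carrier C" for d c3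
  proof -
    have "lift C C ?P (\<lambda>c1 c2. lift A A ?P (\<lambda>x y. lift C C ?P
        (\<lambda>e f. e \<diamondop>\<^bsub>?P\<^esub> (gamma f x \<diamondop>\<^bsub>tensor K A A\<^esub> alpha y c3)) (\<Delta> c1)) (\<sigma> c2)) (\<Delta> d) =
      lift C C ?P (\<lambda>c1 c2. lift C C ?P (\<lambda>e f. ?R e f c2 c3) (\<Delta> c1)) (\<Delta> d)"
      by (intro tensor_lift_cong refl lift_commute) (use that in simp_all)
    also have "\<dots> = lift C C ?P (\<lambda>e g. ?S e g c3) (\<Delta> d)"
      by (rule comult_coassoc) (use that in simp_all)
    finally show ?thesis .
  qed
  have "assoc_right K C A A (tensor_map K A A (tensor K C A) A lambda id (connection c)) =
      lift C C ?P (\<lambda>d c3. lift C C ?P (\<lambda>e g. ?S e g c3) (\<Delta> d)) (\<Delta> c)"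
    using c by (simp add: tensor_defs connection_def gamma_left_coaction inner)
  also have "\<dots> = lift C C ?P (\<lambda>e h. lift C C ?P (\<lambda>g c3. ?S e g c3) (\<Delta> h)) (\<Delta> c)"
    by (rule comult_coassoc) (use c in simp_all)
  also have "\<dots> = tensor_map K C C C (tensor K A A) id connection (\<Delta> c)"
    using c by (simp add: tensor_defs connection_def)
  finally show ?thesis ..
qed

text \<open>By \<open>left_right_coaction_mult\<close> the sum over \<open>\<sigma> c\<^sub>2\<close> contributes \<open>\<delta> (c\<^sub>1 \<otimes> c\<^sub>2) \<delta> (c\<^sub>3 \<otimes> c\<^sub>4) 1\<close>, and the
  normalisation of the cointegral removes both values of \<open>\<delta>\<close>.\<close>

lemma product_connection:
  assumes c: "c \<in> carrier C"
  shows "product_map K A (connection c) = \<epsilon> c \<odot>\<^bsub>A\<^esub> \<one>\<^bsub>A\<^esub>"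
proof -
  let ?d = "\<lambda>x y. \<delta> (x \<diamondop>\<^bsub>tensor K C C\<^esub> y)"
  have factor: "lift A A A (\<lambda>x y. gamma c1 x \<otimes>\<^bsub>A\<^esub> alpha y c3) (\<sigma> c2) =
      lift C C A (\<lambda>e f. ?d c1 e \<odot>\<^bsub>A\<^esub> (?d f c3 \<odot>\<^bsub>A\<^esub> \<one>\<^bsub>A\<^esub>)) (\<Delta> c2)"
    if c': "c1 \<in> carrier C" "c2 \<in> carrier C" "c3 \<in> carrier C" for c1 c2 c3
  proof -
    have inv: "inv_entwining (\<one>\<^bsub>A\<^esub> \<diamondop>\<^bsub>tensor K A C\<^esub> e) = e \<diamondop>\<^bsub>tensor K C A\<^esub> \<one>\<^bsub>A\<^esub>" if "e \<in> carrier C" for e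
      using inv_entwining_left[of "e \<diamondop>\<^bsub>tensor K C A\<^esub> \<one>\<^bsub>A\<^esub>"] entwining_one[OF that] that by simp
    let ?F = "\<lambda>d x e. ?d c1 d \<odot>\<^bsub>A\<^esub> (?d e c3 \<odot>\<^bsub>A\<^esub> x)"
    have "lift A A A (\<lambda>x y. gamma c1 x \<otimes>\<^bsub>A\<^esub> alpha y c3) (\<sigma> c2) =
        lift A A A (\<lambda>x y. lift C A A (\<lambda>d u. lift A C A (\<lambda>v e. ?F d (u \<otimes>\<^bsub>A\<^esub> v) e) (\<rho> y)) (lambda x)) (\<sigma> c2)"
      using c' by (simp add: gamma_def smult_mult_left) (simp add: alpha_def smult_mult_right)
    also have "\<dots> = lift A C A (\<lambda>x d. lift C C A (\<lambda>e f. lift C A A (\<lambda>d y. ?F d y f)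
        (inv_entwining (x \<diamondop>\<^bsub>tensor K A C\<^esub> e))) (\<Delta> d)) (lifted_can K A C \<rho> (\<sigma> c2))"
      by (rule left_right_coaction_mult) (use c' in simp_all)
    also have "\<dots> = lift C C A (\<lambda>e f. ?F e \<one>\<^bsub>A\<^esub> f) (\<Delta> c2)"
      using c' by (simp add: splitting_can inv)
    finally show ?thesis .
  qed
  have inner: "lift C C A (\<lambda>c1 c2. lift C C A (\<lambda>e f. ?d c1 e \<odot>\<^bsub>A\<^esub> (?d f c3 \<odot>\<^bsub>A\<^esub> \<one>\<^bsub>A\<^esub>)) (\<Delta> c2)) (\<Delta> d) =
      ?d d c3 \<odot>\<^bsub>A\<^esub> \<one>\<^bsub>A\<^esub>" if "d \<in> carrier C" "c3 \<in> carrier C" for d c3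
  proof -
    have "lift C C A (\<lambda>c1 c2. lift C C A (\<lambda>e f. ?d c1 e \<odot>\<^bsub>A\<^esub> (?d f c3 \<odot>\<^bsub>A\<^esub> \<one>\<^bsub>A\<^esub>)) (\<Delta> c2)) (\<Delta> d) =
        lift C C A (\<lambda>g f. lift C C A (\<lambda>c1 e. ?d c1 e \<odot>\<^bsub>A\<^esub> (?d f c3 \<odot>\<^bsub>A\<^esub> \<one>\<^bsub>A\<^esub>)) (\<Delta> g)) (\<Delta> d)"
      by (rule comult_coassoc[symmetric]) (use that in simp_all)
    also have "\<dots> = lift C C A (\<lambda>g f. \<epsilon> g \<odot>\<^bsub>A\<^esub> (?d f c3 \<odot>\<^bsub>A\<^esub> \<one>\<^bsub>A\<^esub>)) (\<Delta> d)"
    proof (rule tensor_lift_cong[OF _ refl])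
      fix g f assume "g \<in> carrier C" "f \<in> carrier C"
      then show "lift C C A (\<lambda>c1 e. ?d c1 e \<odot>\<^bsub>A\<^esub> (?d f c3 \<odot>\<^bsub>A\<^esub> \<one>\<^bsub>A\<^esub>)) (\<Delta> g) =
          \<epsilon> g \<odot>\<^bsub>A\<^esub> (?d f c3 \<odot>\<^bsub>A\<^esub> \<one>\<^bsub>A\<^esub>)"
        using that lift_linear_map_pure[of C C A "\<lambda>t. \<delta> t \<odot>\<^bsub>A\<^esub> (?d f c3 \<odot>\<^bsub>A\<^esub> \<one>\<^bsub>A\<^esub>)" "\<Delta> g"]
        by (simp add: cointegral_comult)
    qed
    also have "\<dots> = ?d d c3 \<odot>\<^bsub>A\<^esub> \<one>\<^bsub>A\<^esub>"
      by (rule comult_counit(1)) (use that in simp_all)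
    finally show ?thesis .
  qed
  have "product_map K A (connection c) = lift C C A (\<lambda>d c3. ?d d c3 \<odot>\<^bsub>A\<^esub> \<one>\<^bsub>A\<^esub>) (\<Delta> c)"
    using c by (simp add: tensor_defs connection_def factor inner)
  also have "\<dots> = \<delta> (\<Delta> c) \<odot>\<^bsub>A\<^esub> \<one>\<^bsub>A\<^esub>"
    by (rule lift_linear_map_pure[where h="\<lambda>t. \<delta> t \<odot>\<^bsub>A\<^esub> \<one>\<^bsub>A\<^esub>"]) (use c in simp_all)
  finally show ?thesis using c by (simp add: cointegral_comult)
qed

text \<open>The lifted canonical map is the right coaction on the second leg followed by multiplication of the
  first two legs. Right colinearity moves the coaction to \<open>c\<close>, leaving the product of the legs.\<close>

lemma can_connection:
  assumes c: "c \<in> carrier C"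
  shows "lifted_can K A C \<rho> (connection c) = \<one>\<^bsub>A\<^esub> \<diamondop>\<^bsub>tensor K A C\<^esub> c"
proof -
  let ?AC = "tensor K A C"
  let ?m = "lift A ?AC ?AC (\<lambda>x t. lift A C ?AC (\<lambda>y d. (x \<otimes>\<^bsub>A\<^esub> y) \<diamondop>\<^bsub>?AC\<^esub> d) t)"
  have "lifted_can K A C \<rho> (connection c) = ?m (tensor_map K A A A ?AC id \<rho> (connection c))"
    using c by (simp add: tensor_defs)
  also have "\<dots> = lift C C ?AC (\<lambda>d e. lift A A ?AC (\<lambda>x y. (x \<otimes>\<^bsub>A\<^esub> y) \<diamondop>\<^bsub>?AC\<^esub> e) (connection d)) (\<Delta> c)"
    unfolding connection_right_colinear[OF c, symmetric] using c by (simp add: tensor_defs)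
  also have "\<dots> = lift C C ?AC (\<lambda>d e. product_map K A (connection d) \<diamondop>\<^bsub>?AC\<^esub> e) (\<Delta> c)"
    using c by (simp add: tensor_defs)
  also have "\<dots> = lift C C ?AC (\<lambda>d e. \<epsilon> d \<odot>\<^bsub>?AC\<^esub> (\<one>\<^bsub>A\<^esub> \<diamondop>\<^bsub>?AC\<^esub> e)) (\<Delta> c)"
    using c by (simp add: product_connection smult_pure_left)
  also have "\<dots> = \<one>\<^bsub>A\<^esub> \<diamondop>\<^bsub>?AC\<^esub> c"
    by (rule comult_counit(1)) (use c in simp_all)
  finally show ?thesis .
qed

theorem strong_connection_form_connection:
  assumes "\<And>c. c \<in> carrier C \<Longrightarrow> ell c = connection c"
  shows "strong_connection_form K A C \<Delta> \<epsilon> \<rho> \<psi> B ell"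
proof (intro strong_connection_form.intro entwined_extension_axioms strong_connection_form_axioms.intro)
  show "ell \<in> linear_maps K C (tensor K A A)"
    using linear_map_cong[OF assms[symmetric] connection_linear] by (simp add: linear_map_def)
qed (use assms can_connection connection_right_colinear connection_left_colinear
    in \<open>simp_all add: tensor_defs(1)\<close>)

end

section \<open>The base algebra\<close>

context entwined_extension
begin

text \<open>Coinvariance has to be tested only against \<open>1\<close>: if \<open>\<rho> b = b \<rho> 1\<close>, then \<open>\<rho> (b a) = b\<^sub>0 \<psi> (b\<^sub>1 \<otimes> a)\<close> equals
  \<open>b 1\<^sub>0 \<psi> (1\<^sub>1 \<otimes> a) = b \<rho> (1 a)\<close>. The coinvariants are thereby the kernel of a single linear map.\<close>

lemma base_iff:
  "b \<in> B \<longleftrightarrow> b \<in> carrier A \<and>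
     \<rho> b = lift A C (tensor K A C) (\<lambda>x c. (b \<otimes>\<^bsub>A\<^esub> x) \<diamondop>\<^bsub>tensor K A C\<^esub> c) (\<rho> \<one>\<^bsub>A\<^esub>)"
  (is "_ \<longleftrightarrow> _ \<and> ?P b")
proof
  assume "b \<in> B"
  then have "b \<in> carrier A" "\<rho> (b \<otimes>\<^bsub>A\<^esub> \<one>\<^bsub>A\<^esub>) = left_mult K A C b (\<rho> \<one>\<^bsub>A\<^esub>)"
    by (auto simp: base coinvariants_def simp del: A.r_one)
  then show "b \<in> carrier A \<and> ?P b" by (simp add: tensor_defs)
next
  assume b: "b \<in> carrier A \<and> ?P b"
  have "\<rho> (b \<otimes>\<^bsub>A\<^esub> a) = left_mult K A C b (\<rho> (\<one>\<^bsub>A\<^esub> \<otimes>\<^bsub>A\<^esub> a))" if "a \<in> carrier A" for a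
    using b that by (simp add: coaction_mult_lift[of b] coaction_mult_lift[of "\<one>\<^bsub>A\<^esub>"] tensor_defs A.m_assoc del: A.l_one)
  then show "b \<in> B" using b by (simp add: base coinvariants_def)
qed

lemma coaction_base_mult:
  "\<lbrakk>b \<in> B; a \<in> carrier A\<rbrakk> \<Longrightarrow>
    \<rho> (b \<otimes>\<^bsub>A\<^esub> a) = lift A C (tensor K A C) (\<lambda>x c. (b \<otimes>\<^bsub>A\<^esub> x) \<diamondop>\<^bsub>tensor K A C\<^esub> c) (\<rho> a)"
  by (simp add: base coinvariants_def tensor_defs)

text \<open>A constant of its own, so that membership in its carrier is not unfolded to membership in \<open>B\<close>, which
  the linearity rules could not relate to a module.\<close>

definition base_module :: "('k, 'a) module" where
  "base_module = A\<lparr>carrier := B\<rparr>"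

lemma base_module_simps [simp]:
  "monoid.mult base_module = monoid.mult A" "smult base_module = smult A" "add base_module = add A"
  by (simp_all add: base_module_def)

lemma carrier_base_module: "carrier base_module = B"
  by (simp add: base_module_def)

lemma base_closed:
  shows "B \<subseteq> carrier A" "\<one>\<^bsub>A\<^esub> \<in> B" "submodule B K A"
    and "\<lbrakk>b \<in> B; b' \<in> B\<rbrakk> \<Longrightarrow> b \<otimes>\<^bsub>A\<^esub> b' \<in> B"
proof -
  let ?r = "\<lambda>b. lift A C (tensor K A C) (\<lambda>x c. (b \<otimes>\<^bsub>A\<^esub> x) \<diamondop>\<^bsub>tensor K A C\<^esub> c) (\<rho> \<one>\<^bsub>A\<^esub>)"
  have l: "linear_map A (tensor K A C) ?r" "linear_map A (tensor K A C) \<rho>" by simp_all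
  show sub: "B \<subseteq> carrier A" using base_iff by blast
  show "\<one>\<^bsub>A\<^esub> \<in> B" by (simp add: base_iff)
  show "submodule B K A"
  proof (rule A.submoduleI[OF sub])
    have "\<rho> \<zero>\<^bsub>A\<^esub> = \<zero>\<^bsub>tensor K A C\<^esub>" "?r \<zero>\<^bsub>A\<^esub> = \<zero>\<^bsub>tensor K A C\<^esub>"
      using linear_map_zero[OF l(1)] linear_map_zero[OF l(2)] by (simp_all only: A_module C_module module_tensor)
    then show "\<zero>\<^bsub>A\<^esub> \<in> B" by (simp only: base_iff A.zero_closed)
    show smult: "s \<odot>\<^bsub>A\<^esub> a \<in> B" if "s \<in> carrier K" "a \<in> B" for s a
    proof -
      have a: "a \<in> carrier A" "\<rho> a = ?r a" using that(2) base_iff by auto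
      show ?thesis
        by (simp only: base_iff linear_map_smult[OF l(1) that(1) a(1)] linear_map_smult[OF l(2) that(1) a(1)]
            A.smult_closed[OF that(1) a(1)] a(2))
    qed
    show "\<ominus>\<^bsub>A\<^esub> a \<in> B" if "a \<in> B" for a
    proof -
      have "\<ominus>\<^bsub>A\<^esub> a = (\<ominus>\<^bsub>K\<^esub> \<one>\<^bsub>K\<^esub>) \<odot>\<^bsub>A\<^esub> a" using that base_iff by (simp add: A.smult_l_minus)
      then show ?thesis using smult that by simp
    qed
    show "a \<oplus>\<^bsub>A\<^esub> b \<in> B" if "a \<in> B" "b \<in> B" for a b
    proof -
      have ab: "a \<in> carrier A" "b \<in> carrier A" "\<rho> a = ?r a" "\<rho> b = ?r b" using that base_iff by auto
      show ?thesis
        by (simp only: base_iff linear_map_add[OF l(1) ab(1,2)] linear_map_add[OF l(2) ab(1,2)]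
            A.add.m_closed[OF ab(1,2)] ab(3,4))
    qed
  qed
  show "b \<otimes>\<^bsub>A\<^esub> b' \<in> B" if b: "b \<in> B" "b' \<in> B" for b b'
  proof -
    have "b' \<in> carrier A" "b \<in> carrier A" using b sub by auto
    then show ?thesis
      using coaction_base_mult[OF b(1), of b'] b(2)[unfolded base_iff]
      by (simp add: base_iff[of "b \<otimes>\<^bsub>A\<^esub> b'"] A.m_assoc)
  qed
qed

lemma base_module_rules [simp]:
  "module K base_module"
  "b \<in> carrier base_module \<Longrightarrow> b \<in> carrier A"
  "linear_map base_module A (\<lambda>x. x)"
  "\<lbrakk>b \<in> carrier base_module; b' \<in> carrier base_module\<rbrakk> \<Longrightarrow> b \<otimes>\<^bsub>A\<^esub> b' \<in> carrier base_module"
  "\<lbrakk>linear_map L base_module F; b \<in> carrier base_module\<rbrakk> \<Longrightarrow> linear_map L base_module (\<lambda>x. b \<otimes>\<^bsub>A\<^esub> F x)"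
proof -
  show "module K base_module"
    unfolding base_module_def by (rule submodule.submodule_is_module[OF base_closed(3) A_module])
  show sub: "b \<in> carrier A" if "b \<in> carrier base_module" for b
    using that base_closed(1) by (auto simp: carrier_base_module)
  show "linear_map base_module A (\<lambda>x. x)" by (rule linear_mapI) (simp_all add: sub)
  show mult: "b \<otimes>\<^bsub>A\<^esub> b' \<in> carrier base_module" if "b \<in> carrier base_module" "b' \<in> carrier base_module" for b b'
    using that base_closed(4) by (simp add: carrier_base_module)
  show "linear_map L base_module (\<lambda>x. b \<otimes>\<^bsub>A\<^esub> F x)" if F: "linear_map L base_module F" and b: "b \<in> carrier base_module"
    using linear_mapD[OF F] sub[OF b] sub mult[OF b]
    by (intro linear_mapI) (simp_all add: A.r_distr smult_mult_right)
qed

text \<open>With \<open>f u = \<rho> u - u \<rho> 1\<close> and \<open>f g f = f\<close> the projection is \<open>p = id - g f\<close>. It fixes the first legs of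
  every tensor killed by \<open>f \<otimes> id\<close>, because it differs from the identity by a map that factors
  through \<open>f\<close>. This replaces the exactness of the tensor product over a field.\<close>

lemma base_projection:
  obtains p where "linear_map A base_module p" "\<And>b. b \<in> carrier base_module \<Longrightarrow> p b = b"
    "\<And>t. \<lbrakk>t \<in> carrier (tensor K A A);
       lift A A (tensor K (tensor K A C) A) (\<lambda>u v. \<rho> u \<diamondop>\<^bsub>tensor K (tensor K A C) A\<^esub> v) t =
       lift A A (tensor K (tensor K A C) A) (\<lambda>u v. lift A C (tensor K A C)
         (\<lambda>x c. (u \<otimes>\<^bsub>A\<^esub> x) \<diamondop>\<^bsub>tensor K A C\<^esub> c) (\<rho> \<one>\<^bsub>A\<^esub>) \<diamondop>\<^bsub>tensor K (tensor K A C) A\<^esub> v) t\<rbrakk>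
      \<Longrightarrow> lift A A (tensor K A A) (\<lambda>u v. p u \<diamondop>\<^bsub>tensor K A A\<^esub> v) t = t"
proof -
  let ?AC = "tensor K A C" and ?AA = "tensor K A A" and ?P = "tensor K (tensor K A C) A"
  interpret AC: module K ?AC by simp
  interpret P: module K ?P by simp
  interpret AA: module K ?AA by simp
  define r where "r u = lift A C ?AC (\<lambda>x c. (u \<otimes>\<^bsub>A\<^esub> x) \<diamondop>\<^bsub>?AC\<^esub> c) (\<rho> \<one>\<^bsub>A\<^esub>)" for u
  define f where "f u = \<rho> u \<ominus>\<^bsub>?AC\<^esub> r u" for u
  have r: "linear_map A ?AC r" unfolding r_def by simp
  note [simp] = linear_map_rules[OF r]
  have f: "linear_map A ?AC f" unfolding f_def by (intro linear_map_diff) simp_all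
  note [simp] = linear_map_rules(1,2)[OF f]
  \<comment> \<open>The map \<open>g f\<close> is a projection with the same kernel \<open>B\<close> as \<open>f\<close>.\<close>
  obtain g where g: "linear_map ?AC A g" and fgf: "\<And>x. x \<in> carrier A \<Longrightarrow> f (g (f x)) = f x"
    using generalized_inverse[OF K.field_axioms _ _ f] by auto
  note [simp] = linear_map_rules(1,2)[OF g]
  have f_base: "u \<in> B" if "u \<in> carrier A" "f u = \<zero>\<^bsub>?AC\<^esub>" for u
    using that AC.eq_of_minus_zero[of "\<rho> u" "r u"] by (simp add: base_iff f_def r_def[symmetric])
  have base_f: "f u = \<zero>\<^bsub>?AC\<^esub>" if "u \<in> B" for u
    using that unfolding base_iff r_def[symmetric] by (simp add: f_def AC.minus_eq AC.r_neg)
  define p where "p u = u \<ominus>\<^bsub>A\<^esub> g (f u)" for u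
  have p: "linear_map A A p" unfolding p_def by (intro linear_map_diff) simp_all
  note P = linear_mapD[OF p] and [simp] = linear_map_rules(1,2)[OF p]
  have pB: "p u \<in> B" if "u \<in> carrier A" for u
    using that P(1)[OF that] linear_map_minus[OF _ _ f, of u "g (f u)"]
    by (intro f_base) (simp_all add: p_def fgf AC.minus_eq AC.r_neg)
  show thesis
  proof (rule that)
    show "linear_map A base_module p"
      using P(2,3) pB by (intro linear_mapI) (simp_all only: carrier_base_module base_module_simps)
    show "p b = b" if b: "b \<in> carrier base_module" for b
    proof -
      have "f b = \<zero>\<^bsub>?AC\<^esub>" using b base_f by (simp only: carrier_base_module)
      moreover have "g \<zero>\<^bsub>?AC\<^esub> = \<zero>\<^bsub>A\<^esub>" using linear_map_zero[OF g] by simp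
      ultimately have "p b = b \<ominus>\<^bsub>A\<^esub> \<zero>\<^bsub>A\<^esub>" by (simp only: p_def)
      then show ?thesis using b by (simp add: A.minus_eq)
    qed
  next
    fix t assume t: "t \<in> carrier ?AA"
      and eq: "lift A A ?P (\<lambda>u v. \<rho> u \<diamondop>\<^bsub>?P\<^esub> v) t = lift A A ?P (\<lambda>u v. lift A C ?AC
         (\<lambda>x c. (u \<otimes>\<^bsub>A\<^esub> x) \<diamondop>\<^bsub>?AC\<^esub> c) (\<rho> \<one>\<^bsub>A\<^esub>) \<diamondop>\<^bsub>?P\<^esub> v) t"
    have "lift A A ?P (\<lambda>u v. f u \<diamondop>\<^bsub>?P\<^esub> v) t =
        lift A A ?P (\<lambda>u v. \<rho> u \<diamondop>\<^bsub>?P\<^esub> v) t \<ominus>\<^bsub>?P\<^esub> lift A A ?P (\<lambda>u v. r u \<diamondop>\<^bsub>?P\<^esub> v) t"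
    proof (rule linear_map_eqI[of A A ?P, OF _ _ _ _ linear_map_diff _ t])
      show "lift A A ?P (\<lambda>u v. f u \<diamondop>\<^bsub>?P\<^esub> v) (x \<diamondop>\<^bsub>?AA\<^esub> y) =
        lift A A ?P (\<lambda>u v. \<rho> u \<diamondop>\<^bsub>?P\<^esub> v) (x \<diamondop>\<^bsub>?AA\<^esub> y) \<ominus>\<^bsub>?P\<^esub> lift A A ?P (\<lambda>u v. r u \<diamondop>\<^bsub>?P\<^esub> v) (x \<diamondop>\<^bsub>?AA\<^esub> y)"
        if xy: "x \<in> carrier A" "y \<in> carrier A" for x y
        using xy linear_map_minus[of ?AC ?P "\<lambda>w. w \<diamondop>\<^bsub>?P\<^esub> y" "\<rho> x" "r x"] by (simp add: f_def[of x])
    qed simp_all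
    also have "\<dots> = \<zero>\<^bsub>?P\<^esub>"
      unfolding eq r_def[symmetric] using t by (simp add: P.minus_eq P.r_neg)
    finally have f0: "lift A A ?P (\<lambda>u v. f u \<diamondop>\<^bsub>?P\<^esub> v) t = \<zero>\<^bsub>?P\<^esub>" .
    let ?G = "\<lambda>w. lift ?AC A ?AA (\<lambda>x v. g x \<diamondop>\<^bsub>?AA\<^esub> v) w"
    have G: "linear_map ?P ?AA ?G" by simp
    have g0: "lift A A ?AA (\<lambda>u v. g (f u) \<diamondop>\<^bsub>?AA\<^esub> v) t = \<zero>\<^bsub>?AA\<^esub>"
      using arg_cong[OF f0, of ?G] linear_map_zero[OF G] t by simp
    have "lift A A ?AA (\<lambda>u v. p u \<diamondop>\<^bsub>?AA\<^esub> v) t = t \<ominus>\<^bsub>?AA\<^esub> lift A A ?AA (\<lambda>u v. g (f u) \<diamondop>\<^bsub>?AA\<^esub> v) t"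
    proof (rule linear_map_eqI[of A A ?AA, OF _ _ _ _ linear_map_diff _ t])
      show "lift A A ?AA (\<lambda>u v. p u \<diamondop>\<^bsub>?AA\<^esub> v) (x \<diamondop>\<^bsub>?AA\<^esub> y) =
        x \<diamondop>\<^bsub>?AA\<^esub> y \<ominus>\<^bsub>?AA\<^esub> lift A A ?AA (\<lambda>u v. g (f u) \<diamondop>\<^bsub>?AA\<^esub> v) (x \<diamondop>\<^bsub>?AA\<^esub> y)"
        if xy: "x \<in> carrier A" "y \<in> carrier A" for x y
        using xy linear_map_minus[of A ?AA "\<lambda>w. w \<diamondop>\<^bsub>?AA\<^esub> y" x "g (f x)"] by (simp add: p_def[of x])
    qed simp_all
    then show "lift A A ?AA (\<lambda>u v. p u \<diamondop>\<^bsub>?AA\<^esub> v) t = t"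
      unfolding g0 using t by (simp add: AA.minus_eq)
  qed
qed

text \<open>The projection onto \<open>B\<close> gives a left inverse of \<open>B \<otimes> N \<rightarrow> A \<otimes> N\<close>, so equations in \<open>B \<otimes> N\<close> may be
  verified in \<open>A \<otimes> N\<close>.\<close>

lemma base_module_inclusion_inj:
  assumes N: "module K N" and t: "t \<in> carrier (tensor K base_module N)" "u \<in> carrier (tensor K base_module N)"
    and eq: "lift base_module N (tensor K A N) (\<lambda>b x. b \<diamondop>\<^bsub>tensor K A N\<^esub> x) t =
        lift base_module N (tensor K A N) (\<lambda>b x. b \<diamondop>\<^bsub>tensor K A N\<^esub> x) u"
  shows "t = u"
proof (rule base_projection)
  fix p assume p: "linear_map A base_module p" "\<And>b. b \<in> carrier base_module \<Longrightarrow> p b = b"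
  note [simp] = linear_map_rules(1,2)[OF p(1)] N
  show "t = u"
    using arg_cong[OF eq, of "lift A N (tensor K base_module N) (\<lambda>b x. p b \<diamondop>\<^bsub>tensor K base_module N\<^esub> x)"] t
    by (simp add: p(2))
qed

lemma lift_base_module_inclusion:
  assumes "module K N" "module K P" and G: "bilinear_map A N P G" and "t \<in> carrier (tensor K base_module N)"
  shows "lift base_module N P G t =
    lift A N P G (lift base_module N (tensor K A N) (\<lambda>b x. b \<diamondop>\<^bsub>tensor K A N\<^esub> x) t)"
proof -
  have [simp]: "linear_map base_module P (\<lambda>b. G b y)" if "y \<in> carrier N" for y
    using linear_map_comp[OF base_module_rules(3) bilinear_mapD(1)[OF G that]] .
  show ?thesis using assms bilinear_mapD[OF G] by simp
qed

end

section \<open>Equivariant projectivity\<close>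

context strong_connection_form
begin

lemmas connection_rules [simp] = linear_map_rules[OF connection_linear[folded linear_map_def]]

lemma connection_right_lift:
  assumes "module K P" "c \<in> carrier C" "trilinear_map A A C P F"
  shows "lift C C P (\<lambda>d e. lift A A P (\<lambda>x y. F x y e) (ell d)) (\<Delta> c) =
    lift A A P (\<lambda>x y. lift A C P (\<lambda>z e. F x z e) (\<rho> y)) (ell c)"
  using arg_cong[OF connection_right[OF assms(2)], of "lift A (tensor K A C) P (\<lambda>x d. lift A C P (F x) d)"]
    trilinear_mapD[OF assms(3)] assms(1,2)
  by (simp add: tensor_defs)

lemma connection_left_lift:
  assumes "module K P" "c \<in> carrier C" "trilinear_map C A A P F"
  shows "lift C C P (\<lambda>d e. lift A A P (\<lambda>x y. F d x y) (ell e)) (\<Delta> c) =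
    lift A A P (\<lambda>x y. lift C A P (\<lambda>d z. F d z y) (lambda x)) (ell c)"
  using arg_cong[OF connection_left[OF assms(2)], of "lift C (tensor K A A) P (\<lambda>x d. lift A A P (F x) d)"]
    trilinear_mapD[OF assms(3)] assms(1,2)
  by (simp add: tensor_defs)

text \<open>Apply the counit to the defining property of the connection under the lifted canonical map.\<close>

lemma product_connection_form:
  assumes "c \<in> carrier C"
  shows "lift A A A (\<lambda>x y. x \<otimes>\<^bsub>A\<^esub> y) (ell c) = \<epsilon> c \<odot>\<^bsub>A\<^esub> \<one>\<^bsub>A\<^esub>"
proof -
  have "lift A C A (\<lambda>y d. \<epsilon> d \<odot>\<^bsub>A\<^esub> (x \<otimes>\<^bsub>A\<^esub> y)) (\<rho> z) = x \<otimes>\<^bsub>A\<^esub> z"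
    if "x \<in> carrier A" "z \<in> carrier A" for x z
    using arg_cong[OF coaction_counit_lift[OF that(2)], of "\<lambda>y. x \<otimes>\<^bsub>A\<^esub> y"] that
    by (simp add: smult_mult_right)
  then show ?thesis
    using arg_cong[OF connection_can[OF assms], of "lift A C A (\<lambda>x d. \<epsilon> d \<odot>\<^bsub>A\<^esub> x)"] assms
    by (simp add: tensor_defs)
qed

text \<open>The right inverse \<open>a \<otimes> c \<mapsto> a ell c\<close> of the lifted canonical map.\<close>

definition lifted_inverse :: "('a, 'c) tensor \<Rightarrow> ('a, 'a) tensor" where
  "lifted_inverse w = lift A C (tensor K A A) (\<lambda>x c. lift A A (tensor K A A)
     (\<lambda>u v. (x \<otimes>\<^bsub>A\<^esub> u) \<diamondop>\<^bsub>tensor K A A\<^esub> v) (ell c)) w"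

lemma lifted_inverse_linear: "linear_map (tensor K A C) (tensor K A A) lifted_inverse"
  unfolding lifted_inverse_def by simp

text \<open>The candidate \<open>a \<mapsto> a\<^sub>0 ell a\<^sub>1\<close> for the equivariant section, with values still in \<open>A \<otimes> A\<close>.\<close>

definition sect :: "'a \<Rightarrow> ('a, 'a) tensor" where
  "sect a = lifted_inverse (\<rho> a)"

lemma sect_linear: "linear_map A (tensor K A A) sect"
  unfolding sect_def lifted_inverse_def by simp

lemmas sect_rules [simp] = linear_map_rules[OF sect_linear]

text \<open>The first leg of \<open>a\<^sub>0 ell a\<^sub>1\<close> satisfies the equation that characterises \<open>B\<close>. Its coaction is
  \<open>a\<^sub>0 \<psi> (a\<^sub>1 \<otimes> u)\<close> for \<open>u\<close> the first leg of \<open>ell a\<^sub>2\<close>; left colinearity replaces \<open>a\<^sub>1 \<otimes> u\<close> by \<open>\<lambda> u\<close>, and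
  \<open>\<psi> (\<lambda> u) = u \<rho> 1\<close>.\<close>

lemma sect_coaction:
  assumes a: "a \<in> carrier A"
  shows "lift A A (tensor K (tensor K A C) A) (\<lambda>u v. \<rho> u \<diamondop>\<^bsub>tensor K (tensor K A C) A\<^esub> v) (sect a) =
    lift A A (tensor K (tensor K A C) A) (\<lambda>u v. lift A C (tensor K A C)
      (\<lambda>x c. (u \<otimes>\<^bsub>A\<^esub> x) \<diamondop>\<^bsub>tensor K A C\<^esub> c) (\<rho> \<one>\<^bsub>A\<^esub>) \<diamondop>\<^bsub>tensor K (tensor K A C) A\<^esub> v) (sect a)"
proof -
  let ?AC = "tensor K A C" and ?P = "tensor K (tensor K A C) A"
  let ?R = "\<lambda>y d u v. lift A C ?P (\<lambda>z e. ((y \<otimes>\<^bsub>A\<^esub> z) \<diamondop>\<^bsub>?AC\<^esub> e) \<diamondop>\<^bsub>?P\<^esub> v) (\<psi> (d \<diamondop>\<^bsub>tensor K C A\<^esub> u))"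
  have left: "lift C A ?P (\<lambda>d z. ?R y d z v) (lambda u) =
      lift A C ?P (\<lambda>x e. ((y \<otimes>\<^bsub>A\<^esub> (u \<otimes>\<^bsub>A\<^esub> x)) \<diamondop>\<^bsub>?AC\<^esub> e) \<diamondop>\<^bsub>?P\<^esub> v) (\<rho> \<one>\<^bsub>A\<^esub>)"
    if "y \<in> carrier A" "u \<in> carrier A" "v \<in> carrier A" for y u v
  proof -
    have "lift C A ?P (\<lambda>d z. ?R y d z v) (lambda u) =
        lift A C ?P (\<lambda>z e. ((y \<otimes>\<^bsub>A\<^esub> z) \<diamondop>\<^bsub>?AC\<^esub> e) \<diamondop>\<^bsub>?P\<^esub> v) (\<psi> (lambda u))"
      by (rule lift_linear_map_pure[where h="\<lambda>w. lift A C ?P (\<lambda>z e. ((y \<otimes>\<^bsub>A\<^esub> z) \<diamondop>\<^bsub>?AC\<^esub> e) \<diamondop>\<^bsub>?P\<^esub> v) (\<psi> w)"])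
        (use that in simp_all)
    then show ?thesis using that by (simp add: entwining_left_coaction)
  qed
  have "lift A A ?P (\<lambda>u v. \<rho> u \<diamondop>\<^bsub>?P\<^esub> v) (sect a) =
      lift A C ?P (\<lambda>x c. lift A A ?P (\<lambda>u v. lift A C ?P (\<lambda>y d. ?R y d u v) (\<rho> x)) (ell c)) (\<rho> a)"
    using a by (simp add: sect_def lifted_inverse_def coaction_mult_lift)
  also have "\<dots> = lift A C ?P (\<lambda>x c. lift A C ?P (\<lambda>y d. lift A A ?P (\<lambda>u v. ?R y d u v) (ell c)) (\<rho> x)) (\<rho> a)"
    by (intro tensor_lift_cong refl lift_commute) (use a in simp_all)
  also have "\<dots> = lift A C ?P (\<lambda>y c. lift C C ?P (\<lambda>d e. lift A A ?P (\<lambda>u v. ?R y d u v) (ell e)) (\<Delta> c)) (\<rho> a)"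
    by (rule coaction_coassoc_lift) (use a in simp_all)
  also have "\<dots> = lift A C ?P (\<lambda>y c. lift A A ?P (\<lambda>u v. lift C A ?P (\<lambda>d z. ?R y d z v) (lambda u)) (ell c)) (\<rho> a)"
    by (intro tensor_lift_cong refl connection_left_lift) (use a in simp_all)
  also have "\<dots> = lift A A ?P (\<lambda>u v. lift A C ?AC (\<lambda>x c. (u \<otimes>\<^bsub>A\<^esub> x) \<diamondop>\<^bsub>?AC\<^esub> c) (\<rho> \<one>\<^bsub>A\<^esub>) \<diamondop>\<^bsub>?P\<^esub> v) (sect a)"
    using a by (simp add: sect_def lifted_inverse_def left A.m_assoc)
  finally show ?thesis .
qed

lemma sect_colinear:
  assumes "module K P" "a \<in> carrier A" "trilinear_map A A C P F"
  shows "lift A C P (\<lambda>x c. lift A A P (\<lambda>u v. F u v c) (sect x)) (\<rho> a) =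
    lift A A P (\<lambda>u v. lift A C P (\<lambda>z c. F u z c) (\<rho> v)) (sect a)"
proof -
  have F1: "linear_map X P (\<lambda>x. F (h x) y z)" if "linear_map X A h" "y \<in> carrier A" "z \<in> carrier C" for X h y z
    using linear_map_comp[OF that(1) trilinear_mapD(1)[OF assms(3) that(2,3)]] .
  note [simp] = assms(1,2) trilinear_mapD[OF assms(3)] F1
  have "lift A C P (\<lambda>x c. lift A A P (\<lambda>u v. F u v c) (sect x)) (\<rho> a) =
      lift A C P (\<lambda>x c. lift A C P (\<lambda>y d. lift A A P (\<lambda>u v. F (y \<otimes>\<^bsub>A\<^esub> u) v c) (ell d)) (\<rho> x)) (\<rho> a)"
    by (simp add: sect_def lifted_inverse_def)
  also have "\<dots> = lift A C P (\<lambda>y d. lift C C P (\<lambda>e c. lift A A P (\<lambda>u v. F (y \<otimes>\<^bsub>A\<^esub> u) v c) (ell e)) (\<Delta> d)) (\<rho> a)"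
    by (rule coaction_coassoc_lift) simp_all
  also have "\<dots> = lift A C P (\<lambda>y d. lift A A P (\<lambda>u v. lift A C P (\<lambda>z c. F (y \<otimes>\<^bsub>A\<^esub> u) z c) (\<rho> v)) (ell d)) (\<rho> a)"
    by (intro tensor_lift_cong refl connection_right_lift) simp_all
  also have "\<dots> = lift A A P (\<lambda>u v. lift A C P (\<lambda>z c. F u z c) (\<rho> v)) (sect a)"
    by (simp add: sect_def lifted_inverse_def)
  finally show ?thesis .
qed

lemma sect_base_linear:
  assumes "b \<in> B" "a \<in> carrier A"
  shows "sect (b \<otimes>\<^bsub>A\<^esub> a) = lift A A (tensor K A A) (\<lambda>u v. (b \<otimes>\<^bsub>A\<^esub> u) \<diamondop>\<^bsub>tensor K A A\<^esub> v) (sect a)"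
  using assms subsetD[OF base_closed(1) assms(1)] by (simp add: sect_def lifted_inverse_def coaction_base_mult A.m_assoc)

lemma product_sect:
  assumes "a \<in> carrier A"
  shows "lift A A A (\<lambda>x y. x \<otimes>\<^bsub>A\<^esub> y) (sect a) = a"
proof -
  have "lift A A A (\<lambda>x y. x \<otimes>\<^bsub>A\<^esub> y) (sect a) =
      lift A C A (\<lambda>z c. z \<otimes>\<^bsub>A\<^esub> lift A A A (\<lambda>x y. x \<otimes>\<^bsub>A\<^esub> y) (ell c)) (\<rho> a)"
    using assms by (simp add: sect_def lifted_inverse_def A.m_assoc)
  then show ?thesis
    using assms by (simp add: product_connection_form smult_mult_right coaction_counit_lift)
qed

text \<open>Projecting the first leg to \<open>B\<close> does not change \<open>sect a\<close>, by \<open>sect_coaction\<close>.\<close>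

lemma base_section:
  obtains s where "linear_map A (tensor K base_module A) s"
    and "\<And>a. a \<in> carrier A \<Longrightarrow>
      lift base_module A (tensor K A A) (\<lambda>b x. b \<diamondop>\<^bsub>tensor K A A\<^esub> x) (s a) = sect a"
proof (rule base_projection)
  fix p assume p: "linear_map A base_module p"
    and p_id: "\<And>t. \<lbrakk>t \<in> carrier (tensor K A A);
       lift A A (tensor K (tensor K A C) A) (\<lambda>u v. \<rho> u \<diamondop>\<^bsub>tensor K (tensor K A C) A\<^esub> v) t =
       lift A A (tensor K (tensor K A C) A) (\<lambda>u v. lift A C (tensor K A C)
         (\<lambda>x c. (u \<otimes>\<^bsub>A\<^esub> x) \<diamondop>\<^bsub>tensor K A C\<^esub> c) (\<rho> \<one>\<^bsub>A\<^esub>) \<diamondop>\<^bsub>tensor K (tensor K A C) A\<^esub> v) t\<rbrakk>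
      \<Longrightarrow> lift A A (tensor K A A) (\<lambda>u v. p u \<diamondop>\<^bsub>tensor K A A\<^esub> v) t = t"
  note [simp] = linear_map_rules(1,2)[OF p] linear_map_rules(1,2)[OF linear_map_comp[OF p base_module_rules(3)]]
  let ?s = "\<lambda>a. lift A A (tensor K base_module A) (\<lambda>u v. p u \<diamondop>\<^bsub>tensor K base_module A\<^esub> v) (sect a)"
  show thesis
  proof (rule that)
    show "linear_map A (tensor K base_module A) ?s" by simp
    show "lift base_module A (tensor K A A) (\<lambda>b x. b \<diamondop>\<^bsub>tensor K A A\<^esub> x) (?s a) = sect a"
      if "a \<in> carrier A" for a
      using p_id[OF sect_rules(1)[OF that] sect_coaction[OF that]] that by simp
  qed
qed

lemma equivariantly_projective_base: "equivariantly_projective K A C \<rho> B"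
proof -
  let ?B = base_module
  let ?BA = "tensor K base_module A" and ?AA = "tensor K A A"
  obtain s where s: "linear_map A ?BA s"
    and incl_s: "\<And>a. a \<in> carrier A \<Longrightarrow> lift ?B A ?AA (\<lambda>b x. b \<diamondop>\<^bsub>?AA\<^esub> x) (s a) = sect a"
    using base_section by blast
  note [simp] = linear_map_rules(1,2)[OF s]
  have lift_s: "lift ?B A P G (s a) = lift A A P G (sect a)"
    if "module K P" "bilinear_map A A P G" "a \<in> carrier A" for P :: "('k, 'p) module" and G a
    using that by (simp add: lift_base_module_inclusion[of A P G] incl_s)
  have s': "s \<in> linear_maps K A ?BA" using s by (simp add: linear_map_def)
  have base_lin: "s (b \<otimes>\<^bsub>A\<^esub> a) = left_mult K ?B A b (s a)" if b: "b \<in> B" and a: "a \<in> carrier A" for b a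
  proof (rule base_module_inclusion_inj[OF A_module])
    have b': "b \<in> carrier ?B" using b by (simp only: carrier_base_module)
    then have bA: "b \<in> carrier A" by simp
    show "s (b \<otimes>\<^bsub>A\<^esub> a) \<in> carrier ?BA" "left_mult K ?B A b (s a) \<in> carrier ?BA"
      using a b' by (simp_all add: tensor_defs)
    show "lift ?B A ?AA (\<lambda>b x. b \<diamondop>\<^bsub>?AA\<^esub> x) (s (b \<otimes>\<^bsub>A\<^esub> a)) =
        lift ?B A ?AA (\<lambda>b x. b \<diamondop>\<^bsub>?AA\<^esub> x) (left_mult K ?B A b (s a))"
      using a b' bA by (simp add: tensor_defs lift_s sect_base_linear[OF b])
  qed
  have colin: "assoc_right K ?B A C (tensor_map K A C ?BA C s id (\<rho> a)) =
      tensor_map K ?B A ?B (tensor K A C) id \<rho> (s a)" if a: "a \<in> carrier A" for a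
  proof (rule base_module_inclusion_inj[OF module_tensor[OF A_module C_module]])
    let ?P = "tensor K A (tensor K A C)"
    show "assoc_right K ?B A C (tensor_map K A C ?BA C s id (\<rho> a)) \<in> carrier (tensor K ?B (tensor K A C))"
      "tensor_map K ?B A ?B (tensor K A C) id \<rho> (s a) \<in> carrier (tensor K ?B (tensor K A C))"
      using a by (simp_all add: tensor_defs)
    have "lift A C ?P (\<lambda>x c. lift A A ?P (\<lambda>u v. u \<diamondop>\<^bsub>?P\<^esub> (v \<diamondop>\<^bsub>tensor K A C\<^esub> c)) (sect x)) (\<rho> a) =
        lift A A ?P (\<lambda>u v. lift A C ?P (\<lambda>z c. u \<diamondop>\<^bsub>?P\<^esub> (z \<diamondop>\<^bsub>tensor K A C\<^esub> c)) (\<rho> v)) (sect a)"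
      by (rule sect_colinear) (use a in simp_all)
    also have "\<dots> = lift A A ?P (\<lambda>u v. u \<diamondop>\<^bsub>?P\<^esub> lift A C (tensor K A C) (\<lambda>z c. z \<diamondop>\<^bsub>tensor K A C\<^esub> c) (\<rho> v)) (sect a)"
      using a by (simp del: lift_pure_eq)
    finally show "lift ?B (tensor K A C) ?P (\<lambda>b x. b \<diamondop>\<^bsub>?P\<^esub> x)
        (assoc_right K ?B A C (tensor_map K A C ?BA C s id (\<rho> a))) =
      lift ?B (tensor K A C) ?P (\<lambda>b x. b \<diamondop>\<^bsub>?P\<^esub> x) (tensor_map K ?B A ?B (tensor K A C) id \<rho> (s a))"
      using a by (simp add: tensor_defs lift_s)
  qed
  have split: "tensor_lift ?B A ?BA A (\<lambda>b x. b \<otimes>\<^bsub>A\<^esub> x) (s a) = a" if "a \<in> carrier A" for a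
    using that by (simp add: lift_s product_sect)
  show ?thesis
    unfolding equivariantly_projective_def Let_def base_module_def[symmetric]
    by (intro bexI[OF _ s'] conjI ballI base_lin colin split)
qed

section \<open>The canonical map\<close>

lemma base_actions: "balanced_actions B (monoid.mult A) (monoid.mult A) A A"
  using base_closed(1) A.abelian_group_axioms by (auto simp: balanced_actions_def)

lemma abelian_group_base_tensor: "abelian_group (base_tensor A B)"
  unfolding base_tensor_def by (rule balanced_tensor_facts(2)[OF base_actions])

lemma base_pure_closed [simp]:
  "\<lbrakk>x \<in> carrier A; y \<in> carrier A\<rbrakk> \<Longrightarrow> x \<diamondop>\<^bsub>base_tensor A B\<^esub> y \<in> carrier (base_tensor A B)"
  unfolding base_tensor_def by (rule balanced_tensor_facts(4)[OF base_actions])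

lemmas base_pure_add = pure_tensor_biadditive(1,2)[OF base_actions, folded base_tensor_def]
lemmas base_pure_balanced = pure_tensor_balanced[OF base_actions, folded base_tensor_def]
lemmas base_lift_hom = tensor_lift_hom[OF base_actions, folded base_tensor_def]
lemmas base_lift_pure = tensor_lift_pure[OF base_actions, folded base_tensor_def]

text \<open>The surjection \<open>A \<otimes> A \<rightarrow> A \<otimes>\<^sub>B A\<close>. It carries the lifted canonical map to the canonical map, so that
  statements about \<open>A \<otimes>\<^sub>B A\<close> can be proved in \<open>A \<otimes> A\<close>.\<close>

definition quotient_map :: "('a, 'a) tensor \<Rightarrow> ('a, 'a) tensor" where
  "quotient_map = tensor_lift A A (tensor K A A) (base_tensor A B) (\<lambda>x y. x \<diamondop>\<^bsub>base_tensor A B\<^esub> y)"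

text \<open>Scalars act through \<open>B\<close>, as \<open>s x = x (s 1)\<close> with \<open>s 1\<close> in \<open>B\<close>.\<close>

lemma base_pure_smult:
  assumes "x \<in> carrier A" "s \<in> carrier K" "y \<in> carrier A"
  shows "(s \<odot>\<^bsub>A\<^esub> x) \<diamondop>\<^bsub>base_tensor A B\<^esub> y = x \<diamondop>\<^bsub>base_tensor A B\<^esub> (s \<odot>\<^bsub>A\<^esub> y)"
proof -
  have s: "s \<odot>\<^bsub>A\<^esub> \<one>\<^bsub>A\<^esub> \<in> B"
    using A.submoduleE(4)[OF base_closed(3)] base_closed(2) assms by blast
  have "s \<odot>\<^bsub>A\<^esub> x = x \<otimes>\<^bsub>A\<^esub> (s \<odot>\<^bsub>A\<^esub> \<one>\<^bsub>A\<^esub>)" "s \<odot>\<^bsub>A\<^esub> y = (s \<odot>\<^bsub>A\<^esub> \<one>\<^bsub>A\<^esub>) \<otimes>\<^bsub>A\<^esub> y"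
    using assms by (simp_all add: smult_mult_left smult_mult_right)
  then show ?thesis using base_pure_balanced[OF assms(1) s assms(3)] by simp
qed

lemma quotient_map_hom: "quotient_map \<in> hom (add_monoid (tensor K A A)) (add_monoid (base_tensor A B))"
  and quotient_map_pure [simp]: "\<lbrakk>x \<in> carrier A; y \<in> carrier A\<rbrakk> \<Longrightarrow>
      quotient_map (x \<diamondop>\<^bsub>tensor K A A\<^esub> y) = x \<diamondop>\<^bsub>base_tensor A B\<^esub> y"
  unfolding quotient_map_def
  by (rule lift_hom lift_pure_hom; simp add: abelian_group_base_tensor base_pure_add base_pure_smult)+

lemma quotient_map_closed [simp]: "t \<in> carrier (tensor K A A) \<Longrightarrow> quotient_map t \<in> carrier (base_tensor A B)"
  and quotient_map_add: "\<lbrakk>t \<in> carrier (tensor K A A); u \<in> carrier (tensor K A A)\<rbrakk> \<Longrightarrow>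
      quotient_map (t \<oplus>\<^bsub>tensor K A A\<^esub> u) = quotient_map t \<oplus>\<^bsub>base_tensor A B\<^esub> quotient_map u"
  using quotient_map_hom by (auto simp: hom_def)

lemma quotient_map_surj:
  assumes "z \<in> carrier (base_tensor A B)"
  obtains t where "t \<in> carrier (tensor K A A)" "quotient_map t = z"
proof -
  interpret T: module K "tensor K A A" by simp
  interpret Q: abelian_group "base_tensor A B" by (rule abelian_group_base_tensor)
  have "\<exists>t\<in>carrier (tensor K A A). quotient_map t = z"
    using assms unfolding base_tensor_def
  proof (rule balanced_tensor_induct[OF base_actions], fold base_tensor_def)
    show "\<exists>t\<in>carrier (tensor K A A). quotient_map t = \<zero>\<^bsub>base_tensor A B\<^esub>"
      using quotient_map_add[OF T.zero_closed T.zero_closed] quotient_map_closed[OF T.zero_closed]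
      by (intro bexI[of _ "\<zero>\<^bsub>tensor K A A\<^esub>"]) auto
    show "\<exists>t\<in>carrier (tensor K A A). quotient_map t = x \<diamondop>\<^bsub>base_tensor A B\<^esub> y"
      if "x \<in> carrier A" "y \<in> carrier A" for x y
      using that by (intro bexI[of _ "x \<diamondop>\<^bsub>tensor K A A\<^esub> y"]) auto
    show "\<exists>w\<in>carrier (tensor K A A). quotient_map w = t \<oplus>\<^bsub>base_tensor A B\<^esub> u"
      if "\<exists>w\<in>carrier (tensor K A A). quotient_map w = t" "\<exists>w\<in>carrier (tensor K A A). quotient_map w = u" for t u
      using that quotient_map_add T.add.m_closed by metis
  qed
  then show thesis using that by blast
qed

lemma canonical_map_hom:
    "canonical_map K A C \<rho> B \<in> hom (add_monoid (base_tensor A B)) (add_monoid (tensor K A C))" (is ?hom)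
  and canonical_map_pure [simp]: "\<lbrakk>x \<in> carrier A; y \<in> carrier A\<rbrakk> \<Longrightarrow>
      canonical_map K A C \<rho> B (x \<diamondop>\<^bsub>base_tensor A B\<^esub> y) = left_mult K A C x (\<rho> y)"
proof -
  interpret AC: module K "tensor K A C" by simp
  let ?f = "\<lambda>x y. left_mult K A C x (\<rho> y)"
  have b: "bilinear_map A A (tensor K A C) ?f" unfolding tensor_defs by simp
  note D = bilinear_mapD[OF b]
  have f: "?f x y \<in> carrier (tensor K A C)"
    "?f (x \<oplus>\<^bsub>A\<^esub> x') y = ?f x y \<oplus>\<^bsub>tensor K A C\<^esub> ?f x' y"
    "?f x (y \<oplus>\<^bsub>A\<^esub> y') = ?f x y \<oplus>\<^bsub>tensor K A C\<^esub> ?f x y'"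
    if "x \<in> carrier A" "x' \<in> carrier A" "y \<in> carrier A" "y' \<in> carrier A" for x x' y y'
    using that D linear_map_add[OF D(1), of y x x'] linear_map_add[OF D(2), of x y y'] by auto
  have bal: "?f (x \<otimes>\<^bsub>A\<^esub> b) y = ?f x (b \<otimes>\<^bsub>A\<^esub> y)" if "x \<in> carrier A" "b \<in> B" "y \<in> carrier A" for x b y
    using that subsetD[OF base_closed(1) that(2)] by (simp add: tensor_defs coaction_base_mult A.m_assoc)
  show ?hom unfolding canonical_map_def
    by (rule base_lift_hom) (auto simp: f bal AC.abelian_group_axioms)
  show "canonical_map K A C \<rho> B (x \<diamondop>\<^bsub>base_tensor A B\<^esub> y) = ?f x y"
    if "x \<in> carrier A" "y \<in> carrier A"
    unfolding canonical_map_def using that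
    by (intro base_lift_pure) (auto simp: f bal AC.abelian_group_axioms)
qed

lemma lifted_can_linear: "linear_map (tensor K A A) (tensor K A C) (\<lambda>t. lifted_can K A C \<rho> t)"
  unfolding tensor_defs by simp

lemma canonical_quotient:
  assumes t: "t \<in> carrier (tensor K A A)"
  shows "canonical_map K A C \<rho> B (quotient_map t) = lifted_can K A C \<rho> t"
proof (rule tensor_hom_eqI[of A A "tensor K A C"])
  show "(\<lambda>t. canonical_map K A C \<rho> B (quotient_map t)) \<in> hom (add_monoid (tensor K A A)) (add_monoid (tensor K A C))"
    using hom_compose[OF quotient_map_hom canonical_map_hom] by (simp add: comp_def)
  show "lifted_can K A C \<rho> \<in> hom (add_monoid (tensor K A A)) (add_monoid (tensor K A C))"
    by (rule linear_map_hom[OF lifted_can_linear])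
  show "abelian_group (tensor K A C)" by (rule abelian_group_tensor) simp_all
qed (use t in \<open>simp_all add: tensor_defs\<close>)

lemma lifted_can_inverse:
  assumes "w \<in> carrier (tensor K A C)"
  shows "lifted_can K A C \<rho> (lifted_inverse w) = w"
proof (rule linear_map_eqI[of A C "tensor K A C" _ "\<lambda>w. w"])
  show "linear_map (tensor K A C) (tensor K A C) (\<lambda>w. lifted_can K A C \<rho> (lifted_inverse w))"
    by (rule linear_map_comp[OF lifted_inverse_linear lifted_can_linear])
  fix x c assume xc: "x \<in> carrier A" "c \<in> carrier C"
  let ?m = "lift A C (tensor K A C) (\<lambda>y d. (x \<otimes>\<^bsub>A\<^esub> y) \<diamondop>\<^bsub>tensor K A C\<^esub> d)"
  have "lifted_can K A C \<rho> (lifted_inverse (x \<diamondop>\<^bsub>tensor K A C\<^esub> c)) = ?m (lifted_can K A C \<rho> (ell c))"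
    using xc by (simp add: lifted_inverse_def tensor_defs A.m_assoc)
  also have "\<dots> = x \<diamondop>\<^bsub>tensor K A C\<^esub> c"
    using xc by (simp add: connection_can)
  finally show "lifted_can K A C \<rho> (lifted_inverse (x \<diamondop>\<^bsub>tensor K A C\<^esub> c)) = x \<diamondop>\<^bsub>tensor K A C\<^esub> c" .
qed (use assms in simp_all)

text \<open>For \<open>t = x \<otimes> y\<close> the left side is the class of \<open>x y\<^sub>0 ell y\<^sub>1\<close>. The first leg of \<open>y\<^sub>0 ell y\<^sub>1\<close> lies in \<open>B\<close>
  and may be moved to the second, where the product of the legs is \<open>y\<close>.\<close>

lemma quotient_inverse:
  assumes t: "t \<in> carrier (tensor K A A)"
  shows "quotient_map (lifted_inverse (lifted_can K A C \<rho> t)) = quotient_map t"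
proof (rule tensor_hom_eqI[of A A "base_tensor A B" "\<lambda>t. quotient_map (lifted_inverse (lifted_can K A C \<rho> t))"
      quotient_map])
  interpret Q: abelian_group "base_tensor A B" by (rule abelian_group_base_tensor)
  show "(\<lambda>t. quotient_map (lifted_inverse (lifted_can K A C \<rho> t))) \<in> hom (add_monoid (tensor K A A)) (add_monoid (base_tensor A B))"
    using hom_compose[OF linear_map_hom[OF linear_map_comp[OF lifted_can_linear lifted_inverse_linear]] quotient_map_hom]
    by (simp add: comp_def)
  fix x y assume x: "x \<in> carrier A" and y: "y \<in> carrier A"
  let ?B = base_module and ?AA = "tensor K A A"
  obtain s where lin: "linear_map A (tensor K ?B A) s"
    and incl: "\<And>a. a \<in> carrier A \<Longrightarrow> lift ?B A ?AA (\<lambda>b z. b \<diamondop>\<^bsub>?AA\<^esub> z) (s a) = sect a"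
    using base_section by blast
  have s: "s y \<in> carrier (tensor K ?B A)" using lin y by (rule linear_map_closed)
  let ?h = "\<lambda>t. lift ?B A ?AA (\<lambda>b z. (x \<otimes>\<^bsub>A\<^esub> b) \<diamondop>\<^bsub>?AA\<^esub> z) t"
  let ?k = "\<lambda>t. lift ?B A A (\<lambda>b z. b \<otimes>\<^bsub>A\<^esub> z) t"
  have h: "linear_map (tensor K ?B A) ?AA ?h" and k: "linear_map (tensor K ?B A) A ?k"
    using x by simp_all
  have "quotient_map (?h (s y)) = x \<diamondop>\<^bsub>base_tensor A B\<^esub> ?k (s y)"
  proof (rule tensor_hom_eqI[of ?B A "base_tensor A B" "\<lambda>t. quotient_map (?h t)" "\<lambda>t. x \<diamondop>\<^bsub>base_tensor A B\<^esub> ?k t"])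
    show "(\<lambda>t. quotient_map (?h t)) \<in> hom (add_monoid (tensor K ?B A)) (add_monoid (base_tensor A B))"
      using hom_compose[OF linear_map_hom[OF h] quotient_map_hom] by (simp add: comp_def)
    show "(\<lambda>t. x \<diamondop>\<^bsub>base_tensor A B\<^esub> ?k t) \<in> hom (add_monoid (tensor K ?B A)) (add_monoid (base_tensor A B))"
      by (intro homI) (simp_all add: x base_pure_add linear_map_closed[OF k] linear_map_add[OF k])
    show "quotient_map (?h (b \<diamondop>\<^bsub>tensor K ?B A\<^esub> z)) = x \<diamondop>\<^bsub>base_tensor A B\<^esub> ?k (b \<diamondop>\<^bsub>tensor K ?B A\<^esub> z)"
      if b: "b \<in> carrier ?B" and z: "z \<in> carrier A" for b z
      using b x z base_pure_balanced[OF x b[unfolded carrier_base_module] z] by simp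
  qed (use s in \<open>simp_all add: Q.abelian_group_axioms\<close>)
  moreover have "?h (s y) = lift A A ?AA (\<lambda>b z. (x \<otimes>\<^bsub>A\<^esub> b) \<diamondop>\<^bsub>?AA\<^esub> z) (lift ?B A ?AA (\<lambda>b z. b \<diamondop>\<^bsub>?AA\<^esub> z) (s y))"
    by (rule lift_base_module_inclusion) (use x s in simp_all)
  then have "lifted_inverse (lifted_can K A C \<rho> (x \<diamondop>\<^bsub>?AA\<^esub> y)) = ?h (s y)"
    unfolding incl[OF y] using x y by (simp add: sect_def lifted_inverse_def tensor_defs A.m_assoc)
  moreover have "?k (s y) = y"
    using y by (simp add: lift_base_module_inclusion[of A A] s incl product_sect)
  ultimately show "quotient_map (lifted_inverse (lifted_can K A C \<rho> (x \<diamondop>\<^bsub>?AA\<^esub> y))) = quotient_map (x \<diamondop>\<^bsub>?AA\<^esub> y)"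
    using x y by simp
qed (rule abelian_group_base_tensor quotient_map_hom t A_module)+

lemma canonical_map_bij:
  "bij_betw (canonical_map K A C \<rho> B) (carrier (base_tensor A B)) (carrier (tensor K A C))"
proof (rule bij_betwI')
  fix z z' assume z: "z \<in> carrier (base_tensor A B)" and z': "z' \<in> carrier (base_tensor A B)"
  obtain t where t: "t \<in> carrier (tensor K A A)" and zt: "quotient_map t = z"
    by (rule quotient_map_surj[OF z])
  obtain t' where t': "t' \<in> carrier (tensor K A A)" and zt': "quotient_map t' = z'"
    by (rule quotient_map_surj[OF z'])
  have can: "canonical_map K A C \<rho> B z = lifted_can K A C \<rho> t"
    "canonical_map K A C \<rho> B z' = lifted_can K A C \<rho> t'"
    unfolding zt[symmetric] zt'[symmetric] by (rule canonical_quotient[OF t] canonical_quotient[OF t'])+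
  have inv: "z = quotient_map (lifted_inverse (lifted_can K A C \<rho> t))"
    "z' = quotient_map (lifted_inverse (lifted_can K A C \<rho> t'))"
    unfolding quotient_inverse[OF t] quotient_inverse[OF t'] zt zt' by (rule refl)+
  show "(canonical_map K A C \<rho> B z = canonical_map K A C \<rho> B z') = (z = z')"
  proof
    assume "canonical_map K A C \<rho> B z = canonical_map K A C \<rho> B z'"
    then have "lifted_can K A C \<rho> t = lifted_can K A C \<rho> t'" unfolding can .
    then show "z = z'" by (subst inv(1), subst inv(2)) (rule arg_cong)
  qed (rule arg_cong)
next
  show "canonical_map K A C \<rho> B z \<in> carrier (tensor K A C)" if "z \<in> carrier (base_tensor A B)" for z
    using canonical_map_hom that by (auto simp: hom_def)
next
  fix w assume w: "w \<in> carrier (tensor K A C)"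
  have t: "lifted_inverse w \<in> carrier (tensor K A A)"
    by (rule linear_map_closed[OF lifted_inverse_linear w])
  show "\<exists>z\<in>carrier (base_tensor A B). w = canonical_map K A C \<rho> B z"
  proof
    show "w = canonical_map K A C \<rho> B (quotient_map (lifted_inverse w))"
      by (simp only: canonical_quotient[OF t] lifted_can_inverse[OF w])
  qed (rule quotient_map_closed[OF t])
qed

lemma base_right_mult_quotient:
  assumes a: "a \<in> carrier A" and t: "t \<in> carrier (tensor K A A)"
  shows "base_right_mult A B (quotient_map t) a =
    quotient_map (lift A A (tensor K A A) (\<lambda>x y. x \<diamondop>\<^bsub>tensor K A A\<^esub> (y \<otimes>\<^bsub>A\<^esub> a)) t)"
proof (rule tensor_hom_eqI[of A A "base_tensor A B" "\<lambda>t. base_right_mult A B (quotient_map t) a"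
      "\<lambda>t. quotient_map (lift A A (tensor K A A) (\<lambda>x y. x \<diamondop>\<^bsub>tensor K A A\<^esub> (y \<otimes>\<^bsub>A\<^esub> a)) t)"])
  let ?f = "\<lambda>x y. x \<diamondop>\<^bsub>base_tensor A B\<^esub> (y \<otimes>\<^bsub>A\<^esub> a)"
  have bal: "?f (x \<otimes>\<^bsub>A\<^esub> b) y = ?f x (b \<otimes>\<^bsub>A\<^esub> y)" if "x \<in> carrier A" "b \<in> B" "y \<in> carrier A" for x b y
    using that a subsetD[OF base_closed(1) that(2)] by (simp add: base_pure_balanced A.m_assoc)
  have "(\<lambda>z. base_right_mult A B z a) \<in> hom (add_monoid (base_tensor A B)) (add_monoid (base_tensor A B))"
    unfolding base_right_mult_def
    by (rule base_lift_hom) (use a in \<open>simp_all add: abelian_group_base_tensor base_pure_add A.l_distr bal\<close>)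
  from hom_compose[OF quotient_map_hom this]
  show "(\<lambda>t. base_right_mult A B (quotient_map t) a) \<in> hom (add_monoid (tensor K A A)) (add_monoid (base_tensor A B))"
    by (simp add: comp_def)
  have "linear_map (tensor K A A) (tensor K A A) (\<lambda>t. lift A A (tensor K A A) (\<lambda>x y. x \<diamondop>\<^bsub>tensor K A A\<^esub> (y \<otimes>\<^bsub>A\<^esub> a)) t)"
    using a by simp
  from hom_compose[OF linear_map_hom[OF this] quotient_map_hom]
  show "(\<lambda>t. quotient_map (lift A A (tensor K A A) (\<lambda>x y. x \<diamondop>\<^bsub>tensor K A A\<^esub> (y \<otimes>\<^bsub>A\<^esub> a)) t))
      \<in> hom (add_monoid (tensor K A A)) (add_monoid (base_tensor A B))"
    by (simp add: comp_def)
  show "base_right_mult A B (quotient_map (x \<diamondop>\<^bsub>tensor K A A\<^esub> y)) a =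
      quotient_map (lift A A (tensor K A A) (\<lambda>x y. x \<diamondop>\<^bsub>tensor K A A\<^esub> (y \<otimes>\<^bsub>A\<^esub> a)) (x \<diamondop>\<^bsub>tensor K A A\<^esub> y))"
    if "x \<in> carrier A" "y \<in> carrier A" for x y
  proof -
    have "base_right_mult A B (x \<diamondop>\<^bsub>base_tensor A B\<^esub> y) a = ?f x y"
      unfolding base_right_mult_def
      by (rule base_lift_pure) (use a that in \<open>simp_all add: abelian_group_base_tensor base_pure_add A.l_distr bal\<close>)
    then show ?thesis using a that by simp
  qed
qed (use t in \<open>simp_all add: abelian_group_base_tensor\<close>)

text \<open>The inverse of the canonical map sends \<open>1 \<otimes> c\<close> to the class of \<open>ell c\<close>. Multiplying its second leg
  by \<open>a\<close> and applying \<open>\<rho> (y a) = y\<^sub>0 \<psi> (y\<^sub>1 \<otimes> a)\<close> leaves \<open>\<psi> (c \<otimes> a)\<close>.\<close>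

lemma canonical_entwining_eq:
  assumes z: "z \<in> carrier (tensor K C A)"
  shows "canonical_entwining K A C \<rho> B z = \<psi> z"
proof -
  let ?can = "canonical_map K A C \<rho> B"
  have pure: "?can (base_right_mult A B (the_inv_into (carrier (base_tensor A B)) ?can (\<one>\<^bsub>A\<^esub> \<diamondop>\<^bsub>tensor K A C\<^esub> c)) a) =
      \<psi> (c \<diamondop>\<^bsub>tensor K C A\<^esub> a)" if c: "c \<in> carrier C" and a: "a \<in> carrier A" for c a
  proof -
    have inv: "the_inv_into (carrier (base_tensor A B)) ?can (\<one>\<^bsub>A\<^esub> \<diamondop>\<^bsub>tensor K A C\<^esub> c) = quotient_map (ell c)"
      by (rule the_inv_into_f_eq[OF bij_betw_imp_inj_on[OF canonical_map_bij]])
        (use c in \<open>simp_all add: canonical_quotient connection_can\<close>)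
    let ?G = "\<lambda>w. lift A C (tensor K A C) (\<lambda>z d. lift A C (tensor K A C)
      (\<lambda>y e. (z \<otimes>\<^bsub>A\<^esub> y) \<diamondop>\<^bsub>tensor K A C\<^esub> e) (\<psi> (d \<diamondop>\<^bsub>tensor K C A\<^esub> a))) w"
    have "lifted_can K A C \<rho> (lift A A (tensor K A A) (\<lambda>x y. x \<diamondop>\<^bsub>tensor K A A\<^esub> (y \<otimes>\<^bsub>A\<^esub> a)) (ell c)) =
        ?G (lifted_can K A C \<rho> (ell c))"
      using a c by (simp add: tensor_defs coaction_mult_lift A.m_assoc)
    also have "\<dots> = \<psi> (c \<diamondop>\<^bsub>tensor K C A\<^esub> a)"
      using a c by (simp add: connection_can)
    finally show ?thesis
      using a c by (simp add: inv base_right_mult_quotient canonical_quotient)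
  qed
  have "canonical_entwining K A C \<rho> B z = lift C A (tensor K A C) (\<lambda>c a. \<psi> (c \<diamondop>\<^bsub>tensor K C A\<^esub> a)) z"
    unfolding canonical_entwining_def by (rule tensor_lift_cong[OF pure refl])
  also have "\<dots> = \<psi> z"
    by (rule lift_linear_map_pure) (use z in simp_all)
  finally show ?thesis .
qed

lemma principal_extension_group_like:
  assumes e: "group_like K C \<Delta> \<epsilon> e" and one: "\<rho> \<one>\<^bsub>A\<^esub> = \<one>\<^bsub>A\<^esub> \<diamondop>\<^bsub>tensor K A C\<^esub> e"
  shows "principal_extension K A C \<Delta> \<epsilon> \<rho> B"
proof (intro principal_extension.intro comodule_and_algebra_axioms principal_extension_axioms.intro)
  have ec: "e \<in> carrier C" using e by (simp add: group_like_def)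
  show "B = coinvariants K A C \<rho>" by (rule base)
  show "bij_betw (canonical_entwining K A C \<rho> B) (carrier (tensor K C A)) (carrier (tensor K A C))"
    using entwining_bij by (rule bij_betw_cong[THEN iffD1, rotated]) (rule canonical_entwining_eq[symmetric])
  have "\<rho> a = canonical_entwining K A C \<rho> B (e \<diamondop>\<^bsub>tensor K C A\<^esub> a)" if "a \<in> carrier A" for a
  proof -
    have "\<rho> (\<one>\<^bsub>A\<^esub> \<otimes>\<^bsub>A\<^esub> a) = \<psi> (e \<diamondop>\<^bsub>tensor K C A\<^esub> a)"
      unfolding coaction_mult_lift[OF A.one_closed that] one using that ec by simp
    then show ?thesis using that ec canonical_entwining_eq[of "e \<diamondop>\<^bsub>tensor K C A\<^esub> a"] by simp
  qed
  then show "\<exists>e. group_like K C \<Delta> \<epsilon> e \<and>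
      (\<forall>a\<in>carrier A. \<rho> a = canonical_entwining K A C \<rho> B (e \<diamondop>\<^bsub>tensor K C A\<^esub> a))"
    using e by blast
qed (rule canonical_map_bij equivariantly_projective_base)+

end

theorem theorem4:
  fixes K :: "'k ring" and C :: "('k, 'c) module" and A :: "('k, 'a) module"
    and \<Delta> :: "'c \<Rightarrow> ('c, 'c) tensor" and \<epsilon> :: "'c \<Rightarrow> 'k"
    and \<rho> :: "'a \<Rightarrow> ('a, 'c) tensor" and \<psi> :: "('c, 'a) tensor \<Rightarrow> ('a, 'c) tensor"
    and B :: "'a set"
    and \<delta> :: "('c, 'c) tensor \<Rightarrow> 'k" and \<sigma> :: "'c \<Rightarrow> ('a, 'a) tensor"
    and \<gamma> :: "('c, 'a) tensor \<Rightarrow> 'a" and \<alpha> :: "('a, 'c) tensor \<Rightarrow> 'a"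
    and ell :: "'c \<Rightarrow> ('a, 'a) tensor"
  assumes "entwined_extension K A C \<Delta> \<epsilon> \<rho> \<psi> B"
    and "cointegral K C \<Delta> \<epsilon> \<delta>"
    and "lifted_can K A C \<rho> ` carrier (tensor K A A) = carrier (tensor K A C)"
    and "\<sigma> \<in> linear_maps K C (tensor K A A)"
    and "\<And>c. c \<in> carrier C \<Longrightarrow> lifted_can K A C \<rho> (\<sigma> c) = \<one>\<^bsub>A\<^esub> \<diamondop>\<^bsub>tensor K A C\<^esub> c"
    and "\<gamma> =
      unit_left K A
      \<circ> tensor_map K (tensor K C C) A (self_module K) A \<delta> id
      \<circ> assoc_left K C C A
      \<circ> tensor_map K C A C (tensor K C A) id (left_coaction K A C \<rho> \<psi>)"
    and "\<alpha> =
      unit_right K A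
      \<circ> tensor_map K A (tensor K C C) A (self_module K) id \<delta>
      \<circ> assoc_right K A C C
      \<circ> tensor_map K A C (tensor K A C) C \<rho> id"
    and "ell =
      tensor_map K (tensor K C A) (tensor K A C) A A \<gamma> \<alpha>
      \<circ> assoc_right K (tensor K C A) A C
      \<circ> tensor_map K (tensor K C (tensor K A A)) C (tensor K (tensor K C A) A) C (assoc_left K C A A) id
      \<circ> tensor_map K (tensor K C C) C (tensor K C (tensor K A A)) C
          (tensor_map K C C C (tensor K A A) id \<sigma>) id
      \<circ> tensor_map K C C (tensor K C C) C \<Delta> id
      \<circ> \<Delta>"
  shows "strong_connection_form K A C \<Delta> \<epsilon> \<rho> \<psi> B ell \<and>
    ((\<exists>e. group_like K C \<Delta> \<epsilon> e \<and> \<rho> \<one>\<^bsub>A\<^esub> = \<one>\<^bsub>A\<^esub> \<diamondop>\<^bsub>tensor K A C\<^esub> e) \<longrightarrow>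
      principal_extension K A C \<Delta> \<epsilon> \<rho> B)"
proof -
  interpret cointegral_connection K A C \<Delta> \<epsilon> \<rho> \<psi> B \<delta> \<sigma>
    using assms(1,2,4,5) by (intro cointegral_connection.intro cointegral_connection_axioms.intro)
  have \<gamma>: "\<gamma> (c \<diamondop>\<^bsub>tensor K C A\<^esub> a) = gamma c a" if "c \<in> carrier C" "a \<in> carrier A" for c a
    using that by (simp add: assms(6) gamma_def tensor_defs)
  have \<alpha>: "\<alpha> (a \<diamondop>\<^bsub>tensor K A C\<^esub> c) = alpha a c" if "c \<in> carrier C" "a \<in> carrier A" for c a
    using that by (simp add: assms(7) alpha_def tensor_defs)
  have \<gamma>_linear: "linear_map (tensor K C A) A \<gamma>" and \<alpha>_linear: "linear_map (tensor K A C) A \<alpha>"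
    unfolding assms(6,7) comp_def tensor_defs id_apply by simp_all
  note [simp] = linear_map_rules(1,2)[OF \<gamma>_linear] linear_map_rules(1,2)[OF \<alpha>_linear]
  have "ell c = connection c" if "c \<in> carrier C" for c
    using that by (simp add: assms(8) connection_def tensor_defs \<gamma> \<alpha>)
  then interpret strong: strong_connection_form K A C \<Delta> \<epsilon> \<rho> \<psi> B ell
    by (rule strong_connection_form_connection)
  show ?thesis
    using strong.strong_connection_form_axioms strong.principal_extension_group_like by blast
qed

end
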